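(* Let \[ f_0:=z^3 -xyz^2+(x^2+y^2-2)z -xy,\qquad f_1:=z^4-xyz^3+(x^2+y^2-3)z^2-xyz+1,\qquad f_2:=z^3-xyz^2+(x^2+y^2-1)z-xy, \] polynomials in $\mathbb{Z}[x,y,z]$ (the defining polynomials of the canonical components of the $\mathrm{SL}_2(\mathbb{C})$-character varieties of the two-bridge links $L_0=5^2_1=(8/3)$ (Whitehead link), $L_1=6^2_2=(10/3)$ and $L_2=6^2_3=(12/5)$, respectively). For $i=0,1,2$ define the Hasse-Weil zeta function \[ \zeta(L_i,s):=\zeta(f_i,s):=\prod_p \exp\left(\sum_{n=1}^{\infty}\frac{\#V(f_i)(\mathbb{F}_{p^n})}{n} (p^{-s})^n\right), \] where $p$ runs over all prime numbers and $V(f_i)(\mathbb{F}_{p^n}):=\{(a,b,c)\in(\mathbb{F}_{p^n})^3 \mid f_i(a,b,c)=0\}$. Then \begin{align*} \zeta(L_0,s)&=\zeta_{\mathbb{Q}(\sqrt{2})}(s-1)\, \zeta(s)^2\, \zeta(s-1)^2\, \zeta(s-2)\, (1 - 2^{1-s})^3 (1 - 2^{-s}),\\ \zeta(L_1,s)&=\zeta_{\mathbb{Q}(\sqrt{5})}(s-1)^2\, \zeta(s)^3\, \zeta(s-2)\,(1 - 2^{1-s})^{3}(1 + 2^{1-s})(1 - 2^{-s}),\\ \zeta(L_2,s)&=\zeta(s)^2\, \zeta(s-2)\, (1-2^{-s}). \end{align*}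
   Context: Here $\mathbb{F}_{p^n}$ denotes the finite field with $p^n$ elements, $\zeta_K(s)$ denotes the Dedekind zeta function of a number field $K$, and $\zeta(s)=\zeta_{\mathbb{Q}}(s)$ is the Riemann zeta function. The identities are identities of Euler products (valid for $\mathrm{Re}(s)$ sufficiently large). *)

theory Defs
  imports
    "HOL-Analysis.Analysis"
    "HOL-Algebra.Algebra"
    "HOL-Algebra.Algebraic_Closure_Type"
    "HOL-Library.Poly_Mapping"
begin

datatype var = VX | VY | VZ

text \<open>The ring \<open>\<int>[x,y,z]\<close>: an exponent vector is a function \<open>var \<Rightarrow>\<^sub>0 nat\<close>.\<close>

type_synonym zpoly = "(var \<Rightarrow>\<^sub>0 nat) \<Rightarrow>\<^sub>0 int"

definition indet :: "var \<Rightarrow> zpoly" where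
  "indet v = Poly_Mapping.single (Poly_Mapping.single v 1) 1"

definition f0 :: zpoly where
  "f0 = (let x = indet VX; y = indet VY; z = indet VZ in
     z ^ 3 - x * y * z ^ 2 + (x ^ 2 + y ^ 2 - 2) * z - x * y)"

definition f1 :: zpoly where
  "f1 = (let x = indet VX; y = indet VY; z = indet VZ in
     z ^ 4 - x * y * z ^ 3 + (x ^ 2 + y ^ 2 - 3) * z ^ 2 - x * y * z + 1)"

definition f2 :: zpoly where
  "f2 = (let x = indet VX; y = indet VY; z = indet VZ in
     z ^ 3 - x * y * z ^ 2 + (x ^ 2 + y ^ 2 - 1) * z - x * y)"

definition zpoly_eval :: "('a, 'm) ring_scheme \<Rightarrow> (var \<Rightarrow> 'a) \<Rightarrow> zpoly \<Rightarrow> 'a" where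
  "zpoly_eval R a f =
     (\<Oplus>\<^bsub>R\<^esub>m\<in>Poly_Mapping.keys f.
        [Poly_Mapping.lookup f m] \<cdot>\<^bsub>R\<^esub>
          (\<Otimes>\<^bsub>R\<^esub>v\<in>Poly_Mapping.keys m. a v [^]\<^bsub>R\<^esub> Poly_Mapping.lookup m v))"

definition points :: "zpoly \<Rightarrow> ('a, 'm) ring_scheme \<Rightarrow> ('a \<times> 'a \<times> 'a) set" where
  "points f R =
     {(a, b, c). a \<in> carrier R \<and> b \<in> carrier R \<and> c \<in> carrier R \<and>
        zpoly_eval R (case_var a b c) f = \<zero>\<^bsub>R\<^esub>}"

text \<open>
  For a prime power \<open>q\<close>, a field with \<open>q\<close> elements exists and is unique up to isomorphism, so
  the number of points over it does not depend on the choice.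
\<close>

definition finite_field :: "nat \<Rightarrow> nat ring" where
  "finite_field q = (SOME R. field R \<and> finite (carrier R) \<and> card (carrier R) = q)"

text \<open>The summation index is shifted: \<open>hasse_weil_term f s p n\<close> is the term of degree \<open>n + 1\<close>.\<close>

definition hasse_weil_term :: "zpoly \<Rightarrow> complex \<Rightarrow> nat \<Rightarrow> nat \<Rightarrow> complex" where
  "hasse_weil_term f s p n =
     of_nat (card (points f (finite_field (p ^ Suc n)))) / of_nat (Suc n) *
       (of_nat p powr (- s)) ^ Suc n"

definition hasse_weil_factor :: "zpoly \<Rightarrow> complex \<Rightarrow> nat \<Rightarrow> complex" where
  "hasse_weil_factor f s p =
     (if Factorial_Ring.prime p then exp (suminf (hasse_weil_term f s p)) else 1)"

definition hasse_weil_converges :: "zpoly \<Rightarrow> complex \<Rightarrow> bool" where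
  "hasse_weil_converges f s \<longleftrightarrow>
     (\<forall>p. Factorial_Ring.prime p \<longrightarrow> summable (hasse_weil_term f s p)) \<and>
     convergent_prod (hasse_weil_factor f s)"

definition hasse_weil_zeta :: "zpoly \<Rightarrow> complex \<Rightarrow> complex" where
  "hasse_weil_zeta f s = prodinf (hasse_weil_factor f s)"

text \<open>Number fields are taken as subfields of \<open>\<complex>\<close>.\<close>

definition ring_of_integers :: "complex set \<Rightarrow> complex ring" where
  "ring_of_integers K = ring_of_type_algebra\<lparr>carrier := {x \<in> K. algebraic_int x}\<rparr>"

definition quadratic_field :: "nat \<Rightarrow> complex set" where
  "quadratic_field d =
     generate_field (ring_of_type_algebra :: complex ring) {complex_of_real (sqrt (real d))}"

text \<open>
  The two Dirichlet series below represent the zeta functions for \<open>Re s > 1\<close> only; no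
  meromorphic continuation is involved.
\<close>

definition dedekind_zeta :: "complex set \<Rightarrow> complex \<Rightarrow> complex" where
  "dedekind_zeta K s =
     (\<Sum>\<^sub>\<infinity>I\<in>{I. ideal I (ring_of_integers K) \<and> I \<noteq> {0}}.
        of_nat (card (carrier (ring_of_integers K Quot I))) powr (- s))"

definition riemann_zeta :: "complex \<Rightarrow> complex" where
  "riemann_zeta s = (\<Sum>\<^sub>\<infinity>n\<in>{1::nat..}. of_nat n powr (- s))"

end

(*
  Each f_i equals z^e * (x - z y) * (z x - y) + g_i(z) with e in {0, 1}. For z^2 <> 1 the linear forms
  x - z y and z x - y are coordinates on the plane over F_q, so the fiber over z has q - 1 points, or
  2 q - 1 if g_i(z) = 0; the fibers over z = 1 and z = -1 are pairs of parallel lines (q odd), and f_1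
  has no point with z = 0. Counting the zeros of the g_i comes down to square roots of 2 and 5 in F_q,
  q = p^n, whose number is 1 + (d/p)^n by Euler's criterion. Every point count is then a sum of
  n-th powers, and the logarithmic series turns it into a product of geometric Euler factors.

  On the other side, the nonzero ideals of Z[w], w^2 = t w + c, are the lattices a (Z m + Z (b + w))
  with 0 <= b < m and m dividing b^2 + t b - c. Hence the Dedekind zeta function is zeta(2 s) times the
  Dirichlet series of the number of roots of b^2 + t b - c modulo m, which is multiplicative by the
  Chinese remainder theorem and is evaluated at prime powers by Hensel lifting.
*)

theory Submission
  imports Defs "HOL-Number_Theory.Number_Theory"
begin

section \<open>Euler products\<close>

text \<open>The prime 2 is exceptional: the fibers over z = 1 and z = -1 coincide, 2 becomes 0, and
  the two quadratic factors of z^4 - 3 z^2 + 1 merge. The factors in 2^(-s) of the theorem repair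
  this single Euler factor. The half-plane Re s > 3 is where zeta(s - 2), produced by the leading
  term q^2 of every count, converges absolutely. There s - 1 has real part above 2, which is where
  the trivial bound of m for the number of roots modulo m makes the Dirichlet series of the Dedekind
  zeta function converge absolutely. \<open>infsum\<close>, \<open>suminf\<close> and
  \<open>prodinf\<close> are total functions with meaningless values in the absence of convergence,
  so every rearrangement is backed by absolute summability; and a convergent product must not owe a
  limit 0 to nonzero factors, so a limit of partial products alone does not suffice.
  \<open>finite_field\<close> is a choice among rings on natural numbers, so nothing is known about
  it until a field with p^n elements exists. One is cut out of an algebraic closure of the integers
  modulo p as the fixed points of x -> x^(p^n).\<close>

definition smooth_numbers :: "nat set \<Rightarrow> nat set" where
  "smooth_numbers P = {n. n > 0 \<and> prime_factors n \<subseteq> P}"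

text \<open>The value 1 off the primes lets the product run over all natural numbers, the index set
  of \<open>has_prod\<close>.\<close>

definition euler_factor :: "(nat \<Rightarrow> complex) \<Rightarrow> nat \<Rightarrow> complex" where
  "euler_factor f p = (if Factorial_Ring.prime p then \<Sum>\<^sub>\<infinity>k. f (p ^ k) else 1)"

text \<open>Unique factorization, arranged for adjoining one prime: since
  \<open>p \<notin> P\<close>, the factor \<open>m\<close> is prime to \<open>p\<close> and
  \<open>k\<close> is recovered as the multiplicity of \<open>p\<close>.\<close>

lemma bij_betw_smooth_numbers_insert:
  assumes p: "Factorial_Ring.prime (p::nat)" and "p \<notin> P"
  shows "bij_betw (\<lambda>(m, k). m * p ^ k) (smooth_numbers P \<times> UNIV) (smooth_numbers (insert p P))"
  unfolding bij_betw_def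
proof
  have ndvd: "\<not> p dvd m" if "m \<in> smooth_numbers P" for m
    using that assms by (auto simp: smooth_numbers_def in_prime_factors_iff)
  show "inj_on (\<lambda>(m, k). m * p ^ k) (smooth_numbers P \<times> UNIV)"
  proof (rule inj_onI, clarify)
    fix m k m' k' assume m: "m \<in> smooth_numbers P" "m' \<in> smooth_numbers P"
      and eq: "m * p ^ k = m' * p ^ k'"
    have mult: "multiplicity p (m * p ^ k) = k" if "m \<in> smooth_numbers P" for m k
      using ndvd[OF that] p that
      by (subst prime_elem_multiplicity_mult_distrib)
        (auto simp: smooth_numbers_def not_dvd_imp_multiplicity_0 multiplicity_same_power')
    have "k = k'" using mult[OF m(1), of k] mult[OF m(2), of k'] eq by simp
    with eq p show "m = m' \<and> k = k'" by auto
  qed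
  show "(\<lambda>(m, k). m * p ^ k) ` (smooth_numbers P \<times> UNIV) = smooth_numbers (insert p P)"
  proof (intro equalityI subsetI)
    fix n assume "n \<in> (\<lambda>(m, k). m * p ^ k) ` (smooth_numbers P \<times> UNIV)"
    then obtain m k where "n = m * p ^ k" "m \<in> smooth_numbers P" by auto
    moreover have "q \<in> insert p P" if q: "Factorial_Ring.prime q" "q dvd m * p ^ k" for q
    proof (cases "q dvd m")
      case True
      thus ?thesis using q \<open>m \<in> smooth_numbers P\<close> by (auto simp: smooth_numbers_def prime_factors_dvd)
    next
      case False
      hence "q dvd p ^ k" using q by (metis prime_dvd_mult_iff)
      thus ?thesis using q p by (metis insertI1 prime_dvd_power primes_dvd_imp_eq)
    qed
    ultimately show "n \<in> smooth_numbers (insert p P)"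
      using p by (auto simp: smooth_numbers_def prime_gt_0_nat prime_factors_dvd)
  next
    fix n assume n: "n \<in> smooth_numbers (insert p P)"
    hence n0: "n \<noteq> 0" by (auto simp: smooth_numbers_def)
    obtain m where m: "n = p ^ multiplicity p n * m" "\<not> p dvd m"
      using multiplicity_decompose'[of n p] n0 p by (metis not_prime_unit mult.commute)
    have "m \<in> smooth_numbers P"
    proof -
      have "q \<in> P" if "q \<in> prime_factors m" for q
      proof -
        have "q dvd m" and q: "Factorial_Ring.prime q"
          using that by (simp_all add: in_prime_factors_iff)
        hence "q dvd p ^ multiplicity p n * m" by (intro dvd_mult)
        with m(1) have "q dvd n" by argo
        hence "q \<in> prime_factors n" using n0 q by (simp add: in_prime_factors_iff)
        moreover have "q \<noteq> p" using that m(2) by (auto simp: prime_factors_dvd)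
        ultimately show ?thesis using n by (auto simp: smooth_numbers_def)
      qed
      moreover have "m > 0" using m n0 by (metis gr0I mult_0_right)
      ultimately show ?thesis by (auto simp: smooth_numbers_def)
    qed
    thus "n \<in> (\<lambda>(m, k). m * p ^ k) ` (smooth_numbers P \<times> UNIV)"
      using m(1) by (auto intro!: image_eqI[of _ _ "(m, multiplicity p n)"] simp: mult.commute)
  qed
qed

text \<open>Serves for n^(-s), giving the Riemann zeta function, and for n^(-s) times the number of
  roots of b^2 + t b - c modulo n.\<close>

locale summable_multiplicative =
  fixes f :: "nat \<Rightarrow> complex"
  assumes at_1: "f 1 = 1"
    and mult: "\<And>m n. m > 0 \<Longrightarrow> n > 0 \<Longrightarrow> coprime m n \<Longrightarrow> f (m * n) = f m * f n"
    and abs_summable: "(\<lambda>n. norm (f n)) summable_on {1..}"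
begin

lemma norm_summable_subset: "A \<subseteq> {1..} \<Longrightarrow> (\<lambda>n. norm (f n)) summable_on A"
  by (rule summable_on_subset[OF abs_summable])

lemma summable_subset: "A \<subseteq> {1..} \<Longrightarrow> f summable_on A"
  by (rule abs_summable_summable[OF norm_summable_subset])

text \<open>Adjoining \<open>p\<close> multiplies the sum by its Euler factor: absolute summability
  allows the sum over the pairs (m, k) to be iterated, and m is coprime to p^k.\<close>

lemma infsum_smooth_numbers:
  assumes "finite P" "\<And>p. p \<in> P \<Longrightarrow> Factorial_Ring.prime p"
  shows "infsum f (smooth_numbers P) = (\<Prod>p\<in>P. euler_factor f p)"
  using assms
proof (induction rule: finite_induct)
  case empty
  have "smooth_numbers {} = {1}"
    by (auto simp: smooth_numbers_def set_mset_eq_empty_iff prime_factorization_empty_iff)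
  thus ?case using at_1 by simp
next
  case (insert p P)
  have p: "Factorial_Ring.prime p" using insert.prems by simp
  let ?S = "smooth_numbers P" and ?g = "\<lambda>(m, k). m * p ^ k"
  have bij: "bij_betw ?g (?S \<times> UNIV) (smooth_numbers (insert p P))"
    by (rule bij_betw_smooth_numbers_insert[OF p insert.hyps(2)])
  have "f summable_on smooth_numbers (insert p P)"
    by (rule summable_subset) (auto simp: smooth_numbers_def)
  hence sm: "(\<lambda>x. f (?g x)) summable_on (?S \<times> UNIV)"
    using summable_on_reindex_bij_betw[OF bij] by blast
  have fg: "f (m * p ^ k) = f m * f (p ^ k)" if "m \<in> ?S" for m k
  proof (rule mult)
    have "\<not> p dvd m" using that p insert.hyps(2) by (auto simp: smooth_numbers_def in_prime_factors_iff)
    thus "coprime m (p ^ k)" using p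
      by (metis coprime_commute coprime_power_right_iff prime_imp_coprime)
  qed (use that p in \<open>auto simp: smooth_numbers_def prime_gt_0_nat\<close>)
  have "infsum f (smooth_numbers (insert p P)) = infsum (\<lambda>x. f (?g x)) (?S \<times> UNIV)"
    by (rule infsum_reindex_bij_betw[OF bij, symmetric])
  also have "\<dots> = (\<Sum>\<^sub>\<infinity>m\<in>?S. \<Sum>\<^sub>\<infinity>k. f (m * p ^ k))"
    using infsum_Sigma_banach[OF sm] by simp
  also have "\<dots> = (\<Sum>\<^sub>\<infinity>m\<in>?S. f m * (\<Sum>\<^sub>\<infinity>k. f (p ^ k)))"
    by (rule infsum_cong) (simp add: fg infsum_cmult_right')
  also have "\<dots> = infsum f ?S * euler_factor f p"
    using p by (simp add: infsum_cmult_left' euler_factor_def)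
  finally show ?case using insert by simp
qed

text \<open>The product up to N is the sum over the numbers with all prime factors at most N. These
  include 1, ..., N, so the error is bounded by the tail of the absolute series.\<close>

lemma prod_euler_factor_tendsto:
  "(\<lambda>N. \<Prod>p\<le>N. euler_factor f p) \<longlonglongrightarrow> infsum f {1..}"
proof -
  define P where "P N = {p. Factorial_Ring.prime p \<and> p \<le> N}" for N :: nat
  have fin: "finite (P N)" for N by (rule finite_subset[of _ "{..N}"]) (auto simp: P_def)
  have prod: "(\<Prod>p\<le>N. euler_factor f p) = infsum f (smooth_numbers (P N))" for N
  proof -
    have "(\<Prod>p\<le>N. euler_factor f p) = (\<Prod>p\<in>P N. euler_factor f p)"
      by (rule prod.mono_neutral_right) (auto simp: P_def euler_factor_def)
    also have "\<dots> = infsum f (smooth_numbers (P N))"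
      by (rule infsum_smooth_numbers[symmetric]) (auto simp: P_def fin)
    finally show ?thesis .
  qed
  have bound: "norm (infsum f (smooth_numbers (P N)) - infsum f {1..})
      \<le> infsum (\<lambda>n. norm (f n)) {1..} - (\<Sum>n\<in>{1..N}. norm (f n))" for N
  proof -
    let ?S = "smooth_numbers (P N)"
    have sub: "?S \<subseteq> {1..}" by (auto simp: smooth_numbers_def)
    have sup: "{1..N} \<subseteq> ?S"
      by (auto simp: smooth_numbers_def P_def prime_factors_dvd dest!: dvd_imp_le)
    have "infsum f {1..} = infsum f (?S \<union> ({1..} - ?S))"
      by (rule arg_cong[of _ _ "infsum f"]) (use sub in auto)
    also have "\<dots> = infsum f ?S + infsum f ({1..} - ?S)"
      by (rule infsum_Un_disjoint) (auto intro!: summable_subset simp: smooth_numbers_def)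
    finally have "norm (infsum f ?S - infsum f {1..}) = norm (infsum f ({1..} - ?S))"
      by (simp add: norm_minus_commute)
    also have "\<dots> \<le> infsum (\<lambda>n. norm (f n)) ({1..} - ?S)"
      by (rule norm_infsum_bound) (rule norm_summable_subset, auto)
    also have "\<dots> \<le> infsum (\<lambda>n. norm (f n)) ({1..} - {1..N})"
      by (rule infsum_mono2) (use sup in \<open>auto intro!: norm_summable_subset\<close>)
    also have "\<dots> = infsum (\<lambda>n. norm (f n)) {1..} - (\<Sum>n\<in>{1..N}. norm (f n))"
    proof -
      have "infsum (\<lambda>n. norm (f n)) ({1..N} \<union> ({1..} - {1..N}))
        = infsum (\<lambda>n. norm (f n)) {1..N} + infsum (\<lambda>n. norm (f n)) ({1..} - {1..N})"
        by (rule infsum_Un_disjoint) (auto intro!: norm_summable_subset)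
      moreover have "{1..N} \<union> ({1..} - {1..N}) = {1..}" by auto
      ultimately show ?thesis by simp
    qed
    finally show ?thesis .
  qed
  have "(\<lambda>N. \<Sum>n\<in>{1..N}. norm (f n)) \<longlonglongrightarrow> infsum (\<lambda>n. norm (f n)) {1..}"
  proof -
    have "((\<lambda>n. norm (f n)) has_sum infsum (\<lambda>n. norm (f n)) {1..}) {1..}"
      using abs_summable by simp
    hence "((\<lambda>n. if n \<in> {1..} then norm (f n) else 0) has_sum infsum (\<lambda>n. norm (f n)) {1..}) UNIV"
      by (subst (asm) has_sum_cong_neutral[where T = UNIV]) auto
    from has_sum_imp_sums[OF this] have "(\<lambda>N. \<Sum>n\<le>N. if n \<in> {1..} then norm (f n) else 0)
       \<longlonglongrightarrow> infsum (\<lambda>n. norm (f n)) {1..}" by (simp add: sums_def_le)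
    moreover have "(\<Sum>n\<le>N. if n \<in> {1..} then norm (f n) else 0) = (\<Sum>n\<in>{1..N}. norm (f n))" for N
      by (rule sum.mono_neutral_cong_right) auto
    ultimately show ?thesis by simp
  qed
  hence "(\<lambda>N. infsum (\<lambda>n. norm (f n)) {1..} - (\<Sum>n\<in>{1..N}. norm (f n))) \<longlonglongrightarrow> 0"
    by (auto intro!: tendsto_eq_intros)
  hence "(\<lambda>N. infsum f (smooth_numbers (P N)) - infsum f {1..}) \<longlonglongrightarrow> 0"
    by (rule Lim_null_comparison[rotated]) (use bound in auto)
  thus ?thesis unfolding prod by (simp add: LIM_zero_iff)
qed

text \<open>The deviations of the factors from 1 are dominated by sums of the absolute series over
  disjoint sets of prime powers, so the product converges absolutely.\<close>

lemma convergent_prod_euler_factor: "convergent_prod (euler_factor f)"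
proof -
  let ?P = "{p::nat. Factorial_Ring.prime p}"
  \<comment> \<open>Exponents start at 1: exponent 0 would yield the number 1 for every prime and
    destroy injectivity.\<close>
  let ?g = "\<lambda>(p, k). p ^ Suc k"
  have inj: "inj_on ?g (?P \<times> UNIV)"
  proof (rule inj_onI, clarify)
    fix p k q l :: nat assume pq: "Factorial_Ring.prime p" "Factorial_Ring.prime q"
      and eq: "p ^ Suc k = q ^ Suc l"
    have "p dvd q ^ Suc l" unfolding eq[symmetric] by simp
    hence "p = q" using pq by (metis prime_dvd_power primes_dvd_imp_eq)
    thus "p = q \<and> k = l" using eq pq prime_gt_1_nat[of q] by (auto simp del: power_Suc)
  qed
  have sub: "?g ` (?P \<times> UNIV) \<subseteq> {1..}"
    by (auto simp: Suc_le_eq prime_gt_0_nat)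
  have "((\<lambda>n. norm (f n)) \<circ> ?g) summable_on (?P \<times> UNIV)"
    using norm_summable_subset[OF sub] summable_on_reindex[OF inj] by blast
  hence sm: "(\<lambda>(p, k). norm (f (p ^ Suc k))) summable_on (?P \<times> UNIV)"
    by (simp add: o_def case_prod_unfold)
  define G where "G p = (\<Sum>\<^sub>\<infinity>k. norm (f (p ^ Suc k)))" for p
  have smk: "(\<lambda>k. norm (f (p ^ Suc k))) summable_on UNIV" if "p \<in> ?P" for p
    using summable_on_SigmaD1[OF sm that] by simp
  have smG: "G summable_on ?P"
    unfolding G_def using summable_on_SigmaD[OF sm] smk by simp
  have bound: "norm (euler_factor f p - 1) \<le> G p" if "p \<in> ?P" for p
  proof -
    have smf: "(\<lambda>k. f (p ^ Suc k)) summable_on UNIV"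
      by (rule abs_summable_summable) (rule smk[OF that])
    have A: "(\<lambda>k. f (p ^ Suc k)) sums (\<Sum>\<^sub>\<infinity>k. f (p ^ Suc k))"
      by (rule has_sum_imp_sums) (use smf in simp)
    have smf': "(\<lambda>k. norm (f (p ^ k))) summable_on UNIV"
    proof -
      have p1: "p > 1" using that prime_gt_1_nat by simp
      have "inj (\<lambda>k. p ^ k)" by (rule injI) (use p1 in simp)
      moreover have "range (\<lambda>k. p ^ k) \<subseteq> {1..}"
        using p1 by (intro image_subsetI) simp
      ultimately have "((\<lambda>n. norm (f n)) \<circ> (\<lambda>k. p ^ k)) summable_on UNIV"
        using summable_on_reindex[of "\<lambda>k. p ^ k" UNIV "\<lambda>n. norm (f n)"]
          norm_summable_subset[of "range (\<lambda>k. p ^ k)"] by simp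
      thus ?thesis by (simp add: o_def)
    qed
    have B: "(\<lambda>k. f (p ^ k)) sums (\<Sum>\<^sub>\<infinity>k. f (p ^ k))"
      by (rule has_sum_imp_sums) (use abs_summable_summable[OF smf'] in simp)
    have "(\<lambda>k. f (p ^ k)) sums ((\<Sum>\<^sub>\<infinity>k. f (p ^ Suc k)) + f (p ^ 0))"
      by (rule sums_Suc[OF A])
    with B have "(\<Sum>\<^sub>\<infinity>k. f (p ^ k)) = (\<Sum>\<^sub>\<infinity>k. f (p ^ Suc k)) + f (p ^ 0)"
      by (rule sums_unique2)
    hence "euler_factor f p - 1 = (\<Sum>\<^sub>\<infinity>k. f (p ^ Suc k))"
      using that at_1 by (simp add: euler_factor_def)
    thus ?thesis unfolding G_def using norm_infsum_bound[OF smk[OF that]] by simp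
  qed
  have "(\<lambda>p. if p \<in> ?P then G p else 0) summable_on UNIV"
    using smG by (subst (asm) summable_on_cong_neutral[where T = UNIV]) auto
  hence "summable (\<lambda>p. if p \<in> ?P then G p else 0)" by (rule summable_on_imp_summable)
  hence "summable (\<lambda>p. norm (euler_factor f p - 1))"
    by (rule summable_comparison_test_ev[rotated])
      (use bound in \<open>auto intro!: always_eventually simp: euler_factor_def\<close>)
  thus ?thesis
    by (intro abs_convergent_prod_imp_convergent_prod summable_imp_abs_convergent_prod)
qed

theorem has_prod_euler_factor: "euler_factor f has_prod infsum f {1..}"
  by (intro convergent_prod_tendsto_imp_has_prod convergent_prod_euler_factor
      prod_euler_factor_tendsto)

end

section \<open>The series of n^(-s) and the logarithmic series\<close>

lemma abs_summable_on_nat_powr: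
  assumes "Re s > 1"
  shows "(\<lambda>n::nat. norm (of_nat n powr (- s) :: complex)) summable_on {1..}"
proof -
  have "summable (\<lambda>n. of_nat n powr (- Re s) :: real)"
    using assms by (simp add: summable_real_powr_iff)
  hence "(\<lambda>n. of_nat n powr (- Re s) :: real) summable_on UNIV"
    by (subst summable_on_UNIV_nonneg_real_iff) auto
  hence "(\<lambda>n. of_nat n powr (- Re s) :: real) summable_on {1..}"
    by (rule summable_on_subset) auto
  thus ?thesis
    by (rule summable_on_cong[THEN iffD1, rotated]) (auto simp: norm_powr_real_powr)
qed

lemma norm_nat_powr_less_1:
  assumes "Re s > 0" "p > 1"
  shows "norm (of_nat p powr (- s) :: complex) < 1"
  using assms by (simp add: norm_powr_real_powr powr_less_one)

lemma has_sum_geometric_complex: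
  assumes "norm (x :: complex) < 1"
  shows "((\<lambda>k. x ^ k) has_sum inverse (1 - x)) UNIV"
proof -
  have "summable (\<lambda>k. norm (x ^ k))" using assms by (simp add: norm_power summable_geometric)
  from norm_summable_imp_has_sum[OF this geometric_sums[OF assms]] show ?thesis
    by (simp add: field_simps)
qed

lemma of_nat_power_powr: "p > 0 \<Longrightarrow> of_nat (p ^ k) powr s = (of_nat p powr s) ^ k" for s :: complex
  by (induction k) (auto simp: powr_times_real)

lemma riemann_zeta_euler_product:
  assumes "Re s > 1"
  shows "(\<lambda>p. if Factorial_Ring.prime p then inverse (1 - of_nat p powr (- s)) else 1)
    has_prod riemann_zeta s"
proof -
  interpret summable_multiplicative "\<lambda>n. of_nat n powr (- s)"
    using abs_summable_on_nat_powr[OF assms] by unfold_locales (auto simp: powr_times_real)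
  have "euler_factor (\<lambda>n. of_nat n powr (- s)) =
      (\<lambda>p. if Factorial_Ring.prime p then inverse (1 - of_nat p powr (- s)) else 1)"
  proof
    fix p
    have "(\<Sum>\<^sub>\<infinity>k. of_nat (p ^ k) powr (- s)) = inverse (1 - of_nat p powr (- s))"
      if "Factorial_Ring.prime p"
      using that assms infsumI[OF has_sum_geometric_complex[OF norm_nat_powr_less_1[of s p]]]
      by (simp add: of_nat_power_powr prime_gt_0_nat prime_gt_Suc_0_nat del: of_nat_power)
    thus "euler_factor (\<lambda>n. of_nat n powr (- s)) p =
      (if Factorial_Ring.prime p then inverse (1 - of_nat p powr (- s)) else 1)"
      by (simp add: euler_factor_def del: of_nat_power)
  qed
  with has_prod_euler_factor show ?thesis by (simp add: riemann_zeta_def)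
qed

text \<open>Each term k a^n of the count contributes -k ln(1 - a x) to the logarithmic series. The
  multiplicities are integers because a negative one occurs, for \<open>f1\<close> at the prime
  2.\<close>

lemma exp_power_sum_series:
  fixes x :: complex and c :: "nat \<Rightarrow> complex"
  assumes "\<And>n. c n = (\<Sum>(k, a)\<leftarrow>L. of_int k * a ^ Suc n)"
    and "\<And>k a. (k, a) \<in> set L \<Longrightarrow> norm (a * x) < 1"
  obtains S where "(\<lambda>n. c n / of_nat (Suc n) * x ^ Suc n) sums S"
    and "exp S = (\<Prod>(k, a)\<leftarrow>L. (1 - a * x) powi (- k))"
  using assms
proof (induction L arbitrary: c thesis)
  case Nil
  show ?case by (rule Nil(1)[of 0]) (use Nil in simp_all)
next
  case (Cons ka L)
  obtain k a where ka: "ka = (k, a)" by (cases ka)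
  define c' where "c' n = (\<Sum>(k, a)\<leftarrow>L. of_int k * a ^ Suc n)" for n
  obtain S where S: "(\<lambda>n. c' n / of_nat (Suc n) * x ^ Suc n) sums S"
    "exp S = (\<Prod>(k, a)\<leftarrow>L. (1 - a * x) powi (- k))"
    using Cons.IH[of c'] Cons.prems(3) c'_def by auto
  have ax: "norm (a * x) < 1" using Cons.prems(3) ka by auto
  hence "norm (- (a * x)) < 1" by simp
  from Ln_series'[OF this] have "(\<lambda>n. - ((a * x) ^ n) / of_nat n) sums ln (1 - a * x)"
    by simp
  \<comment> \<open>The dropped term n = 0 is \<open>- 1 / 0\<close>, which is 0; the shift matches
    the index of \<open>hasse_weil_term\<close>.\<close>
  hence "(\<lambda>n. - ((a * x) ^ Suc n) / of_nat (Suc n)) sums ln (1 - a * x)"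
    by (subst sums_Suc_iff) simp
  hence 1: "(\<lambda>n. - of_int k * (- ((a * x) ^ Suc n) / of_nat (Suc n))) sums (- of_int k * ln (1 - a * x))"
    by (rule sums_mult)
  have c: "c n = of_int k * a ^ Suc n + c' n" for n
    using Cons.prems(2)[of n] by (simp add: ka c'_def)
  have "(\<lambda>n. c n / of_nat (Suc n) * x ^ Suc n) =
      (\<lambda>n. - of_int k * (- ((a * x) ^ Suc n) / of_nat (Suc n)) + c' n / of_nat (Suc n) * x ^ Suc n)"
    by (rule ext) (simp add: c power_mult_distrib add_divide_distrib ring_distribs mult_ac del: of_nat_Suc power_Suc)
  hence "(\<lambda>n. c n / of_nat (Suc n) * x ^ Suc n) sums (- of_int k * ln (1 - a * x) + S)"
    using sums_add[OF 1 S(1)] by simp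
  moreover have "exp (- of_int k * ln (1 - a * x) + S) = (\<Prod>(k, a)\<leftarrow>ka # L. (1 - a * x) powi (- k))"
  proof -
    have "1 - a * x \<noteq> 0" using ax by auto
    hence "exp (- of_int k * ln (1 - a * x)) = (1 - a * x) powi (- k)"
      using exp_power_int[of "ln (1 - a * x)" "- k"] by (simp add: mult.commute)
    thus ?thesis by (simp only: exp_add S(2) ka) simp
  qed
  ultimately show ?case by (rule Cons.prems(1))
qed

section \<open>Evaluation of integer polynomials in commutative rings\<close>

lemma poly_mapping_single_add_induct [case_names zero single add]:
  fixes f :: "'a \<Rightarrow>\<^sub>0 'b::monoid_add"
  assumes "P 0" "\<And>m c. P (Poly_Mapping.single m c)" "\<And>f g. P f \<Longrightarrow> P g \<Longrightarrow> P (f + g)"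
  shows "P f"
proof (induction f rule: update_induct)
  case const
  show ?case by (rule assms(1))
next
  case (update f k v)
  \<comment> \<open>\<open>k\<close> is not yet a key of \<open>f\<close>, so updating there amounts
    to adding.\<close>
  have "Poly_Mapping.update k v f = f + Poly_Mapping.single k v"
    using update by (intro poly_mapping_eqI)
      (auto simp: lookup_update lookup_add lookup_single in_keys_iff)
  thus ?case using update assms by simp
qed

text \<open>Running over all three variables instead of the keys makes the formula uniform in
  \<open>m\<close>, so that multiplying monomials simply adds exponents.\<close>

lemma (in cring) zpoly_monomial_eq:
  fixes m :: "var \<Rightarrow>\<^sub>0 nat"
  assumes "\<And>v. a v \<in> carrier R"
  shows "(\<Otimes>v\<in>Poly_Mapping.keys m. a v [^] Poly_Mapping.lookup m v) =
    a VX [^] Poly_Mapping.lookup m VX \<otimes> (a VY [^] Poly_Mapping.lookup m VY \<otimes>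
      a VZ [^] Poly_Mapping.lookup m VZ)"
proof -
  have "(\<Otimes>v\<in>Poly_Mapping.keys m. a v [^] Poly_Mapping.lookup m v) =
      (\<Otimes>v\<in>{VX, VY, VZ}. a v [^] Poly_Mapping.lookup m v)"
  proof (rule finprod_mono_neutral_cong_left)
    show "Poly_Mapping.keys m \<subseteq> {VX, VY, VZ}" using var.exhaust by blast
  qed (use assms in \<open>auto simp: in_keys_iff\<close>)
  thus ?thesis using assms by simp
qed

context cring
begin

lemma int_add_pow_zero: "[(0 :: int)] \<cdot>\<^bsub>R\<^esub> x = \<zero>"
  by (simp add: add_pow_int_ge)

lemma int_add_pow_one_add: "[(i + j)] \<cdot>\<^bsub>R\<^esub> \<one> = [i] \<cdot>\<^bsub>R\<^esub> \<one> \<oplus> [(j :: int)] \<cdot>\<^bsub>R\<^esub> \<one>"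
  by (rule add.int_pow_mult) simp

lemma int_add_pow_one_mult: "[(i * j)] \<cdot>\<^bsub>R\<^esub> \<one> = [i] \<cdot>\<^bsub>R\<^esub> \<one> \<otimes> [(j :: int)] \<cdot>\<^bsub>R\<^esub> \<one>"
proof -
  have "[i] \<cdot>\<^bsub>R\<^esub> \<one> \<otimes> [j] \<cdot>\<^bsub>R\<^esub> \<one> = [i] \<cdot>\<^bsub>R\<^esub> ([j] \<cdot>\<^bsub>R\<^esub> \<one>)" by (simp add: add_pow_ldistr_int)
  also have "\<dots> = [(i * j)] \<cdot>\<^bsub>R\<^esub> \<one>" using add.int_pow_pow[of \<one> i j] by (simp add: mult.commute)
  finally show ?thesis ..
qed

context
  fixes a :: "var \<Rightarrow> 'a"
  assumes a_closed [simp]: "\<And>v. a v \<in> carrier R"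
begin

lemma zpoly_eval_closed [simp]: "zpoly_eval R a f \<in> carrier R"
  unfolding zpoly_eval_def by (intro finsum_closed) (auto simp: zpoly_monomial_eq)

text \<open>A common index set is what allows two polynomials with different keys to be added term
  by term.\<close>

lemma zpoly_eval_superset:
  assumes "finite A" "Poly_Mapping.keys f \<subseteq> A"
  shows "zpoly_eval R a f = (\<Oplus>m\<in>A. [Poly_Mapping.lookup f m] \<cdot>\<^bsub>R\<^esub>
    (\<Otimes>v\<in>Poly_Mapping.keys m. a v [^] Poly_Mapping.lookup m v))"
  unfolding zpoly_eval_def using assms
  by (intro add.finprod_mono_neutral_cong_left) (auto simp: in_keys_iff zpoly_monomial_eq int_add_pow_zero)

lemma zpoly_eval_add: "zpoly_eval R a (f + g) = zpoly_eval R a f \<oplus> zpoly_eval R a g"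
proof -
  let ?A = "Poly_Mapping.keys f \<union> Poly_Mapping.keys g"
  have "zpoly_eval R a (f + g) = (\<Oplus>m\<in>?A. [Poly_Mapping.lookup (f + g) m] \<cdot>\<^bsub>R\<^esub>
    (\<Otimes>v\<in>Poly_Mapping.keys m. a v [^] Poly_Mapping.lookup m v))"
    by (rule zpoly_eval_superset) (auto simp: keys_add)
  also have "\<dots> = zpoly_eval R a f \<oplus> zpoly_eval R a g"
    by (subst (1 2) zpoly_eval_superset[of ?A])
      (auto simp: lookup_add add.int_pow_mult zpoly_monomial_eq simp flip: add.finprod_multf)
  finally show ?thesis .
qed

lemma zpoly_eval_single:
  "zpoly_eval R a (Poly_Mapping.single m c) = [c] \<cdot>\<^bsub>R\<^esub> (a VX [^] Poly_Mapping.lookup m VX \<otimes>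
    (a VY [^] Poly_Mapping.lookup m VY \<otimes> a VZ [^] Poly_Mapping.lookup m VZ))"
  by (subst zpoly_eval_superset[of "{m}"]) (auto simp: zpoly_monomial_eq)

lemma zpoly_eval_zero: "zpoly_eval R a 0 = \<zero>"
  by (simp add: zpoly_eval_def)

text \<open>Both sides are additive in each factor, so monomials suffice. With this, evaluation is a
  ring homomorphism and carries identities verified by \<open>algebra_simps\<close> in
  \<open>zpoly\<close> into every commutative ring.\<close>

lemma zpoly_eval_mult: "zpoly_eval R a (f * g) = zpoly_eval R a f \<otimes> zpoly_eval R a g"
proof (induction f rule: poly_mapping_single_add_induct)
  case zero
  show ?case by (simp add: zpoly_eval_zero)
next
  case (add f f')
  thus ?case by (simp add: zpoly_eval_add distrib_right l_distr)
next
  case (single m c)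
  show ?case
  proof (induction g rule: poly_mapping_single_add_induct)
    case zero
    show ?case by (simp add: zpoly_eval_zero)
  next
    case (add f f')
    thus ?case by (simp add: zpoly_eval_add distrib_left r_distr)
  next
    case (single n d)
    have pow: "[(c * d)] \<cdot>\<^bsub>R\<^esub> (u \<otimes> v) = ([c] \<cdot>\<^bsub>R\<^esub> u) \<otimes> ([d] \<cdot>\<^bsub>R\<^esub> v)"
      if "u \<in> carrier R" "v \<in> carrier R" for u v
    proof -
      have "([c] \<cdot>\<^bsub>R\<^esub> u) \<otimes> ([d] \<cdot>\<^bsub>R\<^esub> v) = [c] \<cdot>\<^bsub>R\<^esub> ([d] \<cdot>\<^bsub>R\<^esub> (u \<otimes> v))"
        using that by (subst add_pow_ldistr_int, simp_all, subst add_pow_rdistr_int, simp_all)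
      thus ?thesis using that add.int_pow_pow[of "u \<otimes> v" c d] by (simp add: mult.commute)
    qed
    define mon where "mon k = a VX [^] Poly_Mapping.lookup k VX \<otimes>
      (a VY [^] Poly_Mapping.lookup k VY \<otimes> a VZ [^] Poly_Mapping.lookup k VZ)"
      for k :: "var \<Rightarrow>\<^sub>0 nat"
    have "mon (m + n) = mon m \<otimes> mon n"
      by (simp add: mon_def lookup_add nat_pow_mult[symmetric] m_ac)
    moreover have "mon k \<in> carrier R" for k by (simp add: mon_def)
    ultimately show ?case
      by (simp add: mult_single zpoly_eval_single pow flip: mon_def)
  qed
qed

lemma zpoly_eval_one: "zpoly_eval R a 1 = \<one>"
  by (simp add: zpoly_eval_single flip: single_one)

lemma zpoly_eval_power: "zpoly_eval R a (f ^ n) = zpoly_eval R a f [^] n"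
  by (induction n) (simp_all add: zpoly_eval_one zpoly_eval_mult m_comm)

lemma zpoly_eval_indet: "zpoly_eval R a (indet v) = a v"
  by (cases v) (simp_all add: indet_def zpoly_eval_single lookup_single)

lemma zpoly_eval_of_int: "zpoly_eval R a (of_int k) = [k] \<cdot>\<^bsub>R\<^esub> \<one>"
proof -
  have "of_int k = (Poly_Mapping.single 0 k :: zpoly)"
    by (simp only: single_of_int[symmetric] of_int_eq_id id_apply)
  thus ?thesis by (simp add: zpoly_eval_single)
qed

lemma zpoly_eval_minus: "zpoly_eval R a (- f) = \<ominus> zpoly_eval R a f"
proof -
  have "zpoly_eval R a f \<oplus> zpoly_eval R a (- f) = \<zero>"
    using zpoly_eval_add[of f "- f"] by (simp add: zpoly_eval_zero)
  thus ?thesis by (simp add: sum_zero_eq_neg a_comm)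
qed

lemma zpoly_eval_diff: "zpoly_eval R a (f - g) = zpoly_eval R a f \<ominus> zpoly_eval R a g"
  using zpoly_eval_add[of f "- g"] by (simp add: zpoly_eval_minus a_minus_def)

lemmas zpoly_eval_simps = zpoly_eval_add zpoly_eval_diff zpoly_eval_minus zpoly_eval_mult
  zpoly_eval_power zpoly_eval_one zpoly_eval_zero zpoly_eval_indet

end

end

section \<open>The Frobenius map\<close>

lemma prime_dvd_power_add_diff:
  fixes x y :: "'a::comm_ring_1"
  assumes "Factorial_Ring.prime p"
  obtains g where "(x + y) ^ p = x ^ p + y ^ p + of_nat p * g"
proof -
  have dvd: "(of_nat p :: 'a) dvd of_nat n" if "p dvd n" for n
    using that by (auto elim!: dvdE)
  have "of_nat p dvd (\<Sum>k\<in>{1..<p}. of_nat (p choose k) * x ^ k * y ^ (p - k))"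
    by (intro dvd_sum dvd_mult2 dvd dvd_choose_prime)
      (use assms prime_gt_1_nat[OF assms] in auto)
  then obtain g where g: "(\<Sum>k\<in>{1..<p}. of_nat (p choose k) * x ^ k * y ^ (p - k)) = of_nat p * g"
    by (elim dvdE)
  have "{..p} = insert 0 (insert p {1..<p})" using prime_gt_0_nat[OF assms] by auto
  hence "(x + y) ^ p = x ^ p + y ^ p + of_nat p * g"
    using prime_gt_0_nat[OF assms] by (simp add: binomial_ring flip: g) 
  thus ?thesis by (rule that)
qed

context cring
begin

text \<open>
  The congruence holds in \<open>\<int>[x,y,z]\<close>, where the binomial theorem of the type class applies, and is
  transported to \<open>R\<close> by evaluation.
\<close>

lemma frobenius_add:
  assumes "Factorial_Ring.prime p" "[int p] \<cdot>\<^bsub>R\<^esub> \<one> = \<zero>" "x \<in> carrier R" "y \<in> carrier R"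
  shows "(x \<oplus> y) [^] p = x [^] p \<oplus> y [^] p"
proof -
  obtain g where g: "(indet VX + indet VY) ^ p = indet VX ^ p + indet VY ^ p + of_nat p * g"
    using prime_dvd_power_add_diff[OF assms(1)] .
  define a where "a = case_var x y y"
  have a: "a v \<in> carrier R" for v using assms by (cases v) (auto simp: a_def)
  have "zpoly_eval R a ((indet VX + indet VY) ^ p) =
      zpoly_eval R a (indet VX ^ p + indet VY ^ p + of_int (int p) * g)"
    by (simp add: g)
  hence "(a VX \<oplus> a VY) [^] p = a VX [^] p \<oplus> a VY [^] p"
    using a assms(2) by (simp only: zpoly_eval_simps zpoly_eval_of_int[OF a]) simp
  thus ?thesis by (simp add: a_def)
qed

lemma frobenius_power_add:
  assumes "Factorial_Ring.prime p" "[int p] \<cdot>\<^bsub>R\<^esub> \<one> = \<zero>" "x \<in> carrier R" "y \<in> carrier R"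
  shows "(x \<oplus> y) [^] (p ^ n) = x [^] (p ^ n) \<oplus> y [^] (p ^ n)"
  using assms(3,4)
proof (induction n)
  case (Suc n)
  thus ?case using frobenius_add[OF assms(1,2)]
    by (simp add: mult.commute[of p] flip: nat_pow_pow)
qed simp

text \<open>Additivity is applied to (x - y) + y, so the sign (-1)^(p^n), which depends on the
  parity of p, never has to be evaluated.\<close>

lemma frobenius_power_diff:
  assumes "Factorial_Ring.prime p" "[int p] \<cdot>\<^bsub>R\<^esub> \<one> = \<zero>" "x \<in> carrier R" "y \<in> carrier R"
  shows "(x \<ominus> y) [^] (p ^ n) = x [^] (p ^ n) \<ominus> y [^] (p ^ n)"
proof -
  have "x [^] (p ^ n) = ((x \<ominus> y) \<oplus> y) [^] (p ^ n)"
    using assms by (simp add: a_minus_def a_assoc l_neg)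
  also have "\<dots> = (x \<ominus> y) [^] (p ^ n) \<oplus> y [^] (p ^ n)"
    using assms by (intro frobenius_power_add) auto
  finally show ?thesis using assms by (simp add: a_minus_def a_assoc r_neg)
qed

end

section \<open>Existence of finite fields\<close>

lemma (in ring_hom_ring) hom_nat_add_pow:
  assumes "x \<in> carrier R"
  shows "h ([(n :: nat)] \<cdot>\<^bsub>R\<^esub> x) = [n] \<cdot>\<^bsub>S\<^esub> h x"
  using assms by (induction n) simp_all

lemma (in cring) minus_minus_minus_cancel:
  assumes "x \<in> carrier R" "y \<in> carrier R" "z \<in> carrier R"
  shows "x \<ominus> y = (x \<ominus> z) \<ominus> (y \<ominus> z)"
  using assms by algebra

text \<open>With x = T, s = T^2 and s v = T^q, divisibility of T^q - T by T^2 becomes divisibility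
  of T by T^2.\<close>

lemma (in cring) eq_mult_minus_if_minus_eq_mult:
  assumes "x \<in> carrier R" "s \<in> carrier R" "u \<in> carrier R" "v \<in> carrier R"
    and "s \<otimes> v \<ominus> x = s \<otimes> u"
  shows "x = s \<otimes> (v \<ominus> u)"
proof -
  have "x = s \<otimes> v \<ominus> (s \<otimes> v \<ominus> x)" using assms(1-4) by algebra
  also have "\<dots> = s \<otimes> v \<ominus> s \<otimes> u" by (simp add: assms(5))
  finally show ?thesis using assms(1-4) by algebra
qed

context algebraically_closed
begin

text \<open>The fixed points are the roots of X^q - X, which splits over \<open>L\<close>; once all
  roots are known to be simple, their number is the degree q.\<close>

lemma card_frobenius_fixed_points:
  assumes p: "Factorial_Ring.prime p" and char: "[int p] \<cdot>\<^bsub>L\<^esub> \<one> = \<zero>" and n: "n > 0"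
  shows "card {a \<in> carrier L. a [^] (p ^ n) = a} = p ^ n"
proof -
  define q where "q = p ^ n"
  have q: "q > 1" unfolding q_def by (rule one_less_power[OF prime_gt_1_nat[OF p] n])
  let ?P = "poly_ring L"
  interpret UP: domain ?P by (rule univ_poly_is_domain[OF carrier_is_subring])
  have hom: "ring_hom_ring L ?P poly_of_const"
    using canonical_embedding_ring_hom[OF carrier_is_subring] by simp
  have X: "X \<in> carrier ?P" by (rule var_closed[OF carrier_is_subring])
  have charP: "[int p] \<cdot>\<^bsub>?P\<^esub> \<one>\<^bsub>?P\<^esub> = \<zero>\<^bsub>?P\<^esub>"
  proof -
    interpret h: ring_hom_ring L ?P poly_of_const by (rule hom)
    have "[p] \<cdot>\<^bsub>?P\<^esub> \<one>\<^bsub>?P\<^esub> = poly_of_const ([p] \<cdot>\<^bsub>L\<^esub> \<one>)"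
      using h.hom_nat_add_pow[OF one_closed, of p] by simp
    also have "\<dots> = \<zero>\<^bsub>?P\<^esub>" using char by (simp add: add_pow_int_ge)
    finally show ?thesis by (simp add: add_pow_int_ge)
  qed
  define f where "f = X [^]\<^bsub>?P\<^esub> q \<ominus>\<^bsub>?P\<^esub> X"
  have f: "f \<in> carrier ?P" unfolding f_def using X by simp
  have eval_f: "eval f a = a [^] q \<ominus> a" if a: "a \<in> carrier L" for a
  proof -
    interpret ev: ring_hom_cring ?P L "\<lambda>f. eval f a"
      using eval_cring_hom[OF carrier_is_subring a] .
    show ?thesis unfolding f_def a_minus_def using X a
      by (simp add: eval_var)
  qed
  have deg: "degree f = q"
  proof -
    have dX: "degree (X [^]\<^bsub>?P\<^esub> q) = q"
      using polynomial_pow_degree[OF X, of q] by (simp add: var_def)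
    moreover have dX': "degree (\<ominus>\<^bsub>?P\<^esub> X) = 1"
      using univ_poly_a_inv_degree[OF carrier_is_subring X] by (simp add: var_def)
    ultimately have "degree (poly_add (X [^]\<^bsub>?P\<^esub> q) (\<ominus>\<^bsub>?P\<^esub> X)) = max q 1"
      using X q poly_add_degree_eq[OF carrier_is_subring, of "X [^]\<^bsub>?P\<^esub> q" "\<ominus>\<^bsub>?P\<^esub> X"]
      by (simp add: univ_poly_carrier)
    thus ?thesis using q by (simp add: f_def a_minus_def univ_poly_add)
  qed
  hence "f \<noteq> []" using q by auto
  have root: "is_root f a \<longleftrightarrow> a \<in> carrier L \<and> a [^] q = a" for a
    using \<open>f \<noteq> []\<close> eval_f by (auto simp: is_root_def)
  \<comment> \<open>\<open>X\<^sup>q - X = (X - a)\<^sup>q - (X - a)\<close> for every root \<open>a\<close>, so a double root would make \<open>(X - a)\<^sup>2\<close>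
    divide \<open>X - a\<close>.\<close>
  have le_1: "alg_mult f a \<le> 1" for a
  proof (rule ccontr)
    assume ge2: "\<not> alg_mult f a \<le> 1"
    hence "alg_mult f a > 0" by linarith
    hence "is_root f a" using alg_mult_gt_zero_iff_is_root[OF f] by simp
    hence a: "a \<in> carrier L" "a [^] q = a" using root by auto
    define T where "T = [\<one>, \<ominus> a]"
    have Tc: "T \<in> carrier ?P" unfolding T_def using a 
      by (simp add: univ_poly_carrier[symmetric] polynomial_def)
    have "T [^]\<^bsub>?P\<^esub> (2 :: nat) pdivides f"
      unfolding T_def using ge2 a f by (intro le_alg_mult_imp_pdivides) auto
    moreover have "f = T [^]\<^bsub>?P\<^esub> q \<ominus>\<^bsub>?P\<^esub> T"
    proof -
      interpret h: ring_hom_ring L ?P poly_of_const by (rule hom)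
      have "\<ominus>\<^bsub>?P\<^esub> poly_of_const a = map (\<lambda>a. \<ominus> a) (poly_of_const a)"
        using h.hom_closed[OF a(1)]
        by (intro univ_poly_a_inv_def'[OF carrier_is_subring]) simp
      hence T: "T = X \<ominus>\<^bsub>?P\<^esub> poly_of_const a"
        using a(1) by (auto simp: a_minus_def T_def var_def univ_poly_add poly_of_const_def)
      have "T [^]\<^bsub>?P\<^esub> q = X [^]\<^bsub>?P\<^esub> q \<ominus>\<^bsub>?P\<^esub> poly_of_const a [^]\<^bsub>?P\<^esub> q"
        unfolding T q_def using X a charP h.hom_closed
        by (intro UP.frobenius_power_diff p) auto
      also have "poly_of_const a [^]\<^bsub>?P\<^esub> q = poly_of_const a"
        using h.hom_nat_pow[OF a(1), of q] a(2) by simp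
      finally have "T [^]\<^bsub>?P\<^esub> q = X [^]\<^bsub>?P\<^esub> q \<ominus>\<^bsub>?P\<^esub> poly_of_const a" .
      moreover have "poly_of_const a \<in> carrier ?P" "X [^]\<^bsub>?P\<^esub> q \<in> carrier ?P"
        using a h.hom_closed X by auto
      ultimately show ?thesis
        unfolding f_def T using X
        UP.minus_minus_minus_cancel[of "X [^]\<^bsub>?P\<^esub> q" X "poly_of_const a"] by simp
    qed
    ultimately have "T [^]\<^bsub>?P\<^esub> (2 :: nat) divides\<^bsub>?P\<^esub> (T [^]\<^bsub>?P\<^esub> q \<ominus>\<^bsub>?P\<^esub> T)"
      by (simp add: pdivides_def)
    then obtain u where u: "u \<in> carrier ?P"
      "T [^]\<^bsub>?P\<^esub> q \<ominus>\<^bsub>?P\<^esub> T = T [^]\<^bsub>?P\<^esub> (2 :: nat) \<otimes>\<^bsub>?P\<^esub> u"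
      by (auto simp: factor_def)
    have "T [^]\<^bsub>?P\<^esub> q = T [^]\<^bsub>?P\<^esub> (2 :: nat) \<otimes>\<^bsub>?P\<^esub> T [^]\<^bsub>?P\<^esub> (q - 2)"
    proof -
      have "q = 2 + (q - 2)" using q by simp
      thus ?thesis using UP.nat_pow_mult[OF Tc, of 2 "q - 2"] by metis
    qed
    moreover have "T [^]\<^bsub>?P\<^esub> (2 :: nat) \<in> carrier ?P" "T [^]\<^bsub>?P\<^esub> (q - 2) \<in> carrier ?P"
      "T [^]\<^bsub>?P\<^esub> q \<in> carrier ?P" using Tc by auto
    ultimately have T2: "T = T [^]\<^bsub>?P\<^esub> (2 :: nat) \<otimes>\<^bsub>?P\<^esub> (T [^]\<^bsub>?P\<^esub> (q - 2) \<ominus>\<^bsub>?P\<^esub> u)"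
      using u Tc by (intro UP.eq_mult_minus_if_minus_eq_mult) simp_all
    have "T [^]\<^bsub>?P\<^esub> (2 :: nat) pdivides T"
      unfolding pdivides_def by (rule dividesI[OF _ T2]) (use u(1) Tc in simp)
    hence "degree (T [^]\<^bsub>?P\<^esub> (2 :: nat)) \<le> degree T"
      using Tc by (intro pdivides_imp_degree_le[OF carrier_is_subring]) (auto simp: T_def)
    thus False using polynomial_pow_degree[OF Tc, of 2] by (simp add: T_def)
  qed
  have "card (set_mset (roots f)) = size (roots f)"
  proof -
    have "count (roots f) x = 1" if "x \<in># roots f" for x
    proof -
      have "count (roots f) x \<le> 1" using alg_mult_eq_count_roots[OF f] le_1 by metis
      moreover have "count (roots f) x > 0" using that by simp
      ultimately show ?thesis by linarith
    qed
    thus ?thesis by (simp add: size_multiset_overloaded_eq)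
  qed
  also have "\<dots> = q" using roots_over_carrier[OF f] deg by (simp add: splitted_def)
  also have "set_mset (roots f) = {a \<in> carrier L. a [^] q = a}"
    using roots_mem_iff_is_root[OF f] root by auto
  finally show ?thesis by (simp add: q_def)
qed

lemma subfield_frobenius_fixed_points:
  assumes p: "Factorial_Ring.prime p" and char: "[int p] \<cdot>\<^bsub>L\<^esub> \<one> = \<zero>"
  shows "subfield {a \<in> carrier L. a [^] (p ^ n) = a} L"
proof -
  let ?S = "{a \<in> carrier L. a [^] (p ^ n) = a}"
  have p0: "p ^ n > 0" using prime_gt_0_nat[OF p] by simp
  have zero: "\<zero> [^] (p ^ n) = \<zero>" using p0 by (simp add: nat_pow_zero)
  have "subring ?S L"
  proof (rule subringI)
    fix h assume "h \<in> ?S"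
    moreover have "(\<zero> \<ominus> h) [^] (p ^ n) = \<zero> [^] (p ^ n) \<ominus> h [^] (p ^ n)"
      using \<open>h \<in> ?S\<close> by (intro frobenius_power_diff p char) auto
    ultimately show "\<ominus> h \<in> ?S" by (simp add: zero a_minus_def)
  next
    fix h1 h2 assume "h1 \<in> ?S" "h2 \<in> ?S"
    thus "h1 \<otimes> h2 \<in> ?S" "h1 \<oplus> h2 \<in> ?S"
      by (auto simp: nat_pow_distrib frobenius_power_add[OF p char])
  qed auto
  thus ?thesis
  proof (rule subfieldI')
    show "inv k \<in> ?S" if k: "k \<in> ?S - {\<zero>}" for k
    proof -
      have "k \<in> Units L" using k by (auto simp: field_Units)
      moreover have "inv k [^] (p ^ n) = inv (k [^] (p ^ n))"
        using \<open>k \<in> Units L\<close> k nat_pow_distrib[of k "inv k" "p ^ n"]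
        by (intro comm_inv_char[symmetric]) auto
      ultimately show ?thesis using k by auto
    qed
  qed
qed

end

text \<open>The field is the fixed field of x -> x^(p^n) in an algebraic closure of the integers
  modulo p. Being finite, its carrier injects into the naturals, and the structure is transported
  there to fit the type demanded by \<open>finite_field\<close>.\<close>

lemma exists_finite_field:
  assumes p: "Factorial_Ring.prime (p :: nat)" and n: "n > 0"
  shows "\<exists>R :: nat ring. field R \<and> finite (carrier R) \<and> card (carrier R) = p ^ n"
proof -
  interpret residues_prime p "residue_ring (int p)"
    using p by (simp add: residues_prime_def)
  let ?Z = "residue_ring (int p)"
  define L where "L = alg_closure"
  have L: "algebraic_closure L (indexed_const ` carrier ?Z)" and hom: "indexed_const \<in> ring_hom ?Z L"
    unfolding L_def by (rule alg_closureE)+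
  interpret L: algebraic_closure L "indexed_const ` carrier ?Z" by (rule L)
  have char: "[int p] \<cdot>\<^bsub>L\<^esub> \<one>\<^bsub>L\<^esub> = \<zero>\<^bsub>L\<^esub>"
  proof -
    interpret h: ring_hom_ring ?Z L indexed_const
      by (rule ring_hom_ringI2) (use hom ring_axioms L.ring_axioms in auto)
    have "[n] \<cdot>\<^bsub>?Z\<^esub> \<one>\<^bsub>?Z\<^esub> = int n mod int p" for n
      by (induction n) (simp_all add: res_add_eq res_one_eq res_zero_eq mod_simps add.commute)
    hence "[p] \<cdot>\<^bsub>?Z\<^esub> \<one>\<^bsub>?Z\<^esub> = \<zero>\<^bsub>?Z\<^esub>" by (simp add: res_zero_eq)
    moreover have "indexed_const ([p] \<cdot>\<^bsub>?Z\<^esub> \<one>\<^bsub>?Z\<^esub>) = [p] \<cdot>\<^bsub>L\<^esub> \<one>\<^bsub>L\<^esub>"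
      using h.hom_nat_add_pow[OF one_closed] by simp
    ultimately show ?thesis by (simp add: add_pow_int_ge)
  qed
  let ?S = "{a \<in> carrier L. a [^]\<^bsub>L\<^esub> (p ^ n) = a}"
  have card: "card ?S = p ^ n" by (rule L.card_frobenius_fixed_points[OF p char n])
  hence fin: "finite ?S" using prime_gt_0_nat[OF p] by (intro card_ge_0_finite) simp
  interpret S: field "L\<lparr>carrier := ?S\<rparr>"
    using L.subfield_iff(2)[OF L.subfield_frobenius_fixed_points[OF p char]] .
  obtain h :: "_ \<Rightarrow> nat" where h: "inj_on h ?S"
    using finite_imp_inj_to_nat_seg[OF fin] by blast
  show ?thesis
  proof (intro exI conjI)
    show "field (image_ring h (L\<lparr>carrier := ?S\<rparr>))"
      by (rule S.inj_imp_image_ring_is_field) (use h in simp)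
    show "finite (carrier (image_ring h (L\<lparr>carrier := ?S\<rparr>)))"
      using fin by (simp add: image_ring_carrier)
    show "card (carrier (image_ring h (L\<lparr>carrier := ?S\<rparr>))) = p ^ n"
      using h card by (simp add: image_ring_carrier card_image)
  qed
qed

section \<open>Square roots in finite fields\<close>

locale galois_field = field R for R (structure) +
  fixes p n :: nat
  assumes p_prime: "Factorial_Ring.prime p" and n_pos: "n > 0"
    and card_carrier: "card (carrier R) = p ^ n"
begin

definition "q = p ^ n"

lemma q_gt_1: "q > 1"
  unfolding q_def by (rule one_less_power[OF prime_gt_1_nat[OF p_prime] n_pos])

lemma finite_carrier [simp]: "finite (carrier R)"
  using card_carrier q_gt_1 unfolding q_def by (intro card_ge_0_finite) linarith

text \<open>The order p^n of the additive group annihilates 1, and a field has no nilpotents, so p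
  is 0. If k were 0 without p dividing it, Bezout would make 1 vanish.\<close>

lemma int_eq_zero_iff: "[(k :: int)] \<cdot>\<^bsub>R\<^esub> \<one> = \<zero> \<longleftrightarrow> int p dvd k"
proof -
  have "[(p ^ n)] \<cdot>\<^bsub>R\<^esub> \<one> = \<zero>"
    using add.pow_order_eq_1[OF one_closed] by (simp add: order_def card_carrier)
  hence "[int (p ^ n)] \<cdot>\<^bsub>R\<^esub> \<one> = \<zero>" by (simp add: add_pow_int_ge del: of_nat_power)
  moreover have "[(int p ^ k)] \<cdot>\<^bsub>R\<^esub> \<one> = ([int p] \<cdot>\<^bsub>R\<^esub> \<one>) [^] k" for k
    by (induction k) (simp_all add: int_add_pow_one_mult m_comm add_pow_int_ge)
  ultimately have "([int p] \<cdot>\<^bsub>R\<^esub> \<one>) [^] n = \<zero>" by simp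
  hence p: "[int p] \<cdot>\<^bsub>R\<^esub> \<one> = \<zero>"
  proof (rule contrapos_pp)
    assume "[int p] \<cdot>\<^bsub>R\<^esub> \<one> \<noteq> \<zero>"
    thus "([int p] \<cdot>\<^bsub>R\<^esub> \<one>) [^] n \<noteq> \<zero>" by (induction n) (simp_all add: integral_iff)
  qed
  show ?thesis
  proof
    assume "int p dvd k"
    then obtain j where "k = int p * j" by (elim dvdE)
    thus "[k] \<cdot>\<^bsub>R\<^esub> \<one> = \<zero>" by (simp add: int_add_pow_one_mult p)
  next
    assume k: "[k] \<cdot>\<^bsub>R\<^esub> \<one> = \<zero>"
    show "int p dvd k"
    proof (rule ccontr)
      assume "\<not> int p dvd k"
      hence "coprime (int p) k" using p_prime by (intro prime_imp_coprime) auto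
      then obtain a b where "a * int p + b * k = 1"
        by (metis bezout_int coprime_imp_gcd_eq_1)
      moreover have "[(a * int p + b * k)] \<cdot>\<^bsub>R\<^esub> \<one> = \<zero>"
        by (simp add: int_add_pow_one_add int_add_pow_one_mult p k)
      ultimately show False by (simp add: add_pow_int_ge)
    qed
  qed
qed

lemma int_eq_iff: "[(k :: int)] \<cdot>\<^bsub>R\<^esub> \<one> = [(l :: int)] \<cdot>\<^bsub>R\<^esub> \<one> \<longleftrightarrow> [k = l] (mod int p)"
proof -
  have "[k] \<cdot>\<^bsub>R\<^esub> \<one> = [(k - l)] \<cdot>\<^bsub>R\<^esub> \<one> \<oplus> [l] \<cdot>\<^bsub>R\<^esub> \<one>"
    using int_add_pow_one_add[of "k - l" l] by simp
  hence "[k] \<cdot>\<^bsub>R\<^esub> \<one> = [l] \<cdot>\<^bsub>R\<^esub> \<one> \<longleftrightarrow> [(k - l)] \<cdot>\<^bsub>R\<^esub> \<one> = \<zero>"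
    by simp
  thus ?thesis by (simp add: int_eq_zero_iff cong_iff_dvd_diff)
qed

lemma int_numeral: "[(1 :: int)] \<cdot>\<^bsub>R\<^esub> \<one> = \<one>" "[(- 1 :: int)] \<cdot>\<^bsub>R\<^esub> \<one> = \<ominus> \<one>"
  "[(2 :: int)] \<cdot>\<^bsub>R\<^esub> \<one> = \<one> \<oplus> \<one>"
  using int_add_pow_one_add[of 1 1]
  by (simp_all add: add_pow_int_ge add_pow_int_lt)

lemma one_add_one_eq_zero_iff: "\<one> \<oplus> \<one> = \<zero> \<longleftrightarrow> p = 2"
proof -
  have "int p dvd 2 \<longleftrightarrow> p = 2"
    using p_prime by (metis int_dvd_int_iff of_nat_numeral primes_dvd_imp_eq two_is_prime_nat dvd_refl)
  thus ?thesis using int_eq_zero_iff[of 2] int_numeral by simp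
qed

lemma int_power_eq: "[(k ^ m)] \<cdot>\<^bsub>R\<^esub> \<one> = ([(k :: int)] \<cdot>\<^bsub>R\<^esub> \<one>) [^] m"
  by (induction m) (simp_all add: int_numeral int_add_pow_one_mult m_comm)

text \<open>The unit group is cyclic of order q - 1. Stating this with powers in \<open>R\<close>
  itself spares later proofs the passage to the group structure.\<close>

lemma exists_generator:
  "\<exists>g\<in>carrier R. g \<noteq> \<zero> \<and> (\<forall>x\<in>carrier R - {\<zero>}. \<exists>i::nat. x = g [^] i) \<and>
    (\<forall>i::nat. g [^] i = \<one> \<longleftrightarrow> (q - 1) dvd i)"
proof -
  let ?M = "Multiplicative_Group.mult_of R"
  note simps = Multiplicative_Group.mult_of_simps
  obtain g where g: "g \<in> carrier ?M" "carrier ?M = {g [^] i |i::nat. i \<in> UNIV}"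
    using finite_field_mult_group_has_gen[OF finite_carrier] by (elim bexE)
  interpret G: group ?M by (rule field_mult_group)
  have fin: "finite (carrier ?M)" by (simp add: simps)
  have "carrier ?M = {g [^]\<^bsub>?M\<^esub> i |i. i \<in> {0..G.ord g - 1}}"
    unfolding g(2) G.ord_elems[OF fin g(1), symmetric] by (simp only: simps)
  also have "\<dots> = (\<lambda>i. g [^]\<^bsub>?M\<^esub> i) ` {0..G.ord g - 1}"
    by blast
  finally have "card (carrier ?M) = card {0..G.ord g - 1}"
    using G.ord_inj[OF g(1)] by (simp only: card_image)
  moreover have "card (carrier ?M) = q - 1"
    by (simp add: simps card_carrier q_def)
  ultimately have ord: "G.ord g = q - 1"
    using G.ord_ge_1[OF fin g(1)] q_gt_1 by simp
  have "\<forall>i::nat. g [^] i = \<one> \<longleftrightarrow> (q - 1) dvd i"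
    using G.pow_eq_id[OF g(1)] ord by (simp add: simps)
  moreover have "\<exists>i::nat. x = g [^] i" if "x \<in> carrier R - {\<zero>}" for x
  proof -
    have "x \<in> carrier ?M" using that by (simp add: simps)
    thus ?thesis unfolding g(2) by blast
  qed
  moreover have "g \<in> carrier R" "g \<noteq> \<zero>" using g(1) by (simp_all add: simps)
  ultimately show ?thesis by (intro bexI[of _ g] conjI ballI) simp_all
qed

lemma power_card_minus_1:
  assumes "x \<in> carrier R" "x \<noteq> \<zero>"
  shows "x [^] (q - 1) = \<one>"
proof -
  obtain g where g: "g \<in> carrier R" "g \<noteq> \<zero>" "\<forall>x\<in>carrier R - {\<zero>}. \<exists>i::nat. x = g [^] i"
      "\<forall>i::nat. g [^] i = \<one> \<longleftrightarrow> (q - 1) dvd i"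
    using exists_generator by (elim bexE conjE)
  obtain i where "x = g [^] (i::nat)" using g(3) assms by blast
  thus ?thesis using g(1) g(4)[rule_format, of "i * (q - 1)"] by (simp add: nat_pow_pow)
qed

lemma odd_q: "p \<noteq> 2 \<Longrightarrow> odd q"
proof -
  assume "p \<noteq> 2"
  hence "p > 2" using prime_ge_2_nat[OF p_prime] by linarith
  hence "odd p" by (rule prime_odd_nat[OF p_prime])
  thus "odd q" by (simp add: q_def)
qed

text \<open>Write q - 1 = 2 h and x = g^i with a generator g. Then x^h = 1 forces 2 h to divide i h,
  so i is even; conversely w^(2 h) = 1 for every nonzero w.\<close>

lemma power_half_eq_one_iff:
  assumes "p \<noteq> 2" "x \<in> carrier R" "x \<noteq> \<zero>"
  shows "x [^] ((q - 1) div 2) = \<one> \<longleftrightarrow> (\<exists>w\<in>carrier R. w \<otimes> w = x)"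
proof
  obtain h where h: "q - 1 = 2 * h" using odd_q[OF assms(1)] by (auto elim: oddE)
  hence half: "(q - 1) div 2 = h" by simp
  have "h > 0" using h q_gt_1 by linarith
  show "\<exists>w\<in>carrier R. w \<otimes> w = x" if "x [^] ((q - 1) div 2) = \<one>"
  proof -
    obtain g where g: "g \<in> carrier R" "g \<noteq> \<zero>" "\<forall>x\<in>carrier R - {\<zero>}. \<exists>i::nat. x = g [^] i"
      "\<forall>i::nat. g [^] i = \<one> \<longleftrightarrow> (q - 1) dvd i"
    using exists_generator by (elim bexE conjE)
    obtain i where i: "x = g [^] (i::nat)" using g(3) assms by blast
    have "h * 2 dvd h * i"
      using that g(1) g(4)[rule_format, of "i * h"] unfolding half h by (simp add: i nat_pow_pow mult.commute)
    hence "2 dvd i" using \<open>h > 0\<close> by simp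
    then obtain j where "i = j + j" by (metis evenE mult_2)
    thus ?thesis using g(1) i by (intro bexI[of _ "g [^] j"]) (auto simp: nat_pow_mult)
  qed
  show "x [^] ((q - 1) div 2) = \<one>" if ex: "\<exists>w\<in>carrier R. w \<otimes> w = x"
  proof -
    obtain w where w: "w \<in> carrier R" "w \<otimes> w = x" using ex by (elim bexE)
    have "x = w [^] (2::nat)" using w by (simp add: numeral_2_eq_2)
    hence "x [^] ((q - 1) div 2) = w [^] (q - 1)" unfolding half h using w by (simp add: nat_pow_pow)
    moreover have "w \<noteq> \<zero>" using w assms by auto
    ultimately show ?thesis using power_card_minus_1 w by simp
  qed
qed

lemma eq_uminus_iff:
  assumes "p \<noteq> 2" "x \<in> carrier R"
  shows "x = \<ominus> x \<longleftrightarrow> x = \<zero>"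
proof
  assume "x = \<ominus> x"
  hence "x \<oplus> x = x \<oplus> \<ominus> x" by (rule arg_cong)
  also have "\<dots> = \<zero>" using assms(2) by (rule r_neg)
  finally have "(\<one> \<oplus> \<one>) \<otimes> x = \<zero>" using assms(2) by (simp add: l_distr)
  thus "x = \<zero>" using assms one_add_one_eq_zero_iff integral_iff by auto
qed simp

text \<open>The integer \<open>d\<close> lies in the prime field, and (q - 1) / 2 is (p - 1) / 2
  times e = 1 + p + ... + p^(n - 1). Euler's criterion modulo p turns d^((q - 1) / 2) into the e-th
  power of the Legendre symbol.\<close>

lemma card_square_roots_int:
  assumes "p \<noteq> 2"
  shows "int (card {w \<in> carrier R. w \<otimes> w = [(d :: int)] \<cdot>\<^bsub>R\<^esub> \<one>}) = 1 + Legendre d p ^ n"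
proof (cases "int p dvd d")
  case True
  hence "[d] \<cdot>\<^bsub>R\<^esub> \<one> = \<zero>" by (simp add: int_eq_zero_iff)
  hence "{w \<in> carrier R. w \<otimes> w = [d] \<cdot>\<^bsub>R\<^esub> \<one>} = {\<zero>}" by (auto simp: integral_iff)
  moreover have "Legendre d p = 0" using True by (simp add: Legendre_def cong_0_iff)
  ultimately show ?thesis using n_pos by simp
next
  case False
  let ?x = "[d] \<cdot>\<^bsub>R\<^esub> \<one>"
  have x: "?x \<in> carrier R" "?x \<noteq> \<zero>" using False by (auto simp: int_eq_zero_iff)
  have p2: "p > 2" using assms prime_ge_2_nat[OF p_prime] by linarith
  hence "odd p" using prime_odd_nat[OF p_prime] by simp
  define L where "L = Legendre d p"
  have L: "L = 1 \<or> L = - 1" using False by (auto simp: L_def Legendre_def cong_0_iff)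
  define e where "e = (\<Sum>i<n. p ^ i)"
  have e: "(p - 1) * e = q - 1"
  proof -
    have "p \<ge> 1" "p ^ n \<ge> 1" using prime_gt_0_nat[OF p_prime] by (simp_all add: Suc_le_eq)
    hence "int ((p - 1) * e) = int (q - 1)"
      using power_diff_1_eq[of "int p" n] by (simp add: e_def q_def of_nat_diff)
    thus ?thesis by (simp only: of_nat_eq_iff)
  qed
  have "(q - 1) div 2 = (p - 1) div 2 * e"
  proof -
    obtain h where "p - 1 = 2 * h" using \<open>odd p\<close> by (auto elim: oddE)
    thus ?thesis unfolding e[symmetric] by simp
  qed
  hence "?x [^] ((q - 1) div 2) = [((d ^ ((p - 1) div 2)) ^ e)] \<cdot>\<^bsub>R\<^esub> \<one>"
    by (simp only: int_power_eq power_mult[symmetric])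
  also have "\<dots> = [(L ^ e)] \<cdot>\<^bsub>R\<^esub> \<one>"
    unfolding int_eq_iff L_def by (intro cong_pow cong_sym[OF euler_criterion] p_prime p2)
  \<comment> \<open>A sum of n odd numbers has the parity of n, and L is 1 or -1.\<close>
  also have "L ^ e = L ^ n"
  proof -
    have "even e = even n" unfolding e_def using \<open>odd p\<close> by (induction n) auto
    thus ?thesis using L by auto
  qed
  finally have half: "?x [^] ((q - 1) div 2) = [(L ^ n)] \<cdot>\<^bsub>R\<^esub> \<one>" .
  show ?thesis
  proof (cases "L ^ n = 1")
    case True
    hence "?x [^] ((q - 1) div 2) = \<one>" using half by (simp add: int_numeral)
    then obtain w where w: "w \<in> carrier R" "w \<otimes> w = ?x"
      using power_half_eq_one_iff[OF assms x] by blast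
    have "{w \<in> carrier R. w \<otimes> w = ?x} = {w, \<ominus> w}"
    proof -
      have "u = w \<or> u = \<ominus> w" if "u \<in> carrier R" "u \<otimes> u = ?x" for u
      proof -
        have "(u \<ominus> w) \<otimes> (u \<oplus> w) = u \<otimes> u \<ominus> w \<otimes> w" using that(1) w(1) by algebra
        also have "\<dots> = \<zero>" using that w by simp
        finally have "u \<ominus> w = \<zero> \<or> u \<oplus> w = \<zero>" using that(1) w(1) by (simp add: integral_iff)
        thus ?thesis using that(1) w(1) by (auto simp: sum_zero_eq_neg)
      qed
      moreover have "\<ominus> w \<otimes> \<ominus> w = w \<otimes> w" using w(1) by algebra
      ultimately show ?thesis using w by auto
    qed
    moreover have "w \<noteq> \<ominus> w" using eq_uminus_iff[OF assms w(1)] w x by auto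
    ultimately have "card {w \<in> carrier R. w \<otimes> w = ?x} = 2" by simp
    thus ?thesis using True by (simp add: L_def)
  next
    case False
    hence Ln: "L ^ n = - 1" using L by (cases "even n") auto
    have "[(- 1 :: int)] \<cdot>\<^bsub>R\<^esub> \<one> \<noteq> \<one>"
    proof -
      have "\<not> [- 1 = 1] (mod int p)" using p2 by (simp add: cong_iff_dvd_diff zdvd_not_zless)
      thus ?thesis using int_eq_iff[of "-1" 1] by (simp add: int_numeral)
    qed
    hence "{w \<in> carrier R. w \<otimes> w = ?x} = {}"
      using power_half_eq_one_iff[OF assms x] half Ln by auto
    thus ?thesis using Ln by (simp add: L_def)
  qed
qed

text \<open>Completing the square: (2 z - 1)^2 = 4 (z^2 - z - 1) + 5, so z -> 2 z - 1 is the
  bijection, and it is invertible because p is odd.\<close>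

lemma card_golden_roots:
  assumes "p \<noteq> 2"
  shows "card {z \<in> carrier R. z \<otimes> z = z \<oplus> \<one>} = card {w \<in> carrier R. w \<otimes> w = [(5 :: int)] \<cdot>\<^bsub>R\<^esub> \<one>}"
proof (rule bij_betw_same_card)
  define t where "t = [(2 :: int)] \<cdot>\<^bsub>R\<^esub> \<one>"
  have t: "t \<in> carrier R" "t \<noteq> \<zero>"
    using assms one_add_one_eq_zero_iff by (auto simp: t_def int_numeral)
  have sq: "(t \<otimes> z \<ominus> \<one>) \<otimes> (t \<otimes> z \<ominus> \<one>) =
      (t \<otimes> t) \<otimes> (z \<otimes> z \<ominus> (z \<oplus> \<one>)) \<oplus> [(5 :: int)] \<cdot>\<^bsub>R\<^esub> \<one>"
    if z: "z \<in> carrier R" for z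
  proof -
    let ?Z = "indet VZ"
    \<comment> \<open>The identity is checked in \<open>zpoly\<close> and then evaluated; the other
      two variables also receive the value z.\<close>
    have eq: "(of_int 2 * ?Z - 1) * (of_int 2 * ?Z - 1) =
        (of_int 2 * of_int 2) * (?Z * ?Z - (?Z + 1)) + of_int 5"
      by (simp add: algebra_simps)
    have cl: "\<And>v. case_var z z z v \<in> carrier R" using z by (simp split: var.split)
    show ?thesis
      using arg_cong[OF eq, of "zpoly_eval R (case_var z z z)"]
      by (simp add: zpoly_eval_simps[OF cl] zpoly_eval_of_int[OF cl] t_def del: of_int_numeral)
  qed
  show "bij_betw (\<lambda>z. t \<otimes> z \<ominus> \<one>) {z \<in> carrier R. z \<otimes> z = z \<oplus> \<one>}
      {w \<in> carrier R. w \<otimes> w = [(5 :: int)] \<cdot>\<^bsub>R\<^esub> \<one>}"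
  proof (rule bij_betwI[where g = "\<lambda>w. inv t \<otimes> (w \<oplus> \<one>)"])
    have inv: "inv t \<in> carrier R" "t \<otimes> inv t = \<one>" using t by (simp_all add: field_Units)
    have cancel: "inv t \<otimes> ((t \<otimes> z \<ominus> \<one>) \<oplus> \<one>) = z" if "z \<in> carrier R" for z
    proof -
      have "inv t \<otimes> ((t \<otimes> z \<ominus> \<one>) \<oplus> \<one>) = (t \<otimes> inv t) \<otimes> z" using inv(1) t(1) that by algebra
      thus ?thesis using inv that by simp
    qed
    have cancel': "t \<otimes> (inv t \<otimes> (w \<oplus> \<one>)) \<ominus> \<one> = w" if "w \<in> carrier R" for w
    proof -
      have "t \<otimes> (inv t \<otimes> (w \<oplus> \<one>)) \<ominus> \<one> = (t \<otimes> inv t) \<otimes> (w \<oplus> \<one>) \<ominus> \<one>"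
        using inv(1) t(1) that by algebra
      also have "\<dots> = \<one> \<otimes> (w \<oplus> \<one>) \<ominus> \<one>" by (simp only: inv(2))
      also have "\<dots> = w" using that by algebra
      finally show ?thesis .
    qed
    show "(\<lambda>z. t \<otimes> z \<ominus> \<one>) \<in> {z \<in> carrier R. z \<otimes> z = z \<oplus> \<one>} \<rightarrow>
      {w \<in> carrier R. w \<otimes> w = [(5 :: int)] \<cdot>\<^bsub>R\<^esub> \<one>}"
    proof safe
      fix z assume z: "z \<in> carrier R" "z \<otimes> z = z \<oplus> \<one>"
      hence "z \<otimes> z \<ominus> (z \<oplus> \<one>) = \<zero>" by (simp add: a_minus_def r_neg)
      thus "(t \<otimes> z \<ominus> \<one>) \<otimes> (t \<otimes> z \<ominus> \<one>) = [(5 :: int)] \<cdot>\<^bsub>R\<^esub> \<one>"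
        using sq[OF z(1)] t(1) by simp
    qed (use t in auto)
    show "(\<lambda>w. inv t \<otimes> (w \<oplus> \<one>)) \<in> {w \<in> carrier R. w \<otimes> w = [(5 :: int)] \<cdot>\<^bsub>R\<^esub> \<one>} \<rightarrow>
      {z \<in> carrier R. z \<otimes> z = z \<oplus> \<one>}"
    proof safe
      fix w assume w: "w \<in> carrier R" "w \<otimes> w = [(5 :: int)] \<cdot>\<^bsub>R\<^esub> \<one>"
      let ?z = "inv t \<otimes> (w \<oplus> \<one>)"
      show zc: "?z \<in> carrier R" using inv w by simp
      have "(t \<otimes> t) \<otimes> (?z \<otimes> ?z \<ominus> (?z \<oplus> \<one>)) \<oplus> [(5 :: int)] \<cdot>\<^bsub>R\<^esub> \<one> = [(5 :: int)] \<cdot>\<^bsub>R\<^esub> \<one>"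
        using sq[OF zc] cancel'[OF w(1)] w by simp
      hence "(t \<otimes> t) \<otimes> (?z \<otimes> ?z \<ominus> (?z \<oplus> \<one>)) = \<zero>"
        using zc t by (simp add: add.r_cancel_one)
      hence "?z \<otimes> ?z \<ominus> (?z \<oplus> \<one>) = \<zero>" using zc t by (simp add: integral_iff)
      thus "?z \<otimes> ?z = ?z \<oplus> \<one>" using zc by simp
    qed
    show "inv t \<otimes> ((t \<otimes> z \<ominus> \<one>) \<oplus> \<one>) = z" if "z \<in> {z \<in> carrier R. z \<otimes> z = z \<oplus> \<one>}" for z
      using cancel that by blast
    show "t \<otimes> (inv t \<otimes> (w \<oplus> \<one>)) \<ominus> \<one> = w"
      if "w \<in> {w \<in> carrier R. w \<otimes> w = [(5 :: int)] \<cdot>\<^bsub>R\<^esub> \<one>}" for w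
      using cancel' that by blast
  qed
qed

text \<open>The roots are the primitive cube roots of unity, which exist precisely when 3 divides
  2^n - 1, that is, for even n. This takes the place of the square roots of 5 in characteristic
  2.\<close>

lemma card_cube_roots_char_2:
  assumes "p = 2"
  shows "int (card {z \<in> carrier R. z \<otimes> z \<oplus> z \<oplus> \<one> = \<zero>}) = 1 + (- 1) ^ n"
proof -
  have two: "\<one> \<oplus> \<one> = \<zero>" using assms one_add_one_eq_zero_iff by simp
  have dbl: "x \<oplus> x = \<zero>" if "x \<in> carrier R" for x
  proof -
    have "x \<oplus> x = (\<one> \<oplus> \<one>) \<otimes> x" using that by (simp add: l_distr)
    thus ?thesis using two that by simp
  qed
  have fac: "(z \<otimes> z \<oplus> z \<oplus> \<one>) \<otimes> (z \<ominus> \<one>) = z [^] (3::nat) \<ominus> \<one>" if "z \<in> carrier R" for z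
    using that unfolding numeral_3_eq_3 by (simp, algebra)
  show ?thesis
  proof (cases "even n")
    case True
    then obtain m where m: "n = 2 * m" by (elim evenE)
    have "[4 ^ m = 1 ^ m] (mod (3::nat))" by (intro cong_pow) (simp add: cong_def)
    moreover have "p ^ n = 4 ^ m" using assms m by (simp add: power_mult)
    ultimately have "[q = 1] (mod 3)" unfolding q_def by simp
    hence "3 dvd q - 1" by (rule cong_to_1_nat)
    then obtain k where k: "q - 1 = 3 * k" by (elim dvdE)
    obtain g where g: "g \<in> carrier R" "g \<noteq> \<zero>" "\<forall>x\<in>carrier R - {\<zero>}. \<exists>i::nat. x = g [^] i"
      "\<forall>i::nat. g [^] i = \<one> \<longleftrightarrow> (q - 1) dvd i"
    using exists_generator by (elim bexE conjE)
    \<comment> \<open>As k = (q - 1) / 3, this element has order 3.\<close>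
    define w where "w = g [^] k"
    have wc: "w \<in> carrier R" using g by (simp add: w_def)
    have "w [^] (3::nat) = \<one>" using g(1) g(4)[rule_format, of "k * 3"] unfolding k w_def by (simp add: nat_pow_pow)
    moreover have "w \<noteq> \<one>" 
    proof
      assume "w = \<one>"
      hence "q - 1 dvd k" using g(4)[rule_format, of k] unfolding w_def by blast
      hence "3 * k dvd k" unfolding k .
      moreover have "k > 0" using k q_gt_1 by linarith
      ultimately show False by (auto dest: dvd_imp_le)
    qed
    moreover have "\<one> \<ominus> \<one> = \<zero>" by simp
    ultimately have w: "w \<otimes> w \<oplus> w \<oplus> \<one> = \<zero>"
      using fac[OF wc] wc integral[of "w \<otimes> w \<oplus> w \<oplus> \<one>" "w \<ominus> \<one>"] by simp
    have "{z \<in> carrier R. z \<otimes> z \<oplus> z \<oplus> \<one> = \<zero>} = {w, w \<oplus> \<one>}"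
    proof -
      have id: "z \<otimes> z \<oplus> z \<oplus> \<one> = (z \<ominus> w) \<otimes> (z \<ominus> (w \<oplus> \<one>))" if z: "z \<in> carrier R" for z
      proof -
        let ?Z = "indet VZ" and ?W = "indet VX"
        \<comment> \<open>Over the integers the factorization holds up to w^2 + w + 1, which is 0 by
          the choice of w, and a multiple of 2.\<close>
        have eq: "(?Z - ?W) * (?Z - (?W + 1)) = ?Z * ?Z + ?Z + 1 + (?W * ?W + ?W + 1) -
            of_int 2 * (1 + ?Z + ?W * ?Z)"
          by (simp add: algebra_simps)
        have cl: "\<And>v. case_var w w z v \<in> carrier R" using z wc by (simp split: var.split)
        have "(z \<ominus> w) \<otimes> (z \<ominus> (w \<oplus> \<one>)) = z \<otimes> z \<oplus> z \<oplus> \<one> \<oplus> (w \<otimes> w \<oplus> w \<oplus> \<one>) \<ominus>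
            (\<one> \<oplus> \<one>) \<otimes> (\<one> \<oplus> z \<oplus> w \<otimes> z)"
          using arg_cong[OF eq, of "zpoly_eval R (case_var w w z)"]
          by (simp only: zpoly_eval_simps[OF cl] zpoly_eval_of_int[OF cl] int_numeral var.case)
        also have "\<dots> = z \<otimes> z \<oplus> z \<oplus> \<one>" using z wc by (simp add: two w a_minus_def)
        finally show ?thesis ..
      qed
      show ?thesis using wc id by (auto simp: integral_iff)
    qed
    moreover have "w \<noteq> w \<oplus> \<one>" using wc by simp
    ultimately show ?thesis using True by simp
  next
    case False
    then obtain m where m: "n = Suc (2 * m)" by (auto elim: oddE)
    have "[4 ^ m = 1 ^ m] (mod (3::nat))" by (intro cong_pow) (simp add: cong_def)
    hence "3 dvd (4::nat) ^ m - 1" by (intro cong_to_1_nat) simp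
    then obtain k :: nat where "4 ^ m - 1 = 3 * k" by (elim dvdE)
    hence "(4::nat) ^ m = 3 * k + 1" by (metis add.commute le_add_diff_inverse one_le_numeral one_le_power)
    moreover have "p ^ n = 2 * 4 ^ m" using assms m by (simp add: power_mult)
    \<comment> \<open>Since q - 1 is 1 modulo 3, the relations z^3 = 1 and z^(q - 1) = 1 force z =
      1, where z^2 + z + 1 = 1 in characteristic 2.\<close>
    ultimately have q: "q - 1 = 3 * (2 * k) + 1" unfolding q_def by simp
    have "z \<otimes> z \<oplus> z \<oplus> \<one> \<noteq> \<zero>" if z: "z \<in> carrier R" for z
    proof
      assume z0: "z \<otimes> z \<oplus> z \<oplus> \<one> = \<zero>"
      hence "z [^] (3::nat) \<ominus> \<one> = \<zero>" using fac[OF z] z by simp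
      hence z3: "z [^] (3::nat) = \<one>" using z by simp
      have "z \<noteq> \<zero>" using z0 by auto
      hence "\<one> = z [^] (q - 1)" using power_card_minus_1 z by simp
      also have "\<dots> = (z [^] (3::nat)) [^] (2 * k) \<otimes> z" unfolding q using z by (simp add: nat_pow_pow)
      also have "\<dots> = z" using z z3 by simp
      finally have z1: "z = \<one>" by simp
      show False using z0 two unfolding z1 by simp
    qed
    hence "{z \<in> carrier R. z \<otimes> z \<oplus> z \<oplus> \<one> = \<zero>} = {}" by blast
    thus ?thesis using False by simp
  qed
qed

end

section \<open>Point counts\<close>

context galois_field
begin

text \<open>
  For fixed \<open>z\<close>, each of the three equations becomes \<open>(x - z y) (z x - y) = k(z)\<close> (for \<open>f1\<close> after division by
  \<open>z\<close>). The two linear forms are independent precisely when \<open>z\<^sup>2 \<noteq> 1\<close>, and then the fiber is a hyperbola or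
  a pair of lines.
\<close>

definition pencil :: "'a \<Rightarrow> 'a \<Rightarrow> ('a \<times> 'a) set" where
  "pencil z c = {(x, y) \<in> carrier R \<times> carrier R. (x \<ominus> z \<otimes> y) \<otimes> (z \<otimes> x \<ominus> y) = c}"

lemma card_q: "card (carrier R) = q"
  by (simp add: card_carrier q_def)

lemma card_hyperbola:
  assumes "c \<in> carrier R"
  shows "card {(u, v) \<in> carrier R \<times> carrier R. u \<otimes> v = c} = (q - 1) + (if c = \<zero> then q else 0)"
proof (cases "c = \<zero>")
  case True
  have "{(u, v) \<in> carrier R \<times> carrier R. u \<otimes> v = c} =
      {\<zero>} \<times> carrier R \<union> (carrier R - {\<zero>}) \<times> {\<zero>}"
    using True by (auto simp: integral_iff)
  moreover have "card ({\<zero>} \<times> carrier R \<union> (carrier R - {\<zero>}) \<times> {\<zero>}) = q + (q - 1)"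
    by (subst card_Un_disjoint) (auto simp: card_cartesian_product card_q)
  ultimately show ?thesis using True by simp
next
  case False
  have "bij_betw (\<lambda>u. (u, inv u \<otimes> c)) (carrier R - {\<zero>})
      {(u, v) \<in> carrier R \<times> carrier R. u \<otimes> v = c}"
  proof (rule bij_betwI[where g = fst])
    show "(\<lambda>u. (u, inv u \<otimes> c)) \<in> carrier R - {\<zero>} \<rightarrow> {(u, v) \<in> carrier R \<times> carrier R. u \<otimes> v = c}"
      using assms by (auto simp: field_Units m_assoc[symmetric])
    show "fst \<in> {(u, v) \<in> carrier R \<times> carrier R. u \<otimes> v = c} \<rightarrow> carrier R - {\<zero>}"
      using False by auto
    show "(fst uv, inv (fst uv) \<otimes> c) = uv"
      if mem: "uv \<in> {(u, v) \<in> carrier R \<times> carrier R. u \<otimes> v = c}" for uv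
    proof -
      obtain u v where uv: "uv = (u, v)" "u \<in> carrier R" "v \<in> carrier R" "u \<otimes> v = c" using mem by auto
      have "u \<noteq> \<zero>" using uv False by auto
      hence "inv u \<otimes> (u \<otimes> v) = v" using uv(2,3) by (simp add: field_Units m_assoc[symmetric])
      thus ?thesis using uv(1,4) by simp
    qed
  qed simp
  from bij_betw_same_card[OF this] show ?thesis using False by (simp add: card_q)
qed

lemma card_pencil:
  assumes z: "z \<in> carrier R" "z \<otimes> z \<noteq> \<one>" and c: "c \<in> carrier R"
  shows "card (pencil z c) = (q - 1) + (if c = \<zero> then q else 0)"
proof -
  let ?h = "\<lambda>(x, y). (x \<ominus> z \<otimes> y, z \<otimes> x \<ominus> y)" and ?C = "carrier R \<times> carrier R"
  have d: "\<one> \<ominus> z \<otimes> z \<in> carrier R" "\<one> \<ominus> z \<otimes> z \<noteq> \<zero>" using z by auto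
  have inj: "inj_on ?h ?C"
  proof (rule inj_onI, clarify)
    fix x y x' y' assume xy: "x \<in> carrier R" "y \<in> carrier R" "x' \<in> carrier R" "y' \<in> carrier R"
      and eq: "x \<ominus> z \<otimes> y = x' \<ominus> z \<otimes> y'" "z \<otimes> x \<ominus> y = z \<otimes> x' \<ominus> y'"
    \<comment> \<open>Cramer's rule: up to the factor 1 - z^2, both coordinates are recovered from
      the two linear forms.\<close>
    have *: "(\<one> \<ominus> z \<otimes> z) \<otimes> a = (a \<ominus> z \<otimes> b) \<ominus> z \<otimes> (z \<otimes> a \<ominus> b)"
      "(\<one> \<ominus> z \<otimes> z) \<otimes> b = z \<otimes> (a \<ominus> z \<otimes> b) \<ominus> (z \<otimes> a \<ominus> b)"
      if "a \<in> carrier R" "b \<in> carrier R" for a b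
      using that z(1) by algebra+
    have "(\<one> \<ominus> z \<otimes> z) \<otimes> x = (\<one> \<ominus> z \<otimes> z) \<otimes> x'" "(\<one> \<ominus> z \<otimes> z) \<otimes> y = (\<one> \<ominus> z \<otimes> z) \<otimes> y'"
      using *[OF xy(1,2)] *[OF xy(3,4)] by (simp_all only: eq)
    thus "x = x' \<and> y = y'" using m_lcancel[OF d(2,1)] xy by simp
  qed
  have "?h ` ?C \<subseteq> ?C" using z by auto
  \<comment> \<open>An injective self-map of the finite plane is onto.\<close>
  hence surj: "?h ` ?C = ?C" by (intro endo_inj_surj inj) auto
  have "bij_betw ?h (pencil z c) {(u, v) \<in> ?C. u \<otimes> v = c}"
    unfolding bij_betw_def
  proof
    show "inj_on ?h (pencil z c)" by (rule inj_on_subset[OF inj]) (auto simp: pencil_def)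
    show "?h ` pencil z c = {(u, v) \<in> ?C. u \<otimes> v = c}"
    proof (intro equalityI subsetI)
      fix uv assume "uv \<in> {(u, v) \<in> ?C. u \<otimes> v = c}"
      hence uv: "uv \<in> ?C" "fst uv \<otimes> snd uv = c" by auto
      from uv(1) have "uv \<in> ?h ` ?C" unfolding surj .
      then obtain x y where "x \<in> carrier R" "y \<in> carrier R" "uv = ?h (x, y)" by auto
      thus "uv \<in> ?h ` pencil z c" using uv(2) by (intro image_eqI[of _ _ "(x, y)"]) (auto simp: pencil_def)
    qed (use z in \<open>auto simp: pencil_def\<close>)
  qed
  from bij_betw_same_card[OF this] show ?thesis using card_hyperbola[OF c] by simp
qed

text \<open>Both forms become x - y, so the fiber is the union of the lines x - y = w over the
  square roots w of c, each with q points.\<close>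

lemma card_pencil_one:
  "card (pencil \<one> c) = q * card {w \<in> carrier R. w \<otimes> w = c}"
proof -
  have "bij_betw (\<lambda>(x, y). (y, x \<ominus> y)) (pencil \<one> c) (carrier R \<times> {w \<in> carrier R. w \<otimes> w = c})"
  proof (rule bij_betwI[where g = "\<lambda>(y, w). (w \<oplus> y, y)"])
    have *: "w \<oplus> y \<ominus> y = w" "x \<ominus> y \<oplus> y = x"
      if "w \<in> carrier R" "x \<in> carrier R" "y \<in> carrier R" for w x y
      using that by algebra+
    show "(\<lambda>(x, y). (y, x \<ominus> y)) \<in> pencil \<one> c \<rightarrow> carrier R \<times> {w \<in> carrier R. w \<otimes> w = c}"
      by (auto simp: pencil_def)
    show "(\<lambda>(y, w). (w \<oplus> y, y)) \<in> carrier R \<times> {w \<in> carrier R. w \<otimes> w = c} \<rightarrow> pencil \<one> c"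
      by (auto simp: pencil_def *)
  qed (auto simp: pencil_def a_minus_def a_assoc l_neg r_neg)
  from bij_betw_same_card[OF this] show ?thesis by (simp add: card_cartesian_product card_q)
qed

text \<open>The forms become x + y and -(x + y), whence the sign of c; the substitution y -> -y
  reduces this fiber to the one over z = 1.\<close>

lemma card_pencil_minus_one:
  assumes "c \<in> carrier R"
  shows "card (pencil (\<ominus> \<one>) c) = q * card {w \<in> carrier R. w \<otimes> w = \<ominus> c}"
proof -
  have *: "(x \<ominus> \<ominus> \<one> \<otimes> y) \<otimes> (\<ominus> \<one> \<otimes> x \<ominus> y) = c \<longleftrightarrow> (x \<oplus> y) \<otimes> (x \<oplus> y) = \<ominus> c"
    if "x \<in> carrier R" "y \<in> carrier R" for x y
  proof -
    have "(x \<ominus> \<ominus> \<one> \<otimes> y) \<otimes> (\<ominus> \<one> \<otimes> x \<ominus> y) = \<ominus> ((x \<oplus> y) \<otimes> (x \<oplus> y))"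
      using that by algebra
    moreover have "\<ominus> ((x \<oplus> y) \<otimes> (x \<oplus> y)) = c \<longleftrightarrow> (x \<oplus> y) \<otimes> (x \<oplus> y) = \<ominus> c"
      using that assms minus_minus by force
    ultimately show ?thesis by simp
  qed
  hence "pencil (\<ominus> \<one>) c = {(x, y) \<in> carrier R \<times> carrier R. (x \<oplus> y) \<otimes> (x \<oplus> y) = \<ominus> c}"
    by (auto simp: pencil_def)
  moreover have "pencil \<one> (\<ominus> c) =
      {(x, y) \<in> carrier R \<times> carrier R. (x \<oplus> \<ominus> y) \<otimes> (x \<oplus> \<ominus> y) = \<ominus> c}"
    by (auto simp: pencil_def a_minus_def)
  ultimately have "bij_betw (\<lambda>(x, y). (x, \<ominus> y)) (pencil (\<ominus> \<one>) c) (pencil \<one> (\<ominus> c))"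
    by (intro bij_betwI[where g = "\<lambda>(x, y). (x, \<ominus> y)"]) auto
  from bij_betw_same_card[OF this] show ?thesis by (simp add: card_pencil_one)
qed

lemma sum_card_pencil:
  assumes "S \<subseteq> carrier R" "\<And>z. z \<in> S \<Longrightarrow> z \<otimes> z \<noteq> \<one>" "\<And>z. z \<in> S \<Longrightarrow> k z \<in> carrier R"
  shows "(\<Sum>z\<in>S. card (pencil z (k z))) = card S * (q - 1) + q * card {z \<in> S. k z = \<zero>}"
proof -
  have fin: "finite S" using assms(1) by (rule finite_subset) simp
  have "(\<Sum>z\<in>S. card (pencil z (k z))) = (\<Sum>z\<in>S. (q - 1) + (if k z = \<zero> then q else 0))"
    using assms by (intro sum.cong card_pencil) auto
  also have "\<dots> = card S * (q - 1) + (\<Sum>z\<in>S. if k z = \<zero> then q else 0)"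
    by (simp add: sum.distrib)
  also have "(\<Sum>z\<in>S. if k z = \<zero> then q else 0) = (\<Sum>z\<in>{z \<in> S. k z = \<zero>}. q)"
    by (simp only: sum.inter_filter[OF fin])
  finally show ?thesis by simp
qed

section \<open>Points of the three surfaces, fiber by fiber\<close>

lemma card_points_fibers:
  "card (points f R) = (\<Sum>z\<in>carrier R. card {(x, y) \<in> carrier R \<times> carrier R.
     zpoly_eval R (case_var x y z) f = \<zero>})"
proof -
  let ?F = "\<lambda>z. {(x, y) \<in> carrier R \<times> carrier R. zpoly_eval R (case_var x y z) f = \<zero>}"
  have "bij_betw (\<lambda>(x, y, z). (z, x, y)) (points f R) (SIGMA z:carrier R. ?F z)"
    by (rule bij_betwI[where g = "\<lambda>(z, x, y). (x, y, z)"]) (auto simp: points_def)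
  from bij_betw_same_card[OF this] have "card (points f R) = card (SIGMA z:carrier R. ?F z)" .
  also have "\<dots> = (\<Sum>z\<in>carrier R. card (?F z))"
    by (rule card_SigmaI) (auto intro: finite_subset[of _ "carrier R \<times> carrier R"])
  finally show ?thesis .
qed

text \<open>The product (x - z y) (z x - y) = z (x^2 + y^2) - (z^2 + 1) x y absorbs every term
  containing x or y. Squares are spelled as products and 2 as \<open>of_int 2\<close> so that
  evaluation yields the expressions occurring in the fibers.\<close>

lemma f0_eq: "f0 = (indet VX - indet VZ * indet VY) * (indet VZ * indet VX - indet VY) -
    indet VZ * (of_int 2 - indet VZ * indet VZ)"
  by (simp add: f0_def Let_def algebra_simps power2_eq_square power3_eq_cube)

lemma f1_eq: "f1 = indet VZ * ((indet VX - indet VZ * indet VY) * (indet VZ * indet VX - indet VY)) +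
    (indet VZ * indet VZ - (indet VZ + 1)) * (indet VZ * indet VZ - (1 - indet VZ))"
  by (simp add: f1_def Let_def algebra_simps power2_eq_square power3_eq_cube power4_eq_xxxx)

lemma f2_eq: "f2 = (indet VX - indet VZ * indet VY) * (indet VZ * indet VX - indet VY) -
    indet VZ * (1 - indet VZ * indet VZ)"
  by (simp add: f2_def Let_def algebra_simps power2_eq_square power3_eq_cube)

lemma fiber_f0:
  assumes "z \<in> carrier R"
  shows "{(x, y) \<in> carrier R \<times> carrier R. zpoly_eval R (case_var x y z) f0 = \<zero>} =
    pencil z (z \<otimes> ([(2 :: int)] \<cdot>\<^bsub>R\<^esub> \<one> \<ominus> z \<otimes> z))"
proof -
  have "zpoly_eval R (case_var x y z) f0 = \<zero> \<longleftrightarrow> (x \<ominus> z \<otimes> y) \<otimes> (z \<otimes> x \<ominus> y) =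
      z \<otimes> ([(2 :: int)] \<cdot>\<^bsub>R\<^esub> \<one> \<ominus> z \<otimes> z)" if "x \<in> carrier R" "y \<in> carrier R" for x y
  proof -
    have cl: "\<And>v. case_var x y z v \<in> carrier R" using that assms by (simp split: var.split)
    show ?thesis unfolding f0_eq using that assms
      by (simp only: zpoly_eval_simps[OF cl] zpoly_eval_of_int[OF cl] var.case) simp
  qed
  thus ?thesis by (auto simp: pencil_def)
qed

lemma fiber_f2:
  assumes "z \<in> carrier R"
  shows "{(x, y) \<in> carrier R \<times> carrier R. zpoly_eval R (case_var x y z) f2 = \<zero>} =
    pencil z (z \<otimes> (\<one> \<ominus> z \<otimes> z))"
proof -
  have "zpoly_eval R (case_var x y z) f2 = \<zero> \<longleftrightarrow> (x \<ominus> z \<otimes> y) \<otimes> (z \<otimes> x \<ominus> y) =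
      z \<otimes> (\<one> \<ominus> z \<otimes> z)" if "x \<in> carrier R" "y \<in> carrier R" for x y
  proof -
    have cl: "\<And>v. case_var x y z v \<in> carrier R" using that assms by (simp split: var.split)
    show ?thesis unfolding f2_eq using that assms
      by (simp only: zpoly_eval_simps[OF cl] var.case) simp
  qed
  thus ?thesis by (auto simp: pencil_def)
qed

text \<open>\<open>z\<^sup>4 - 3 z\<^sup>2 + 1 = (z\<^sup>2 - z - 1) (z\<^sup>2 + z - 1)\<close>.\<close>

definition "golden z = (z \<otimes> z \<ominus> (z \<oplus> \<one>)) \<otimes> (z \<otimes> z \<ominus> (\<one> \<ominus> z))"

lemma golden_closed [simp]: "z \<in> carrier R \<Longrightarrow> golden z \<in> carrier R"
  by (simp add: golden_def)

lemma fiber_f1: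
  assumes "z \<in> carrier R" "z \<noteq> \<zero>"
  shows "{(x, y) \<in> carrier R \<times> carrier R. zpoly_eval R (case_var x y z) f1 = \<zero>} =
    pencil z (inv z \<otimes> (\<ominus> golden z))"
proof -
  have inv: "inv z \<in> carrier R" "z \<otimes> inv z = \<one>" using assms by (simp_all add: field_Units)
  have "zpoly_eval R (case_var x y z) f1 = \<zero> \<longleftrightarrow> (x \<ominus> z \<otimes> y) \<otimes> (z \<otimes> x \<ominus> y) =
      inv z \<otimes> (\<ominus> golden z)" if "x \<in> carrier R" "y \<in> carrier R" for x y
  proof -
    have cl: "\<And>v. case_var x y z v \<in> carrier R" using that assms by (simp split: var.split)
    define u where "u = (x \<ominus> z \<otimes> y) \<otimes> (z \<otimes> x \<ominus> y)"
    have u: "u \<in> carrier R" using that assms by (simp add: u_def)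
    have "zpoly_eval R (case_var x y z) f1 = z \<otimes> u \<oplus> golden z"
      unfolding f1_eq u_def golden_def by (simp only: zpoly_eval_simps[OF cl] var.case)
    also have "\<dots> = \<zero> \<longleftrightarrow> z \<otimes> u = \<ominus> golden z"
      using u assms sum_zero_eq_neg[of "z \<otimes> u" "golden z"] by (auto simp: l_neg)
    also have "\<dots> \<longleftrightarrow> z \<otimes> u = z \<otimes> (inv z \<otimes> (\<ominus> golden z))"
      using inv assms by (simp add: m_assoc[symmetric])
    also have "\<dots> \<longleftrightarrow> u = inv z \<otimes> (\<ominus> golden z)"
      using m_lcancel[OF assms(2,1)] u inv assms by simp
    finally show ?thesis by (simp add: u_def)
  qed
  thus ?thesis by (auto simp: pencil_def)
qed

lemma fiber_f1_zero:
  "{(x, y) \<in> carrier R \<times> carrier R. zpoly_eval R (case_var x y \<zero>) f1 = \<zero>} = {}"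
proof -
  have "zpoly_eval R (case_var x y \<zero>) f1 \<noteq> \<zero>" if "x \<in> carrier R" "y \<in> carrier R" for x y
  proof -
    have cl: "\<And>v. case_var x y \<zero> v \<in> carrier R" using that by (simp split: var.split)
    have "zpoly_eval R (case_var x y \<zero>) f1 = \<zero> \<otimes> ((x \<ominus> \<zero> \<otimes> y) \<otimes> (\<zero> \<otimes> x \<ominus> y)) \<oplus> golden \<zero>"
      unfolding f1_eq golden_def by (simp only: zpoly_eval_simps[OF cl] var.case)
    also have "\<dots> = \<one>" using that by (simp add: golden_def a_minus_def l_minus r_minus)
    finally show ?thesis by simp
  qed
  thus ?thesis by auto
qed

lemma square_eq_one_iff:
  assumes "z \<in> carrier R"
  shows "z \<otimes> z = \<one> \<longleftrightarrow> z = \<one> \<or> z = \<ominus> \<one>"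
proof
  assume "z \<otimes> z = \<one>"
  moreover have "(z \<ominus> \<one>) \<otimes> (z \<oplus> \<one>) = z \<otimes> z \<ominus> \<one>" using assms by algebra
  ultimately have "(z \<ominus> \<one>) \<otimes> (z \<oplus> \<one>) = \<zero>" by simp
  hence "z \<ominus> \<one> = \<zero> \<or> z \<oplus> \<one> = \<zero>" using assms by (simp add: integral_iff)
  thus "z = \<one> \<or> z = \<ominus> \<one>" using assms by (auto simp: sum_zero_eq_neg)
qed (auto simp: l_minus r_minus)

lemma minus_one_eq_one_iff: "\<ominus> \<one> = \<one> \<longleftrightarrow> p = 2"
  using one_add_one_eq_zero_iff sum_zero_eq_neg[of \<one> \<one>] r_neg[of \<one>] by auto

lemma card_square_roots_one:
  "card {w \<in> carrier R. w \<otimes> w = \<one>} = (if p = 2 then 1 else 2)"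
proof -
  have "{w \<in> carrier R. w \<otimes> w = \<one>} = {\<one>, \<ominus> \<one>}" using square_eq_one_iff by auto
  thus ?thesis using minus_one_eq_one_iff by (auto simp: card_insert_if)
qed

lemma two_minus_one: "[(2 :: int)] \<cdot>\<^bsub>R\<^esub> \<one> \<ominus> \<one> = \<one>"
  by (simp add: int_numeral a_minus_def a_assoc r_neg)

text \<open>The degenerate fibers over 1 and -1 are split off. They coincide in characteristic 2,
  which is why the second term and the number of remaining z depend on p.\<close>

lemma sum_pencil_split:
  assumes "\<And>z. z \<in> carrier R \<Longrightarrow> k z \<in> carrier R"
  shows "(\<Sum>z\<in>carrier R. card (pencil z (k z))) =
    card (pencil \<one> (k \<one>)) + (if p = 2 then 0 else card (pencil (\<ominus> \<one>) (k (\<ominus> \<one>)))) +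
    ((q - (if p = 2 then 1 else 2)) * (q - 1) +
     q * card {z \<in> carrier R - {\<one>, \<ominus> \<one>}. k z = \<zero>})"
proof -
  let ?S = "carrier R - {\<one>, \<ominus> \<one>}" and ?N = "\<lambda>z. card (pencil z (k z))"
  have "(\<Sum>z\<in>carrier R. ?N z) = (\<Sum>z\<in>{\<one>, \<ominus> \<one>}. ?N z) + (\<Sum>z\<in>?S. ?N z)"
    by (subst sum.union_disjoint[symmetric]) (auto intro: sum.cong)
  also have "(\<Sum>z\<in>{\<one>, \<ominus> \<one>}. ?N z) =
      ?N \<one> + (if p = 2 then 0 else ?N (\<ominus> \<one>))"
    using minus_one_eq_one_iff by auto
  also have "(\<Sum>z\<in>?S. ?N z) = card ?S * (q - 1) + q * card {z \<in> ?S. k z = \<zero>}"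
    using assms square_eq_one_iff by (intro sum_card_pencil) auto
  also have "card ?S = q - (if p = 2 then 1 else 2)"
    using minus_one_eq_one_iff by (subst card_Diff_subset) (auto simp: card_q card_insert_if)
  finally show ?thesis .
qed

text \<open>For odd p the fibers over 1 and -1 have 2 q points each, the other q - 2 fibers have q -
  1 points, and q more for z = 0 and for every square root of 2. For p = 2 the contributions are q,
  (q - 1)^2 and q.\<close>

theorem card_points_f0:
  "int (card (points f0 R)) =
    (if p = 2 then int q ^ 2 + 1 else int q ^ 2 + 3 * int q + 2 + Legendre 2 p ^ n * int q)"
proof -
  let ?k = "\<lambda>z. z \<otimes> ([(2 :: int)] \<cdot>\<^bsub>R\<^esub> \<one> \<ominus> z \<otimes> z)"
  have "card (points f0 R) = (\<Sum>z\<in>carrier R. card (pencil z (?k z)))"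
    unfolding card_points_fibers by (intro sum.cong) (simp_all only: fiber_f0)
  also have "\<dots> = card (pencil \<one> (?k \<one>)) + (if p = 2 then 0 else card (pencil (\<ominus> \<one>) (?k (\<ominus> \<one>)))) +
    ((q - (if p = 2 then 1 else 2)) * (q - 1) +
     q * card {z \<in> carrier R - {\<one>, \<ominus> \<one>}. ?k z = \<zero>})"
    by (rule sum_pencil_split) simp
  also have "?k \<one> = \<one>" by (simp add: two_minus_one)
  also have "card (pencil \<one> \<one>) = q * (if p = 2 then 1 else 2)"
    by (simp add: card_pencil_one card_square_roots_one)
  also have "?k (\<ominus> \<one>) = \<ominus> \<one>" by (simp add: l_minus r_minus two_minus_one)
  also have "card (pencil (\<ominus> \<one>) (\<ominus> \<one>)) = q * (if p = 2 then 1 else 2)"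
    by (simp add: card_pencil_minus_one card_square_roots_one)
  also have "{z \<in> carrier R - {\<one>, \<ominus> \<one>}. ?k z = \<zero>} =
      insert \<zero> {z \<in> carrier R. z \<otimes> z = [(2 :: int)] \<cdot>\<^bsub>R\<^esub> \<one>}" (is "?A = ?B")
  proof -
    \<comment> \<open>Thus no square root of 2 is 1 or -1, and none is lost by excluding the
      degenerate fibers.\<close>
    have "[(2 :: int)] \<cdot>\<^bsub>R\<^esub> \<one> \<noteq> \<one>"
      using two_minus_one by (metis r_right_minus_eq one_closed zero_not_one)
    hence ne: "z \<noteq> \<one> \<and> z \<noteq> \<ominus> \<one>" if "z \<in> carrier R" "z \<otimes> z = [(2 :: int)] \<cdot>\<^bsub>R\<^esub> \<one>" for z
      using square_eq_one_iff[OF that(1)] that(2) by auto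
    have ne0: "\<zero> \<noteq> \<ominus> \<one>" using minus_minus[of \<one>] by (metis minus_zero one_closed zero_not_one)
    have "?k z = \<zero> \<longleftrightarrow> z = \<zero> \<or> z \<otimes> z = [(2 :: int)] \<cdot>\<^bsub>R\<^esub> \<one>" if "z \<in> carrier R" for z
      using that by (auto simp: integral_iff)
    thus ?thesis using ne ne0 by auto
  qed
  also have "card ?B = (if p = 2 then 1 else
      Suc (card {z \<in> carrier R. z \<otimes> z = [(2 :: int)] \<cdot>\<^bsub>R\<^esub> \<one>}))"
  proof (cases "p = 2")
    case True
    hence "[(2 :: int)] \<cdot>\<^bsub>R\<^esub> \<one> = \<zero>" using one_add_one_eq_zero_iff by (simp add: int_numeral)
    hence B: "?B = {\<zero>}" by (auto simp: integral_iff)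
    show ?thesis unfolding B using True by simp
  next
    case False
    hence "[(2 :: int)] \<cdot>\<^bsub>R\<^esub> \<one> \<noteq> \<zero>" using one_add_one_eq_zero_iff by (simp add: int_numeral)
    thus ?thesis using False by (subst card_insert_disjoint) auto
  qed
  finally have eq: "card (points f0 R) = q * (if p = 2 then 1 else 2) +
    (if p = 2 then 0 else q * (if p = 2 then 1 else 2)) + ((q - (if p = 2 then 1 else 2)) * (q - 1) +
     q * (if p = 2 then 1 else Suc (card {z \<in> carrier R. z \<otimes> z = [(2 :: int)] \<cdot>\<^bsub>R\<^esub> \<one>})))" .
  \<comment> \<open>The substitution removes the truncated subtractions q - 1 and q - 2 on natural
    numbers.\<close>
  obtain r where r: "q = r + 2"
    using q_gt_1 by (metis Suc_leI add.commute le_Suc_ex one_add_one plus_1_eq_Suc)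
  show ?thesis
  proof (cases "p = 2")
    case True
    show ?thesis unfolding eq if_P[OF True] by (simp add: r algebra_simps power2_eq_square)
  next
    case False
    show ?thesis using card_square_roots_int[OF False, of 2] unfolding eq if_not_P[OF False]
      by (simp add: r algebra_simps power2_eq_square)
  qed
qed

text \<open>Here z (1 - z^2) vanishes at 1 and -1, so the degenerate fibers are double lines with q
  points, and z = 0 is the only other zero. No square root enters, hence no quadratic field in the
  zeta function.\<close>

theorem card_points_f2:
  "int (card (points f2 R)) = (if p = 2 then int q ^ 2 + 1 else int q ^ 2 + 2)"
proof -
  let ?k = "\<lambda>z. z \<otimes> (\<one> \<ominus> z \<otimes> z)"
  have "card (points f2 R) = (\<Sum>z\<in>carrier R. card (pencil z (?k z)))"
    unfolding card_points_fibers by (intro sum.cong) (simp_all only: fiber_f2)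
  also have "\<dots> = card (pencil \<one> (?k \<one>)) + (if p = 2 then 0 else card (pencil (\<ominus> \<one>) (?k (\<ominus> \<one>)))) +
    ((q - (if p = 2 then 1 else 2)) * (q - 1) +
     q * card {z \<in> carrier R - {\<one>, \<ominus> \<one>}. ?k z = \<zero>})"
    by (rule sum_pencil_split) simp
  also have "?k \<one> = \<zero>" by simp
  also have "card (pencil \<one> \<zero>) = q"
  proof -
    have "{w \<in> carrier R. w \<otimes> w = \<zero>} = {\<zero>}" by (auto simp: integral_iff)
    thus ?thesis by (simp add: card_pencil_one)
  qed
  also have "?k (\<ominus> \<one>) = \<zero>" by (simp add: l_minus r_minus)
  also have "card (pencil (\<ominus> \<one>) \<zero>) = q"
  proof -
    have "{w \<in> carrier R. w \<otimes> w = \<ominus> \<zero>} = {\<zero>}" by (auto simp: integral_iff)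
    thus ?thesis by (simp add: card_pencil_minus_one)
  qed
  also have "{z \<in> carrier R - {\<one>, \<ominus> \<one>}. ?k z = \<zero>} = {\<zero>}"
  proof -
    have ne0: "\<zero> \<noteq> \<ominus> \<one>" using minus_minus[of \<one>] by (metis minus_zero one_closed zero_not_one)
    have "?k z = \<zero> \<longleftrightarrow> z = \<zero> \<or> z \<otimes> z = \<one>" if "z \<in> carrier R" for z
      using that by (auto simp: integral_iff)
    thus ?thesis using square_eq_one_iff ne0 by auto
  qed
  finally have eq: "card (points f2 R) = q + (if p = 2 then 0 else q) +
      ((q - (if p = 2 then 1 else 2)) * (q - 1) + q * card {\<zero>})" .
  obtain r where r: "q = r + 2"
    using q_gt_1 by (metis Suc_leI add.commute le_Suc_ex one_add_one plus_1_eq_Suc)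
  show ?thesis
  proof (cases "p = 2")
    case True
    show ?thesis unfolding eq if_P[OF True] by (simp add: r algebra_simps power2_eq_square)
  next
    case False
    show ?thesis unfolding eq if_not_P[OF False] by (simp add: r algebra_simps power2_eq_square)
  qed
qed

text \<open>For odd p the map z -> -z exchanges the roots of the two factors, and a common root
  would satisfy z = -z, so z = 0, which is no root. For p = 2 both factors equal z^2 + z +
  1.\<close>

lemma card_golden_zeros:
  "int (card {z \<in> carrier R. golden z = \<zero>}) =
    (if p = 2 then 1 + (- 1) ^ n else 2 + 2 * Legendre 5 p ^ n)"
proof (cases "p = 2")
  case True
  have m1: "\<ominus> \<one> = \<one>" using True minus_one_eq_one_iff by simp
  have neg: "\<ominus> z = z" if "z \<in> carrier R" for z
    using that m1 l_minus[of \<one> z] by simp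
  have "golden z = \<zero> \<longleftrightarrow> z \<otimes> z \<oplus> z \<oplus> \<one> = \<zero>" if "z \<in> carrier R" for z
  proof -
    have "z \<otimes> z \<ominus> (z \<oplus> \<one>) = z \<otimes> z \<oplus> z \<oplus> \<one>" "z \<otimes> z \<ominus> (\<one> \<ominus> z) = z \<otimes> z \<oplus> z \<oplus> \<one>"
      using that by (simp_all add: a_minus_def neg a_assoc a_comm[of \<one> z])
    thus ?thesis using that by (simp add: golden_def integral_iff)
  qed
  hence "{z \<in> carrier R. golden z = \<zero>} = {z \<in> carrier R. z \<otimes> z \<oplus> z \<oplus> \<one> = \<zero>}" by auto
  thus ?thesis using card_cube_roots_char_2[OF True] True by simp
next
  case False
  let ?A = "{z \<in> carrier R. z \<otimes> z = z \<oplus> \<one>}" and ?B = "{z \<in> carrier R. z \<otimes> z = \<one> \<ominus> z}"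
  have "{z \<in> carrier R. golden z = \<zero>} = ?A \<union> ?B"
    by (auto simp: golden_def integral_iff)
  moreover have "?A \<inter> ?B = {}"
  proof -
    have False if "z \<in> carrier R" "z \<otimes> z = z \<oplus> \<one>" "z \<otimes> z = \<one> \<ominus> z" for z
    proof -
      have "\<one> \<oplus> z = \<one> \<oplus> \<ominus> z" using that by (simp add: a_minus_def a_comm)
      hence "z = \<ominus> z" using that(1) by simp
      hence "z = \<zero>" using eq_uminus_iff[OF False that(1)] by simp
      thus False using that(2) by simp
    qed
    thus ?thesis by auto
  qed
  moreover have "card ?B = card ?A"
  proof (rule bij_betw_same_card)
    show "bij_betw (\<lambda>z. \<ominus> z) ?B ?A"
      by (rule bij_betwI[where g = "\<lambda>z. \<ominus> z"])
        (auto simp: l_minus r_minus a_minus_def a_comm)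
  qed
  moreover have "finite ?A" "finite ?B" by auto
  ultimately have "card {z \<in> carrier R. golden z = \<zero>} = 2 * card ?A"
    by (simp add: card_Un_disjoint)
  thus ?thesis using card_golden_roots[OF False] card_square_roots_int[OF False, of 5] False by simp
qed

text \<open>For odd p: 2 q points over each of 1 and -1, then (q - 3) (q - 1) because z = 0 drops
  out as well, and q for each root of \<open>golden\<close>. For p = 2: q, (q - 2) (q - 1), and q
  for each root.\<close>

theorem card_points_f1:
  "int (card (points f1 R)) =
    (if p = 2 then int q ^ 2 - int q + 2 + (- 1) ^ n * int q
     else int q ^ 2 + 3 + 2 * int q + 2 * Legendre 5 p ^ n * int q)"
proof -
  let ?k = "\<lambda>z. inv z \<otimes> (\<ominus> golden z)" and ?N = "\<lambda>z. card (pencil z (inv z \<otimes> (\<ominus> golden z)))"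
  let ?S = "carrier R - {\<zero>, \<one>, \<ominus> \<one>}"
  have ne0: "\<zero> \<noteq> \<ominus> \<one>" using minus_minus[of \<one>] by (metis minus_zero one_closed zero_not_one)
  have g1: "golden \<one> = \<ominus> \<one>" unfolding golden_def by algebra
  have gm1: "golden (\<ominus> \<one>) = \<ominus> \<one>"
    unfolding golden_def by algebra
  have inv1: "inv (\<ominus> \<one>) = \<ominus> \<one>"
    by (rule comm_inv_char) (simp_all add: l_minus r_minus)
  have g0: "golden \<zero> = \<one>"
    by (simp add: golden_def a_minus_def l_minus r_minus)
  have "card (points f1 R) = (\<Sum>z\<in>carrier R - {\<zero>}. card {(x, y) \<in> carrier R \<times> carrier R.
     zpoly_eval R (case_var x y z) f1 = \<zero>})"
    unfolding card_points_fibers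
  proof (rule sum.mono_neutral_right)
    show "\<forall>z\<in>carrier R - (carrier R - {\<zero>}). card {(x, y) \<in> carrier R \<times> carrier R.
        zpoly_eval R (case_var x y z) f1 = \<zero>} = 0"
    proof
      fix z assume "z \<in> carrier R - (carrier R - {\<zero>})"
      hence "z = \<zero>" by auto
      thus "card {(x, y) \<in> carrier R \<times> carrier R. zpoly_eval R (case_var x y z) f1 = \<zero>} = 0"
        by (simp only: fiber_f1_zero card.empty)
    qed
  qed auto
  also have "\<dots> = (\<Sum>z\<in>carrier R - {\<zero>}. ?N z)"
  proof (intro sum.cong refl)
    fix z assume "z \<in> carrier R - {\<zero>}"
    hence z: "z \<in> carrier R" "z \<noteq> \<zero>" by auto
    show "card {(x, y) \<in> carrier R \<times> carrier R. zpoly_eval R (case_var x y z) f1 = \<zero>} = ?N z"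
      by (simp only: fiber_f1[OF z])
  qed
  also have "\<dots> = (\<Sum>z\<in>{\<one>, \<ominus> \<one>}. ?N z) + (\<Sum>z\<in>?S. ?N z)"
    using ne0 by (subst sum.union_disjoint[symmetric]) (auto intro: sum.cong)
  also have "(\<Sum>z\<in>{\<one>, \<ominus> \<one>}. ?N z) = ?N \<one> + (if p = 2 then 0 else ?N (\<ominus> \<one>))"
    using minus_one_eq_one_iff by auto
  also have "?k \<one> = \<one>" by (simp add: g1)
  also have "card (pencil \<one> \<one>) = q * (if p = 2 then 1 else 2)"
    by (simp add: card_pencil_one card_square_roots_one)
  also have "?k (\<ominus> \<one>) = \<ominus> \<one>" by (simp add: gm1 inv1 l_minus r_minus)
  also have "card (pencil (\<ominus> \<one>) (\<ominus> \<one>)) = q * (if p = 2 then 1 else 2)"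
    by (simp add: card_pencil_minus_one card_square_roots_one)
  also have "(\<Sum>z\<in>?S. ?N z) = card ?S * (q - 1) + q * card {z \<in> ?S. ?k z = \<zero>}"
    using square_eq_one_iff by (intro sum_card_pencil) (auto simp: field_Units)
  also have "card ?S = q - (if p = 2 then 2 else 3)"
    using minus_one_eq_one_iff ne0 by (subst card_Diff_subset) (auto simp: card_q card_insert_if)
  also have "{z \<in> ?S. ?k z = \<zero>} = {z \<in> carrier R. golden z = \<zero>}"
  proof -
    have "?k z = \<zero> \<longleftrightarrow> golden z = \<zero>" if "z \<in> carrier R" "z \<noteq> \<zero>" for z
    proof -
      have "inv z \<in> carrier R" "inv z \<otimes> z = \<one>" using that by (simp_all add: field_Units)
      moreover from this have "inv z \<noteq> \<zero>" using that by auto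
      moreover have "\<ominus> golden z = \<zero> \<longleftrightarrow> golden z = \<zero>"
        using that minus_minus[of "golden z"] by auto
      ultimately show ?thesis using that by (simp add: integral_iff)
    qed
    moreover have "z \<in> ?S" if "z \<in> carrier R" "golden z = \<zero>" for z
      using that g0 g1 gm1 ne0 by auto
    ultimately show ?thesis by blast
  qed
  finally have eq: "card (points f1 R) = q * (if p = 2 then 1 else 2) +
    (if p = 2 then 0 else q * (if p = 2 then 1 else 2)) + ((q - (if p = 2 then 2 else 3)) * (q - 1) +
     q * card {z \<in> carrier R. golden z = \<zero>})" .
  show ?thesis
  proof (cases "p = 2")
    case True
    obtain r where r: "q = r + 2"
      using q_gt_1 by (metis Suc_leI add.commute le_Suc_ex one_add_one plus_1_eq_Suc)
    show ?thesis using card_golden_zeros unfolding eq if_P[OF True]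
      by (simp add: r algebra_simps power2_eq_square)
  next
    case False
    \<comment> \<open>Three values of z are removed, so q \<ge> 3 is what makes the truncated
      subtraction exact.\<close>
    hence "q \<noteq> 2" using odd_q by auto
    hence "q \<ge> 3" using q_gt_1 by linarith
    then obtain r where r: "q = r + 3" by (metis add.commute le_Suc_ex)
    show ?thesis using card_golden_zeros unfolding eq if_not_P[OF False]
      by (simp add: r algebra_simps power2_eq_square)
  qed
qed

end

section \<open>Ideals of quadratic orders\<close>

text \<open>The generator is the least positive element; a nonzero remainder modulo it would be
  smaller.\<close>

lemma int_subgroup_principal:
  fixes S :: "int set"
  assumes diff: "\<And>x y. x \<in> S \<Longrightarrow> y \<in> S \<Longrightarrow> x - y \<in> S" and ex: "x0 \<in> S" "x0 \<noteq> 0"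
  obtains a where "a > 0" "S = {x. a dvd x}"
proof -
  have zero: "0 \<in> S" using diff[OF ex(1) ex(1)] by simp
  have neg: "- x \<in> S" if "x \<in> S" for x using diff[OF zero that] by simp
  have add: "x + y \<in> S" if "x \<in> S" "y \<in> S" for x y using diff[OF that(1) neg[OF that(2)]] by simp
  have mult_nat: "int k * x \<in> S" if "x \<in> S" for k x
    using that by (induction k) (auto simp: zero ring_distribs add)
  have mult: "k * x \<in> S" if "x \<in> S" for k x
    using mult_nat[OF that, of "nat k"] neg[OF mult_nat[OF that, of "nat (- k)"]]
    by (cases "k \<ge> 0") auto
  define P where "P n \<longleftrightarrow> n > 0 \<and> int n \<in> S" for n
  have "P (nat \<bar>x0\<bar>)" using ex neg[OF ex(1)] by (auto simp: P_def abs_if)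
  hence P: "P (LEAST n. P n)" and least: "\<And>n. P n \<Longrightarrow> (LEAST n. P n) \<le> n"
    by (auto intro: LeastI Least_le)
  define a where "a = int (LEAST n. P n)"
  have a: "a > 0" "a \<in> S" using P by (auto simp: a_def P_def)
  have "a dvd x" if "x \<in> S" for x
  proof (rule ccontr)
    assume "\<not> a dvd x"
    hence pos: "x mod a > 0" using a(1) by (simp add: dvd_eq_mod_eq_0 order_less_le)
    have "x mod a \<in> S" using diff[OF that mult[OF a(2), of "x div a"]] by (simp add: minus_div_mult_eq_mod)
    hence "P (nat (x mod a))" using pos by (simp add: P_def)
    hence "a \<le> x mod a" using least pos by (fastforce simp: a_def)
    thus False using pos_mod_bound[OF a(1), of x] by simp
  qed
  moreover have "x \<in> S" if "a dvd x" for x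
    using that mult[OF a(2)] by (auto elim!: dvdE simp: mult.commute)
  ultimately show ?thesis using that[of a] a(1) by auto
qed

text \<open>The order \<open>\<int>[w]\<close> where \<open>w\<^sup>2 = t w + c\<close>.\<close>

locale quadratic_order =
  fixes t c :: int and w :: complex
  assumes w_square: "w * w = of_int t * w + of_int c"
    and independent: "\<And>u v. of_int u + of_int v * w = 0 \<Longrightarrow> u = 0 \<and> v = 0"
begin

definition elt :: "int \<Rightarrow> int \<Rightarrow> complex" where
  "elt u v = of_int u + of_int v * w"

text \<open>Built like \<open>ring_of_integers\<close>, by restricting the carrier, so that the two
  records can be proved equal.\<close>

definition order_ring :: "complex ring" where
  "order_ring = ring_of_type_algebra\<lparr>carrier := {elt u v |u v. True}\<rparr>"

text \<open>
  \<open>lattice a m b = a (\<int> m + \<int> (b + w))\<close> is the Hermite normal form of a sublattice of \<open>\<int>[w]\<close>; it is an ideal iff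
  \<open>m\<close> divides \<open>b\<^sup>2 + t b - c\<close>, and then its index is \<open>a\<^sup>2 m\<close>.
\<close>

definition lattice :: "int \<Rightarrow> int \<Rightarrow> int \<Rightarrow> complex set" where
  "lattice a m b = {elt x y |x y. a dvd y \<and> a * m dvd x - b * y}"

lemma elt_eq_iff: "elt u v = elt u' v' \<longleftrightarrow> u = u' \<and> v = v'"
proof
  assume "elt u v = elt u' v'"
  hence "of_int (u - u') + of_int (v - v') * w = 0" by (simp add: elt_def algebra_simps)
  from independent[OF this] show "u = u' \<and> v = v'" by simp
qed simp

lemma elt_add: "elt u v + elt u' v' = elt (u + u') (v + v')"
  and elt_diff: "elt u v - elt u' v' = elt (u - u') (v - v')"
  and elt_uminus: "- elt u v = elt (- u) (- v)"
  by (simp_all add: elt_def algebra_simps)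

lemma elt_mult: "elt u v * elt u' v' = elt (u * u' + c * v * v') (u * v' + v * u' + t * v * v')"
proof -
  have "elt u v * elt u' v' = of_int (u * u') + of_int (u * v' + v * u') * w + of_int (v * v') * (w * w)"
    by (simp add: elt_def algebra_simps)
  thus ?thesis by (simp add: w_square elt_def algebra_simps)
qed

lemma elt_0: "elt 0 0 = 0" and elt_1: "elt 1 0 = 1"
  by (simp_all add: elt_def)

lemma elt_eq_0_iff: "elt u v = 0 \<longleftrightarrow> u = 0 \<and> v = 0"
  using elt_eq_iff[of u v 0 0] by (simp add: elt_0)

lemma elt_mem_lattice_iff: "elt x y \<in> lattice a m b \<longleftrightarrow> a dvd y \<and> a * m dvd x - b * y"
  by (auto simp: lattice_def elt_eq_iff)

sublocale cring order_ring
proof -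
  interpret C: cring "ring_of_type_algebra :: complex ring" by (rule cring_from_type_algebra)
  have "subring ({elt u v |u v. True}) (ring_of_type_algebra :: complex ring)"
  proof (rule C.subringI)
    fix h assume h: "h \<in> {elt u v |u v. True}"
    have "\<ominus>\<^bsub>ring_of_type_algebra\<^esub> h = - h"
      by (rule C.minus_equality) (auto simp: ring_of_type_algebra_def)
    thus "\<ominus>\<^bsub>ring_of_type_algebra\<^esub> h \<in> {elt u v |u v. True}"
      using h elt_uminus by fastforce
  next
    show "\<one>\<^bsub>ring_of_type_algebra\<^esub> \<in> {elt u v |u v. True}"
      using elt_1[symmetric] by (simp add: ring_of_type_algebra_def) blast
  qed (auto simp: ring_of_type_algebra_def elt_add elt_mult, metis+)
  thus "cring order_ring"
    unfolding order_ring_def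
    by (intro C.subcring_iff[THEN iffD1] C.subcringI') (auto simp: ring_of_type_algebra_def)
qed

lemma order_ring_simps:
  "carrier order_ring = {elt u v |u v. True}" "x \<oplus>\<^bsub>order_ring\<^esub> y = x + y"
  "x \<otimes>\<^bsub>order_ring\<^esub> y = x * y" "\<zero>\<^bsub>order_ring\<^esub> = 0" "\<one>\<^bsub>order_ring\<^esub> = 1"
  by (simp_all add: order_ring_def ring_of_type_algebra_def)

lemma elt_closed: "elt u v \<in> carrier order_ring"
  by (auto simp: order_ring_simps)

lemma order_ring_uminus: "x \<in> carrier order_ring \<Longrightarrow> \<ominus>\<^bsub>order_ring\<^esub> x = - x"
proof (rule minus_equality)
  assume "x \<in> carrier order_ring"
  thus "- x \<in> carrier order_ring" using elt_uminus by (fastforce simp: order_ring_simps)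
qed (simp_all add: order_ring_simps)

lemma order_ring_minus:
  "x \<in> carrier order_ring \<Longrightarrow> y \<in> carrier order_ring \<Longrightarrow> x \<ominus>\<^bsub>order_ring\<^esub> y = x - y"
  by (simp add: a_minus_def order_ring_uminus order_ring_simps(2))

text \<open>Sending w to -b is a ring homomorphism onto the integers modulo m, because X^2 - t X - c
  takes the value b^2 + t b - c at -b. The lattice is a times its kernel.\<close>

lemma ideal_lattice:
  assumes "m dvd b * b + t * b - c"
  shows "ideal (lattice a m b) order_ring"
proof (rule idealI)
  have mult: "r * x \<in> lattice a m b" if xr: "x \<in> lattice a m b" "r \<in> carrier order_ring" for x r
  proof -
    obtain x1 x2 where x: "x = elt x1 x2" "a dvd x2" "a * m dvd x1 - b * x2"
      using xr(1) by (auto simp: lattice_def)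
    obtain r1 r2 where r: "r = elt r1 r2" using xr(2) by (auto simp: order_ring_simps)
    obtain j where j: "x2 = a * j" using x(2) by (elim dvdE)
    obtain l where l: "x1 - b * x2 = a * m * l" using x(3) by (elim dvdE)
    obtain k where k: "b * b + t * b - c = m * k" using assms by (elim dvdE)
    have x1: "x1 = a * m * l + b * (a * j)" using l j by simp
    \<comment> \<open>With phi(x1 + x2 w) = x1 - b x2 this reads phi(r x) = phi(r) phi(x) - r2 x2
      (b^2 + t b - c).\<close>
    have "(r1 * x1 + c * r2 * x2) - b * (r1 * x2 + r2 * x1 + t * r2 * x2) =
        r1 * (x1 - b * x2) - b * r2 * (x1 - b * x2) - r2 * x2 * (b * b + t * b - c)"
      by (simp add: algebra_simps)
    also have "\<dots> = a * m * (r1 * l - b * r2 * l - r2 * j * k)"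
      unfolding l k unfolding j by (simp add: algebra_simps)
    finally have "a * m dvd (r1 * x1 + c * r2 * x2) - b * (r1 * x2 + r2 * x1 + t * r2 * x2)"
      by simp
    moreover have "a dvd r1 * x2 + r2 * x1 + t * r2 * x2"
      by (simp add: x1 j mult.assoc mult.left_commute[of _ a] dvd_add)
    ultimately show ?thesis by (simp add: x(1) r elt_mult elt_mem_lattice_iff)
  qed
  show "ring order_ring" by (rule ring_axioms)
  show "r \<otimes>\<^bsub>order_ring\<^esub> x \<in> lattice a m b" "x \<otimes>\<^bsub>order_ring\<^esub> r \<in> lattice a m b"
    if "x \<in> lattice a m b" "r \<in> carrier order_ring" for x r
    using mult[OF that] by (simp_all add: order_ring_simps mult.commute)
  show "subgroup (lattice a m b) (add_monoid order_ring)"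
  proof (rule add.subgroupI)
    show "lattice a m b \<subseteq> carrier order_ring" by (auto simp: lattice_def elt_closed)
    have "elt 0 0 \<in> lattice a m b" by (simp add: elt_mem_lattice_iff)
    thus "lattice a m b \<noteq> {}" by auto
    show "\<ominus>\<^bsub>order_ring\<^esub> x \<in> lattice a m b" if mem: "x \<in> lattice a m b" for x
    proof -
      obtain x1 x2 where x: "x = elt x1 x2" "a dvd x2" "a * m dvd x1 - b * x2"
        using mem by (auto simp: lattice_def)
      have "a * m dvd - (x1 - b * x2)" using x(3) by (simp only: dvd_minus_iff)
      thus ?thesis using x(2) by (simp add: x(1) order_ring_uminus elt_closed elt_uminus elt_mem_lattice_iff)
    qed
    show "x \<oplus>\<^bsub>order_ring\<^esub> y \<in> lattice a m b" if mem: "x \<in> lattice a m b" "y \<in> lattice a m b" for x y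
    proof -
      obtain x1 x2 where x: "x = elt x1 x2" "a dvd x2" "a * m dvd x1 - b * x2"
        using mem by (auto simp: lattice_def)
      obtain y1 y2 where y: "y = elt y1 y2" "a dvd y2" "a * m dvd y1 - b * y2"
        using mem by (auto simp: lattice_def)
      have "a * m dvd (x1 - b * x2) + (y1 - b * y2)" using x(3) y(3) by (rule dvd_add)
      thus ?thesis using x(2) y(2)
        by (simp add: x(1) y(1) order_ring_simps elt_add elt_mem_lattice_iff algebra_simps)
    qed
  qed
qed

text \<open>The w-coordinates of elements of I form a group generated by a, the integers in I one
  generated by k. Closure under multiplication by w forces k = a m and makes a divide an element of
  I with w-coordinate a.\<close>

lemma nonzero_ideal_is_lattice:
  assumes I: "ideal I order_ring" and nz: "I \<noteq> {0}"
  obtains a m b where "a > 0" "m > 0" "0 \<le> b" "b < m" "m dvd b * b + t * b - c" "I = lattice a m b"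
proof -
  interpret I: ideal I order_ring by (rule I)
  define J where "J x y \<longleftrightarrow> elt x y \<in> I" for x y
  have zero: "0 \<in> I"
    using additive_subgroup.zero_closed[OF ideal.axioms(1)[OF I]] by (simp add: order_ring_simps)
  have Jdiff: "J (x - x') (y - y')" if "J x y" "J x' y'" for x y x' y'
  proof -
    have "elt x y \<oplus>\<^bsub>order_ring\<^esub> (\<ominus>\<^bsub>order_ring\<^esub> elt x' y') \<in> I"
      using that unfolding J_def
      by (intro additive_subgroup.a_closed additive_subgroup.a_inv_closed ideal.axioms(1)[OF I])
    thus ?thesis
      by (simp only: J_def order_ring_uminus[OF elt_closed] order_ring_simps elt_uminus elt_add) simp
  qed
  have Jmult: "J (u * x + c * v * y) (u * y + v * x + t * v * y)" if "J x y" for x y u v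
    using I.I_l_closed[of "elt x y" "elt u v"] that
    by (simp add: J_def elt_closed order_ring_simps(3) elt_mult)
  have Jscale: "J (u * x) (u * y)" if "J x y" for u x y using Jmult[OF that, of u 0] by simp
  have Jadd: "J (x + x') (y + y')" if "J x y" "J x' y'" for x y x' y'
    using Jdiff[OF that(1) Jscale[OF that(2), of "-1"]] by simp
  have sub: "I \<subseteq> {elt u v |u v. True}" using I.a_subset by (simp add: order_ring_simps)
  have Jw: "J (c * y) (x + t * y)" if "J x y" for x y using Jmult[OF that, of 0 1] by simp
  obtain x0 y0 where xy0: "J x0 y0" "x0 \<noteq> 0 \<or> y0 \<noteq> 0"
  proof -
    obtain z where z: "z \<in> I" "z \<noteq> 0" using nz zero by auto
    then obtain x y where "z = elt x y" using sub by auto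
    thus ?thesis using z that[of x y] by (auto simp: J_def elt_eq_0_iff)
  qed
  define A where "A = {y. \<exists>x. J x y}"
  define K where "K = {x. J x 0}"
  have "\<exists>y\<in>A. y \<noteq> 0"
  proof (cases "y0 = 0")
    case True
    thus ?thesis using xy0 Jw[OF xy0(1)] by (auto simp: A_def)
  qed (use xy0 in \<open>auto simp: A_def\<close>)
  then obtain y1 where "y1 \<in> A" "y1 \<noteq> 0" by blast
  then obtain a where a: "a > 0" "A = {x. a dvd x}"
  proof (rule int_subgroup_principal[rotated])
    show "x - y \<in> A" if "x \<in> A" "y \<in> A" for x y
      using that Jdiff unfolding A_def by blast
  qed
  have "a \<in> A" using a by simp
  then obtain x1 where x1: "J x1 a" by (auto simp: A_def)
  \<comment> \<open>Multiplication by the conjugate (x1 + t a) - a w produces the norm of x1 + a w,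
    a nonzero integer in I.\<close>
  have "J (x1 * x1 + t * x1 * a - c * a * a) 0"
    using Jmult[OF x1, of "x1 + t * a" "- a"] by (simp add: algebra_simps)
  moreover have "x1 * x1 + t * x1 * a - c * a * a \<noteq> 0"
  proof
    assume "x1 * x1 + t * x1 * a - c * a * a = 0"
    hence "elt (x1 + t * a) (- a) * elt x1 a = 0"
      by (simp add: elt_mult elt_eq_0_iff algebra_simps)
    thus False using a(1) by (simp add: elt_eq_0_iff)
  qed
  ultimately have "x1 * x1 + t * x1 * a - c * a * a \<in> K" "x1 * x1 + t * x1 * a - c * a * a \<noteq> 0"
    by (auto simp: K_def)
  then obtain k where k: "k > 0" "K = {x. k dvd x}"
  proof (rule int_subgroup_principal[rotated])
    show "x - y \<in> K" if "x \<in> K" "y \<in> K" for x y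
      using that Jdiff[of x 0 y 0] unfolding K_def by simp
  qed
  have "k \<in> K" using k(2) by simp
  hence Jk: "J k 0" by (simp add: K_def)
  have "k \<in> A" using Jw[OF Jk] by (auto simp: A_def)
  then obtain m where m: "k = a * m" using a by (auto elim: dvdE)
  \<comment> \<open>This is the w-coordinate of w (x1 + a w).\<close>
  have "x1 + t * a \<in> A" using Jw[OF x1] by (auto simp: A_def)
  hence "a dvd x1" using a by (simp add: dvd_add_left_iff)
  then obtain b0 where b0: "x1 = a * b0" by (elim dvdE)
  have m0: "m > 0" using k(1) a(1) m by (simp add: zero_less_mult_iff)
  define b where "b = b0 mod m"
  have Jab: "J (a * b) a"
  proof -
    have "J (x1 - (b0 div m) * k) a" using Jdiff[OF x1 Jscale[OF Jk, of "b0 div m"]] by simp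
    moreover have "x1 - (b0 div m) * k = a * (b0 - b0 div m * m)" by (simp add: b0 m algebra_simps)
    ultimately show ?thesis by (simp add: b_def minus_div_mult_eq_mod)
  qed
  have JL: "J x y \<longleftrightarrow> a dvd y \<and> a * m dvd x - b * y" for x y
  proof
    assume J: "J x y"
    hence "y \<in> A" by (auto simp: A_def)
    then obtain j where j: "y = a * j" using a by (auto elim: dvdE)
    have "J (x - j * (a * b)) (y - j * a)" using Jdiff[OF J Jscale[OF Jab, of j]] .
    hence "x - b * y \<in> K" by (simp add: K_def j mult_ac)
    thus "a dvd y \<and> a * m dvd x - b * y" using j k m by simp
  next
    assume *: "a dvd y \<and> a * m dvd x - b * y"
    then obtain j where j: "y = a * j" by (auto elim: dvdE)
    have "x - b * y \<in> K" using * k m by simp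
    hence "J (x - b * y) 0" by (simp add: K_def)
    from Jadd[OF this Jscale[OF Jab, of j]] show "J x y" by (simp add: j mult_ac)
  qed
  \<comment> \<open>Membership of w times a (b + w) in the lattice is the divisibility condition on
    b.\<close>
  have "a * m dvd c * a - b * (a * b + t * a)" using Jw[OF Jab] by (simp add: JL)
  hence "a * m dvd a * (- (b * b + t * b - c))" by (simp add: algebra_simps)
  hence "m dvd - (b * b + t * b - c)" using a(1) by (subst (asm) dvd_mult_cancel_left) simp
  hence "m dvd b * b + t * b - c" by (simp only: dvd_minus_iff)
  moreover have "I = lattice a m b"
  proof (intro equalityI subsetI)
    fix z assume "z \<in> I"
    moreover from this obtain x y where "z = elt x y" using sub by auto
    ultimately show "z \<in> lattice a m b" using JL[of x y] by (simp add: J_def elt_mem_lattice_iff)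
  next
    fix z assume "z \<in> lattice a m b"
    moreover from this obtain x y where "z = elt x y" by (auto simp: lattice_def)
    ultimately show "z \<in> I" using JL[of x y] by (simp add: J_def elt_mem_lattice_iff)
  qed
  ultimately show ?thesis using a(1) m0 by (intro that[of a m b]) (simp_all add: b_def)
qed

text \<open>The set determines a as the generator of its w-coordinates, a m as the generator of its
  integers, and b modulo m.\<close>

lemma lattice_inject:
  assumes "a > 0" "m > 0" "0 \<le> b" "b < m" "a' > 0" "m' > 0" "0 \<le> b'" "b' < m'"
    and eq: "lattice a m b = lattice a' m' b'"
  shows "a = a' \<and> m = m' \<and> b = b'"
proof -
  have iff: "a dvd y \<and> a * m dvd x - b * y \<longleftrightarrow> a' dvd y \<and> a' * m' dvd x - b' * y" for x y
    using eq by (simp only: elt_mem_lattice_iff[symmetric])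
  have "a dvd a'" using iff[of a' "b' * a'"] by simp
  moreover have "a' dvd a" using iff[of a "b * a"] by simp
  ultimately have a: "a = a'" using assms by (intro zdvd_antisym_nonneg) auto
  have "a * m dvd a' * m'" using iff[of 0 "a' * m'"] by simp
  moreover have "a' * m' dvd a * m" using iff[of 0 "a * m"] by simp
  ultimately have "a * m = a' * m'" using assms by (intro zdvd_antisym_nonneg) auto
  hence m: "m = m'" using a assms by simp
  have "a * m dvd a * (b - b')" using iff[of a "b * a"] by (simp add: a m algebra_simps)
  hence "m dvd b - b'" using assms(1) by simp
  hence "b = b'" using assms m by (metis mod_eq_dvd_iff mod_pos_pos_trivial)
  thus ?thesis using a m by simp
qed

lemma lattice_nonzero:
  assumes "a > 0" "m > 0"
  shows "lattice a m b \<noteq> {0}"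
proof -
  have "elt (a * m) 0 \<in> lattice a m b" by (simp add: elt_mem_lattice_iff)
  moreover have "elt (a * m) 0 \<noteq> 0" using assms by (simp add: elt_eq_0_iff)
  ultimately show ?thesis by blast
qed

lemma card_quotient_lattice:
  assumes "a > 0" "m > 0" "m dvd b * b + t * b - c"
  shows "card (carrier (order_ring Quot lattice a m b)) = nat (a * a * m)"
proof -
  let ?L = "lattice a m b"
  interpret I: ideal ?L order_ring by (rule ideal_lattice[OF assms(3)])
  have coset_eq: "?L +>\<^bsub>order_ring\<^esub> elt x y = ?L +>\<^bsub>order_ring\<^esub> elt x' y' \<longleftrightarrow>
      a dvd y - y' \<and> a * m dvd (x - x') - b * (y - y')" for x y x' y'
  proof -
    have "?L +>\<^bsub>order_ring\<^esub> elt x y = ?L +>\<^bsub>order_ring\<^esub> elt x' y' \<longleftrightarrow>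
        elt x y \<ominus>\<^bsub>order_ring\<^esub> elt x' y' \<in> ?L"
      using quotient_eq_iff_same_a_r_cos[OF I.ideal_axioms elt_closed elt_closed] by simp
    thus ?thesis by (simp add: order_ring_minus elt_closed elt_diff elt_mem_lattice_iff)
  qed
  let ?f = "\<lambda>(x, y). ?L +>\<^bsub>order_ring\<^esub> elt x y"
  have "bij_betw ?f ({0..<a * m} \<times> {0..<a}) (carrier (order_ring Quot ?L))"
    unfolding bij_betw_def
  proof
    show "inj_on ?f ({0..<a * m} \<times> {0..<a})"
    proof (rule inj_onI, clarify)
      fix x y x' y' assume "x \<in> {0..<a * m}" "y \<in> {0..<a}" "x' \<in> {0..<a * m}" "y' \<in> {0..<a}"
        and "?L +>\<^bsub>order_ring\<^esub> elt x y = ?L +>\<^bsub>order_ring\<^esub> elt x' y'"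
      hence *: "a dvd y - y'" "a * m dvd (x - x') - b * (y - y')" by (simp_all add: coset_eq)
      have "y = y'" using *(1) \<open>y \<in> _\<close> \<open>y' \<in> _\<close>
        by (metis atLeastLessThan_iff mod_eq_dvd_iff mod_pos_pos_trivial)
      moreover from this have "a * m dvd x - x'" using *(2) by simp
      hence "x = x'" using \<open>x \<in> _\<close> \<open>x' \<in> _\<close>
        by (metis atLeastLessThan_iff mod_eq_dvd_iff mod_pos_pos_trivial)
      ultimately show "x = x' \<and> y = y'" by simp
    qed
    have carr: "carrier (order_ring Quot ?L) = range ?f"
      by (auto simp: FactRing_def A_RCOSETS_def' order_ring_simps(1))
    show "?f ` ({0..<a * m} \<times> {0..<a}) = carrier (order_ring Quot ?L)"
      unfolding carr
    proof (intro equalityI subsetI)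
      fix C assume "C \<in> range ?f"
      then obtain x y where C: "C = ?L +>\<^bsub>order_ring\<^esub> elt x y" by auto
      \<comment> \<open>Subtracting j a (b + w) brings the w-coordinate into [0, a); a multiple of a
        m then reduces the integer part.\<close>
      define j where "j = y div a"
      define y' where "y' = y mod a"
      define x' where "x' = (x - j * a * b) mod (a * m)"
      have y: "y - y' = a * j" by (simp add: y'_def j_def minus_mod_eq_mult_div)
      have "(x - j * a * b) - x' = a * m * ((x - j * a * b) div (a * m))"
        unfolding x'_def by (rule minus_mod_eq_mult_div)
      hence "a * m dvd (x - j * a * b) - x'" by simp
      moreover have "(x - x') - b * (y - y') = (x - j * a * b) - x'" by (simp add: y)
      ultimately have "a * m dvd (x - x') - b * (y - y')" by (simp only:)
      hence "C = ?f (x', y')" unfolding C by (simp add: coset_eq y)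
      moreover have "(x', y') \<in> {0..<a * m} \<times> {0..<a}"
        using assms by (simp add: x'_def y'_def)
      ultimately show "C \<in> ?f ` ({0..<a * m} \<times> {0..<a})" by blast
    qed auto
  qed
  from bij_betw_same_card[OF this] show ?thesis
    using assms by (simp add: card_cartesian_product nat_mult_distrib mult_ac)
qed

definition root_set :: "nat \<Rightarrow> int set" where
  "root_set m = {b \<in> {0..<int m}. int m dvd b * b + t * b - c}"

definition ideal_index :: "(nat \<times> nat \<times> int) set" where
  "ideal_index = (SIGMA a:{1..}. SIGMA m:{1..}. root_set m)"

lemma bij_betw_ideals:
  "bij_betw (\<lambda>(a, m, b). lattice (int a) (int m) b) ideal_index
    {I. ideal I order_ring \<and> I \<noteq> {0}}"
  unfolding bij_betw_def
proof
  show "inj_on (\<lambda>(a, m, b). lattice (int a) (int m) b) ideal_index"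
  proof (rule inj_onI)
    fix i j assume ij: "i \<in> ideal_index" "j \<in> ideal_index"
      "(\<lambda>(a, m, b). lattice (int a) (int m) b) i = (\<lambda>(a, m, b). lattice (int a) (int m) b) j"
    obtain a m b a' m' b' where "i = (a, m, b)" "j = (a', m', b')" by (metis prod_cases3)
    thus "i = j"
      using ij lattice_inject[of "int a" "int m" b "int a'" "int m'" b']
      by (auto simp: ideal_index_def root_set_def)
  qed
  show "(\<lambda>(a, m, b). lattice (int a) (int m) b) ` ideal_index = {I. ideal I order_ring \<and> I \<noteq> {0}}"
  proof (intro equalityI subsetI)
    fix I assume "I \<in> {I. ideal I order_ring \<and> I \<noteq> {0}}"
    then obtain a m b where "a > 0" "m > 0" "0 \<le> b" "b < m" "m dvd b * b + t * b - c" "I = lattice a m b"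
      using nonzero_ideal_is_lattice[of I] by auto
    thus "I \<in> (\<lambda>(a, m, b). lattice (int a) (int m) b) ` ideal_index"
      by (intro image_eqI[of _ _ "(nat a, nat m, b)"]) (auto simp: ideal_index_def root_set_def Suc_le_eq)
  next
    fix I assume "I \<in> (\<lambda>(a, m, b). lattice (int a) (int m) b) ` ideal_index"
    then obtain a m b where "I = lattice (int a) (int m) b" "a > 0" "m > 0" "b \<in> root_set m"
      by (auto simp: ideal_index_def Suc_le_eq)
    thus "I \<in> {I. ideal I order_ring \<and> I \<noteq> {0}}"
      using lattice_nonzero[of "int a" "int m" b] by (auto simp: root_set_def intro!: ideal_lattice)
  qed
qed

end

section \<open>Rings of integers of quadratic fields\<close>

lemma ring_of_type_algebra_simps:
  "carrier ring_of_type_algebra = UNIV" "x \<oplus>\<^bsub>ring_of_type_algebra\<^esub> y = x + y"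
  "x \<otimes>\<^bsub>ring_of_type_algebra\<^esub> y = x * y" "\<zero>\<^bsub>ring_of_type_algebra\<^esub> = 0"
  "\<one>\<^bsub>ring_of_type_algebra\<^esub> = 1"
  by (simp_all add: ring_of_type_algebra_def)

lemma ring_of_type_algebra_uminus:
  "\<ominus>\<^bsub>ring_of_type_algebra\<^esub> x = - (x :: complex)"
proof -
  interpret C: cring "ring_of_type_algebra :: complex ring" by (rule cring_from_type_algebra)
  show ?thesis by (rule C.minus_equality) (simp_all add: ring_of_type_algebra_simps)
qed

lemma ring_of_type_algebra_inv:
  assumes "x \<noteq> 0"
  shows "inv\<^bsub>ring_of_type_algebra\<^esub> x = inverse (x :: complex)"
proof -
  interpret C: cring "ring_of_type_algebra :: complex ring" by (rule cring_from_type_algebra)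
  show ?thesis using assms by (intro C.comm_inv_char) (simp_all add: ring_of_type_algebra_simps)
qed

text \<open>All powers of the reduced denominator b divide D, but b \<ge> 2 already fails at the
  exponent D, because 2^D > D.\<close>

lemma Ints_if_bounded_denominator_powers:
  fixes x :: "'a::field_char_0"
  assumes "x \<in> \<rat>" "D > 0" and int: "\<And>k. of_int D * x ^ k \<in> \<int>"
  shows "x \<in> \<int>"
proof -
  obtain a b where ab: "b > 0" "coprime a b" "x = of_int a / of_int b"
    using assms(1) by (rule Rats_cases')
  have dvd: "b ^ k dvd D" for k
  proof -
    obtain z where z: "of_int D * x ^ k = of_int z" using int[of k] by (elim Ints_cases)
    hence "of_int (D * a ^ k) = (of_int (z * b ^ k) :: 'a)"
      using ab(1) by (simp add: ab(3) power_divide field_simps)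
    hence "D * a ^ k = z * b ^ k" by (simp only: of_int_eq_iff)
    hence "b ^ k dvd D * a ^ k" by simp
    moreover have "coprime (b ^ k) (a ^ k)" using ab(2) by (simp add: coprime_commute)
    ultimately show ?thesis by (simp add: coprime_dvd_mult_left_iff)
  qed
  have "b = 1"
  proof (rule ccontr)
    assume "b \<noteq> 1"
    hence "b \<ge> 2" using ab(1) by simp
    hence "(2::int) ^ nat D \<le> b ^ nat D" by (intro power_mono) auto
    moreover have "b ^ nat D \<le> D" using dvd assms(2) by (rule zdvd_imp_le)
    moreover have "int (nat D) < int (2 ^ nat D)" by (simp only: of_nat_less_iff less_exp)
    ultimately show False using assms(2) by simp
  qed
  thus ?thesis by (simp add: ab(3))
qed

context
  fixes d :: nat and r :: complex
  assumes d_prime: "Factorial_Ring.prime d" and r_def: "r = complex_of_real (sqrt (real d))"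
begin

lemma r_square: "r * r = of_nat d"
  by (simp add: r_def flip: of_real_mult)

text \<open>A rational algebraic integer is an integer, and the prime d is not the square of
  one.\<close>

lemma r_irrational: "r \<notin> \<rat>"
proof
  assume "r \<in> \<rat>"
  moreover have "algebraic_int r"
    by (rule algebraic_int.intros[of "[:- of_nat d, 0, 1:]"])
      (auto simp: r_square coeff_pCons split: nat.splits)
  ultimately have "r \<in> \<int>" by (intro rational_algebraic_int_is_int)
  then obtain k where "r = of_int k" by (elim Ints_cases)
  hence "of_int (k * k) = (of_int (int d) :: complex)" using r_square by simp
  hence k: "k * k = int d" by (simp only: of_int_eq_iff)
  hence "nat \<bar>k\<bar> * nat \<bar>k\<bar> = d" by (simp flip: nat_mult_distrib abs_mult)
  thus False using d_prime by (metis prime_product[of "nat \<bar>k\<bar>" "nat \<bar>k\<bar>"] mult_1 not_prime_1)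
qed

lemma rational_independent:
  assumes "u \<in> \<rat>" "v \<in> \<rat>" "u + v * r = 0"
  shows "u = 0 \<and> v = 0"
proof (cases "v = 0")
  case False
  hence "r = - u / v" using assms(3) by (simp add: field_simps eq_neg_iff_add_eq_0)
  hence "r \<in> \<rat>" using assms by simp
  thus ?thesis using r_irrational by simp
qed (use assms in simp)

lemma rational_eq:
  assumes "u \<in> \<rat>" "v \<in> \<rat>" "u' \<in> \<rat>" "v' \<in> \<rat>" "u + v * r = u' + v' * r"
  shows "u = u' \<and> v = v'"
  using rational_independent[of "u - u'" "v - v'"] assms by (simp add: algebra_simps)

text \<open>Inverses come from the conjugate u - v r: the norm N is nonzero because r is irrational.
  Conversely, any subfield containing r contains all rationals.\<close>

lemma quadratic_field_eq: "quadratic_field d = {u + v * r |u v. u \<in> \<rat> \<and> v \<in> \<rat>}" (is "_ = ?K")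
proof
  interpret C: field "ring_of_type_algebra :: complex ring" by (rule field_from_type_algebra)
  let ?C = "ring_of_type_algebra :: complex ring"
  note simps = ring_of_type_algebra_simps ring_of_type_algebra_uminus
  have "subfield ?K ?C"
  proof (rule C.subfieldI')
    show "subring ?K ?C"
    proof (rule C.subringI)
      show "\<one>\<^bsub>?C\<^esub> \<in> ?K"
        unfolding simps by (rule CollectI, rule exI[of _ 1], rule exI[of _ 0]) simp
      show "\<ominus>\<^bsub>?C\<^esub> h \<in> ?K" if mem: "h \<in> ?K" for h
      proof -
        obtain u v where "h = u + v * r" "u \<in> \<rat>" "v \<in> \<rat>" using mem by auto
        thus ?thesis by (intro CollectI exI[of _ "- u"] exI[of _ "- v"]) (simp add: simps)
      qed
      fix h h' assume "h \<in> ?K" "h' \<in> ?K"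
      then obtain u v u' v' where h: "h = u + v * r" "u \<in> \<rat>" "v \<in> \<rat>" "h' = u' + v' * r" "u' \<in> \<rat>" "v' \<in> \<rat>"
        by auto
      have "h * h' = u * u' + v * v' * (r * r) + (u * v' + v * u') * r" by (simp add: h algebra_simps)
      hence "h * h' = (u * u' + v * v' * of_nat d) + (u * v' + v * u') * r" by (simp only: r_square)
      thus "h \<otimes>\<^bsub>?C\<^esub> h' \<in> ?K" using h
        by (intro CollectI exI[of _ "u * u' + v * v' * of_nat d"] exI[of _ "u * v' + v * u'"]) (simp add: simps)
      show "h \<oplus>\<^bsub>?C\<^esub> h' \<in> ?K" using h
        by (intro CollectI exI[of _ "u + u'"] exI[of _ "v + v'"]) (simp add: simps algebra_simps)
    qed (simp add: simps)
    fix h assume "h \<in> ?K - {\<zero>\<^bsub>?C\<^esub>}"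
    then obtain u v where h: "h = u + v * r" "u \<in> \<rat>" "v \<in> \<rat>" "h \<noteq> 0" by (auto simp: simps)
    define N where "N = u * u - of_nat d * v * v"
    have NR: "N \<in> \<rat>" using h by (simp add: N_def)
    have "(u + v * r) * (u - v * r) = u * u - v * v * (r * r)" by (simp add: algebra_simps)
    hence prod: "h * (u - v * r) = N" by (simp add: r_square N_def h(1))
    have "u - v * r \<noteq> 0"
      using rational_independent[of u "- v"] h by auto
    hence "N \<noteq> 0" using prod h(4) by auto
    moreover have "inverse h * N = u - v * r"
      unfolding prod[symmetric] using h(4) by (simp flip: mult.assoc)
    ultimately have "inverse h = (u - v * r) / N" by (simp add: eq_divide_eq)
    hence "inverse h = u / N + (- v / N) * r" by (simp add: diff_divide_distrib)
    hence "inverse h \<in> ?K" using h NR by (intro CollectI exI[of _ "u / N"] exI[of _ "- v / N"]) simp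
    thus "inv\<^bsub>?C\<^esub> h \<in> ?K" using h(4) by (simp add: ring_of_type_algebra_inv)
  qed
  moreover have "r \<in> ?K" by (rule CollectI, rule exI[of _ 0], rule exI[of _ 1]) simp
  ultimately show "quadratic_field d \<subseteq> ?K"
    unfolding quadratic_field_def r_def[symmetric]
    by (intro C.generate_field_min_subfield1) (auto simp: simps)
  let ?G = "generate_field ?C {r}"
  have add: "x + y \<in> ?G" and mult: "x * y \<in> ?G" if "x \<in> ?G" "y \<in> ?G" for x y
    using generate_field.eng_add[OF that] generate_field.eng_mult[OF that] by (simp_all add: simps)
  have neg: "- x \<in> ?G" if "x \<in> ?G" for x
    using generate_field.a_inv[OF that] by (simp add: simps)
  have inv: "inverse x \<in> ?G" if "x \<in> ?G" "x \<noteq> 0" for x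
    using generate_field.m_inv[OF that(1)] that by (simp add: simps ring_of_type_algebra_inv)
  have one: "1 \<in> ?G" using generate_field.one[of ?C "{r}"] by (simp add: simps)
  have zero: "0 \<in> ?G" using C.zero_in_generate[of "{r}"] by (simp add: simps)
  have nat: "of_nat n \<in> ?G" for n by (induction n) (auto intro: zero add one)
  have int: "of_int n \<in> ?G" for n by (cases n rule: int_cases2) (auto intro: nat neg)
  have rat: "x \<in> ?G" if mem: "x \<in> \<rat>" for x
  proof -
    obtain a b where "b > 0" "x = of_int a / of_int b" using mem by (elim Rats_cases')
    thus ?thesis using mult[OF int[of a] inv[OF int[of b]]] by (simp add: divide_inverse)
  qed
  have "r \<in> ?G" by (rule generate_field.incl) simp
  thus "?K \<subseteq> quadratic_field d"
    unfolding quadratic_field_def r_def[symmetric] by (auto intro: add mult rat)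
qed

text \<open>The order generated by r; for d = 5 it has index 2 in the ring of integers.\<close>

definition "int_span = {of_int u + of_int v * r |u v. True}"

lemma int_span_add: "x \<in> int_span \<Longrightarrow> y \<in> int_span \<Longrightarrow> x + y \<in> int_span"
proof -
  assume "x \<in> int_span" "y \<in> int_span"
  then obtain u v u' v' where "x = of_int u + of_int v * r" "y = of_int u' + of_int v' * r"
    by (auto simp: int_span_def)
  thus ?thesis unfolding int_span_def
    by (intro CollectI exI[of _ "u + u'"] exI[of _ "v + v'"]) (simp add: algebra_simps)
qed

lemma int_span_mult: "x \<in> int_span \<Longrightarrow> y \<in> int_span \<Longrightarrow> x * y \<in> int_span"
proof -
  assume "x \<in> int_span" "y \<in> int_span"
  then obtain u v u' v' where xy: "x = of_int u + of_int v * r" "y = of_int u' + of_int v' * r"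
    by (auto simp: int_span_def)
  have "x * y = of_int (u * u') + of_int (v * v') * (r * r) + of_int (u * v' + v * u') * r"
    by (simp add: xy algebra_simps)
  hence "x * y = of_int (u * u' + v * v' * int d) + of_int (u * v' + v * u') * r"
    by (simp add: r_square)
  thus ?thesis unfolding int_span_def by blast
qed

lemma int_span_int: "of_int k \<in> int_span"
  unfolding int_span_def by (intro CollectI exI[of _ k] exI[of _ 0]) simp

lemma int_span_power: "x \<in> int_span \<Longrightarrow> x ^ k \<in> int_span"
  using int_span_int[of 1] by (induction k) (auto intro: int_span_mult)

lemma int_span_sum: "(\<And>i. i \<in> A \<Longrightarrow> f i \<in> int_span) \<Longrightarrow> sum f A \<in> int_span"
  using int_span_int[of 0] by (induction A rule: infinite_finite_induct) (auto intro: int_span_add)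

text \<open>The norm is multiplicative, so D^2 N^k is the norm of D (a + b r)^k and hence an integer
  for every k.\<close>

lemma norm_Ints_if_bounded_denominator:
  assumes "a \<in> \<rat>" "b \<in> \<rat>" "D > 0" and span: "\<And>k. of_int D * (a + b * r) ^ k \<in> int_span"
  shows "a * a - of_nat d * b * b \<in> \<int>"
proof (rule Ints_if_bounded_denominator_powers)
  let ?N = "a * a - of_nat d * b * b"
  show "?N \<in> \<rat>" using assms by simp
  show "D * D > 0" using assms by simp
  fix k
  have "\<exists>u v. u \<in> \<rat> \<and> v \<in> \<rat> \<and> (a + b * r) ^ k = u + v * r \<and> u * u - of_nat d * v * v = ?N ^ k"
  proof (induction k)
    case 0
    show ?case by (intro exI[of _ "1::complex"] exI[of _ "0::complex"]) simp
  next
    case (Suc k)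
    then obtain u v where uv: "u \<in> \<rat>" "v \<in> \<rat>" "(a + b * r) ^ k = u + v * r" "u * u - of_nat d * v * v = ?N ^ k"
      by blast
    have "(a + b * r) ^ Suc k = a * u + b * v * (r * r) + (a * v + b * u) * r"
      by (simp add: uv algebra_simps)
    hence "(a + b * r) ^ Suc k = (a * u + b * v * of_nat d) + (a * v + b * u) * r"
      by (simp only: r_square)
    moreover have "(a * u + b * v * of_nat d) * (a * u + b * v * of_nat d) -
        of_nat d * (a * v + b * u) * (a * v + b * u) = ?N * (u * u - of_nat d * v * v)"
      by (simp add: algebra_simps)
    ultimately show ?case using uv assms
      by (intro exI[of _ "a * u + b * v * of_nat d"] exI[of _ "a * v + b * u"]) simp
  qed
  then obtain u v where uv: "u \<in> \<rat>" "v \<in> \<rat>" "(a + b * r) ^ k = u + v * r" "u * u - of_nat d * v * v = ?N ^ k"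
    by blast
  obtain x y where "of_int D * (a + b * r) ^ k = of_int x + of_int y * r"
    using span[of k] by (auto simp: int_span_def)
  hence "of_int D * u + of_int D * v * r = of_int x + of_int y * r" by (simp add: uv(3) algebra_simps)
  hence xy: "of_int D * u = of_int x" "of_int D * v = of_int y"
    using rational_eq[of "of_int D * u" "of_int D * v" "of_int x" "of_int y"] uv by auto
  have "of_int (D * D) * ?N ^ k = (of_int D * u) * (of_int D * u) - of_nat d * (of_int D * v) * (of_int D * v)"
    unfolding uv(4)[symmetric] by (simp add: algebra_simps)
  also have "\<dots> \<in> \<int>" unfolding xy by simp
  finally show "of_int (D * D) * ?N ^ k \<in> \<int>" .
qed

text \<open>
  The powers of an algebraic integer of \<open>\<rat>(r)\<close> have a common denominator with respect to \<open>\<int> + \<int> r\<close>. Hence so do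
  the powers of its norm, which is therefore an integer; applied to \<open>x + 1\<close>, this handles the trace.
\<close>

lemma algebraic_int_trace_norm:
  assumes ab: "a \<in> \<rat>" "b \<in> \<rat>" and int: "algebraic_int (a + b * r)"
  shows "a * a - of_nat d * b * b \<in> \<int>" "2 * a \<in> \<int>"
proof -
  define x where "x = a + b * r"
  obtain p where p: "poly p x = 0" "Polynomial.coeff p (Polynomial.degree p) = 1"
      "\<And>i. Polynomial.coeff p i \<in> \<int>"
    using int by (auto simp: algebraic_int.simps x_def)
  define n where "n = Polynomial.degree p"
  obtain a1 a2 where a: "a2 > 0" "a = of_int a1 / of_int a2" using ab(1) by (elim Rats_cases')
  obtain b1 b2 where b: "b2 > 0" "b = of_int b1 / of_int b2" using ab(2) by (elim Rats_cases')
  define e where "e = a2 * b2"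
  have "of_int e * x = of_int (a1 * b2) + of_int (b1 * a2) * r"
    unfolding e_def x_def a(2) b(2) using a(1) b(1) by (simp add: field_simps)
  hence ex: "of_int e * x \<in> int_span" unfolding int_span_def by blast
  \<comment> \<open>Since e x has integral coordinates, e^n clears the denominators of x^k for k <
    n; the monic equation of x extends this to every k.\<close>
  define D where "D = e ^ n"
  have D: "D > 0" using a b by (simp add: D_def e_def)
  have "(\<Sum>i\<le>n. Polynomial.coeff p i * x ^ i) = 0" using p(1) by (simp add: poly_altdef n_def)
  moreover have "(\<Sum>i\<le>n. Polynomial.coeff p i * x ^ i) = (\<Sum>i<n. Polynomial.coeff p i * x ^ i) + x ^ n"
    using p(2) by (simp add: n_def lessThan_Suc_atMost[symmetric])
  ultimately have xn: "x ^ n = - (\<Sum>i<n. Polynomial.coeff p i * x ^ i)" by (simp add: add_eq_0_iff)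
  have span: "of_int D * x ^ k \<in> int_span" for k
  proof (induction k rule: less_induct)
    case (less k)
    show ?case
    proof (cases "k < n")
      case True
      have eq: "of_int D * x ^ k = of_int (e ^ (n - k)) * (of_int e * x) ^ k"
        using True by (simp add: D_def power_mult_distrib flip: power_add)
      show ?thesis unfolding eq by (rule int_span_mult[OF int_span_int int_span_power[OF ex]])
    next
      case False
      have "x ^ k = x ^ (k - n) * x ^ n" using False by (simp flip: power_add)
      hence eq: "of_int D * x ^ k = (\<Sum>i<n. - Polynomial.coeff p i * (of_int D * x ^ (k - n + i)))"
        by (simp add: xn sum_distrib_left sum_negf power_add mult_ac)
      have mem: "- Polynomial.coeff p i * (of_int D * x ^ (k - n + i)) \<in> int_span" if "i < n" for i
      proof (rule int_span_mult)
        show "- Polynomial.coeff p i \<in> int_span"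
          using p(3)[of i] int_span_int by (metis Ints_cases Ints_minus)
        show "of_int D * x ^ (k - n + i) \<in> int_span" using False that by (intro less) simp
      qed
      show ?thesis unfolding eq by (rule int_span_sum, rule mem) simp
    qed
  qed
  \<comment> \<open>The additional power x^j makes the induction close when one factor x + 1 is
    expanded.\<close>
  have span1: "of_int D * (x + 1) ^ k * x ^ j \<in> int_span" for k j
  proof (induction k arbitrary: j)
    case 0
    show ?case using span by simp
  next
    case (Suc k)
    have "of_int D * (x + 1) ^ Suc k * x ^ j =
        of_int D * (x + 1) ^ k * x ^ Suc j + of_int D * (x + 1) ^ k * x ^ j"
      by (simp add: algebra_simps)
    thus ?case using Suc by (metis int_span_add)
  qed
  show N: "a * a - of_nat d * b * b \<in> \<int>"
    by (rule norm_Ints_if_bounded_denominator[OF ab D]) (use span in \<open>simp add: x_def\<close>)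
  have eq: "(a + 1) + b * r = x + 1" by (simp add: x_def)
  have "(a + 1) * (a + 1) - of_nat d * b * b \<in> \<int>"
  proof (rule norm_Ints_if_bounded_denominator[OF _ ab(2) D])
    show "of_int D * ((a + 1) + b * r) ^ k \<in> int_span" for k
      unfolding eq using span1[of k 0] by simp
  qed (use ab in simp)
  \<comment> \<open>The norm of x + 1 is the norm of x plus 2 a + 1.\<close>
  from Ints_diff[OF Ints_diff[OF this N] Ints_1] show "2 * a \<in> \<int>" by (simp add: algebra_simps)
qed

text \<open>Trace and norm are integers, so d (2 b)^2 is one. A denominator B of 2 b would have B^2
  dividing the prime d, so B = 1.\<close>

lemma algebraic_int_half_ints:
  assumes ab: "a \<in> \<rat>" "b \<in> \<rat>" and int: "algebraic_int (a + b * r)"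
  obtains T Y :: int where "2 * a = of_int T" "2 * b = of_int Y" "4 dvd T * T - int d * (Y * Y)"
proof -
  obtain T where T: "2 * a = of_int T"
    using algebraic_int_trace_norm(2)[OF assms] by (elim Ints_cases)
  obtain N where N: "a * a - of_nat d * b * b = of_int N"
    using algebraic_int_trace_norm(1)[OF assms] by (elim Ints_cases)
  have eq: "of_nat d * ((2 * b) * (2 * b)) = (2 * a) * (2 * a) - 4 * (of_int N :: complex)"
    by (simp add: N[symmetric] algebra_simps)
  have "2 * b \<in> \<rat>" using ab by simp
  then obtain A B where AB: "B > 0" "coprime A B" "2 * b = of_int A / of_int B" by (elim Rats_cases')
  have "of_int (int d * (A * A)) = (of_int ((T * T - 4 * N) * (B * B)) :: complex)"
    using eq AB(1) unfolding T AB(3) by (simp add: field_simps)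
  hence eq': "int d * (A * A) = (T * T - 4 * N) * (B * B)" by (simp only: of_int_eq_iff)
  hence "B * B dvd int d * (A * A)" by simp
  moreover have "coprime (B * B) (A * A)" using AB(2) by (simp add: coprime_commute)
  ultimately have dvd: "B * B dvd int d" by (simp add: coprime_dvd_mult_left_iff)
  have "B = 1"
  proof -
    have "nat B * nat B dvd d" using dvd AB(1) by (simp flip: nat_mult_distrib add: nat_dvd_iff) 
    then obtain k where "d = nat B * nat B * k" by (elim dvdE)
    hence k: "d = nat B * (nat B * k)" by (simp only: mult.assoc)
    hence "nat B = 1 \<or> nat B * k = 1" using d_prime prime_product by metis
    hence "nat B = 1" by auto
    thus ?thesis using AB(1) by simp
  qed
  thus ?thesis using that[OF T, of A] AB(3) eq' by simp
qed

end

section \<open>The maximal orders of the fields generated by the square roots of 2 and 5\<close>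

lemma (in quadratic_order) algebraic_int_elt: "algebraic_int (elt u v)"
proof (rule algebraic_int.intros)
  \<comment> \<open>The coefficients are the norm and the negated trace of u + v w.\<close>
  let ?p = "[:of_int (u * u + t * u * v - c * v * v), - of_int (2 * u + t * v), 1:] :: complex poly"
  show "Polynomial.coeff ?p (Polynomial.degree ?p) = 1" by simp
  show "\<forall>i. Polynomial.coeff ?p i \<in> \<int>" by (auto simp: coeff_pCons split: nat.splits)
  have "poly ?p (elt u v) = of_int (v * v) * (w * w) - of_int (v * v) * (of_int t * w + of_int c)"
    by (simp add: elt_def algebra_simps)
  thus "poly ?p (elt u v) = 0" by (simp add: w_square)
qed

interpretation sqrt_2: quadratic_order 0 2 "complex_of_real (sqrt 2)"
proof
  have p: "Factorial_Ring.prime (2::nat)" by simp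
  show "u = 0 \<and> v = 0" if "of_int u + of_int v * complex_of_real (sqrt 2) = 0" for u v
    using rational_independent[OF p, of _ "of_int u" "of_int v"] that by simp
qed (simp flip: of_real_mult)

interpretation golden_ratio: quadratic_order 1 1 "(1 + complex_of_real (sqrt 5)) / 2"
proof
  have p: "Factorial_Ring.prime (5::nat)" by simp
  have sq: "complex_of_real (sqrt 5) * complex_of_real (sqrt 5) = 5" by (simp flip: of_real_mult)
  show "(1 + complex_of_real (sqrt 5)) / 2 * ((1 + complex_of_real (sqrt 5)) / 2) =
      of_int 1 * ((1 + complex_of_real (sqrt 5)) / 2) + of_int 1"
    using sq by (simp add: field_simps)
  show "u = 0 \<and> v = 0" if "of_int u + of_int v * ((1 + complex_of_real (sqrt 5)) / 2) = 0" for u v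
  proof -
    have "(of_int (2 * u + v) :: complex) = 0 \<and> (of_int v :: complex) = 0"
      using that by (intro rational_independent[OF p refl]) (simp_all add: field_simps)
    thus ?thesis by (simp only: of_int_eq_0_iff) simp
  qed
qed

text \<open>In half-integral coordinates, 4 dividing T^2 - 2 Y^2 makes T even, and then Y even
  too.\<close>

theorem ring_of_integers_sqrt_2: "ring_of_integers (quadratic_field 2) = sqrt_2.order_ring"
proof -
  have p: "Factorial_Ring.prime (2::nat)" by simp
  let ?r = "complex_of_real (sqrt (real 2))"
  have "{x \<in> quadratic_field 2. algebraic_int x} = {sqrt_2.elt u v |u v. True}"
  proof (intro equalityI subsetI)
    fix x assume "x \<in> {x \<in> quadratic_field 2. algebraic_int x}"
    then obtain a b where x: "x = a + b * ?r" "a \<in> \<rat>" "b \<in> \<rat>" "algebraic_int x"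
      unfolding quadratic_field_eq[OF p refl] by auto
    obtain T Y where TY: "2 * a = of_int T" "2 * b = of_int Y" "4 dvd T * T - int 2 * (Y * Y)"
      using algebraic_int_half_ints[OF p refl x(2,3)] x(1,4) by auto
    obtain k where k: "T * T - int 2 * (Y * Y) = 4 * k" using TY(3) by (elim dvdE)
    hence "T * T = 2 * (Y * Y + 2 * k)" by simp
    hence "even (T * T)" by simp
    then obtain T' where T': "T = 2 * T'" by auto
    have "Y * Y = 2 * (T' * T' - k)" using k by (simp add: T' algebra_simps)
    hence "even (Y * Y)" by simp
    then obtain Y' where Y': "Y = 2 * Y'" by auto
    have "a = of_int T'" "b = of_int Y'" using TY T' Y' by simp_all
    hence "x = sqrt_2.elt T' Y'" by (simp add: x(1) sqrt_2.elt_def)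
    thus "x \<in> {sqrt_2.elt u v |u v. True}" by blast
  next
    fix x assume "x \<in> {sqrt_2.elt u v |u v. True}"
    then obtain u v where x: "x = sqrt_2.elt u v" by auto
    have "x \<in> quadratic_field 2" unfolding quadratic_field_eq[OF p refl]
      by (intro CollectI exI[of _ "of_int u"] exI[of _ "of_int v"]) (simp add: x sqrt_2.elt_def)
    thus "x \<in> {x \<in> quadratic_field 2. algebraic_int x}"
      using sqrt_2.algebraic_int_elt by (simp add: x)
  qed
  thus ?thesis by (simp add: ring_of_integers_def sqrt_2.order_ring_def)
qed

text \<open>Here 4 dividing T^2 - 5 Y^2 only gives T and Y the same parity; with T = Y + 2 k the
  number is k + Y (1 + sqrt 5) / 2.\<close>

theorem ring_of_integers_sqrt_5: "ring_of_integers (quadratic_field 5) = golden_ratio.order_ring"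
proof -
  have p: "Factorial_Ring.prime (5::nat)" by simp
  let ?r = "complex_of_real (sqrt (real 5))"
  have "{x \<in> quadratic_field 5. algebraic_int x} = {golden_ratio.elt u v |u v. True}"
  proof (intro equalityI subsetI)
    fix x assume "x \<in> {x \<in> quadratic_field 5. algebraic_int x}"
    then obtain a b where x: "x = a + b * ?r" "a \<in> \<rat>" "b \<in> \<rat>" "algebraic_int x"
      unfolding quadratic_field_eq[OF p refl] by auto
    obtain T Y where TY: "2 * a = of_int T" "2 * b = of_int Y" "4 dvd T * T - int 5 * (Y * Y)"
      using algebraic_int_half_ints[OF p refl x(2,3)] x(1,4) by auto
    have "even (T * T - int 5 * (Y * Y))" using TY(3) by (rule dvd_trans[rotated]) simp
    hence "even (T - Y)" by simp
    then obtain k where "T - Y = 2 * k" by (elim dvdE)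
    hence T: "T = Y + 2 * k" by simp
    have ab: "a = of_int T / 2" "b = of_int Y / 2"
      using TY(1,2) by (simp_all add: eq_divide_eq mult.commute)
    have "a + b * r = of_int k + of_int Y * ((1 + r) / 2)" for r
      unfolding ab T by (simp add: add_divide_distrib ring_distribs)
    hence "x = golden_ratio.elt k Y" by (simp only: x(1) golden_ratio.elt_def of_nat_numeral)
    thus "x \<in> {golden_ratio.elt u v |u v. True}" by blast
  next
    fix x assume "x \<in> {golden_ratio.elt u v |u v. True}"
    then obtain u v where x: "x = golden_ratio.elt u v" by auto
    have "of_int u + of_int v * ((1 + r) / 2) = (of_int u + of_int v / 2) + of_int v / 2 * r" for r :: complex
      by (simp add: add_divide_distrib ring_distribs)
    hence "x = (of_int u + of_int v / 2) + of_int v / 2 * ?r"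
      by (simp only: x golden_ratio.elt_def of_nat_numeral)
    hence "x \<in> quadratic_field 5" unfolding quadratic_field_eq[OF p refl]
      by (intro CollectI exI conjI) (assumption, simp_all)
    thus "x \<in> {x \<in> quadratic_field 5. algebraic_int x}"
      using golden_ratio.algebraic_int_elt by (simp add: x)
  qed
  thus ?thesis by (simp add: ring_of_integers_def golden_ratio.order_ring_def)
qed

section \<open>Euler product of the Dedekind zeta function\<close>

text \<open>Bridges the discriminant 8 = 4 * 2 and the symbol of 2 occurring in the point counts. By
  Fermat, 4^((p - 1) / 2) = 2^(p - 1) is 1 modulo p.\<close>

lemma Legendre_4_mult:
  assumes "Factorial_Ring.prime p" "p > 2"
  shows "Legendre (4 * a) (int p) = Legendre a (int p)"
proof -
  have "\<not> p dvd 2" using assms by (auto dest: dvd_imp_le)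
  hence "[2 ^ (p - 1) = 1] (mod p)" by (rule fermat_theorem[OF assms(1)])
  hence "[int (2 ^ (p - 1)) = int 1] (mod int p)" by (simp only: cong_int_iff)
  hence two: "[2 ^ (p - 1) = 1] (mod int p)" by simp
  have "odd p" using prime_odd_nat assms by blast
  define e where "e = (p - 1) div 2"
  have e: "2 * e = p - 1" using \<open>odd p\<close> by (simp add: e_def)
  have "(4 * a) ^ e = 2 ^ (p - 1) * a ^ e"
    unfolding e[symmetric] by (simp add: power_mult_distrib power_mult)
  hence "[Legendre (4 * a) (int p) = 2 ^ (p - 1) * a ^ ((p - 1) div 2)] (mod int p)"
    using euler_criterion[OF assms, of "4 * a"] by (simp only: e_def)
  also have "[2 ^ (p - 1) * a ^ ((p - 1) div 2) = 1 * a ^ ((p - 1) div 2)] (mod int p)"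
    by (intro cong_mult two cong_refl)
  also have "[1 * a ^ ((p - 1) div 2) = Legendre a (int p)] (mod int p)"
    using cong_sym[OF euler_criterion[OF assms]] by simp
  finally have "int p dvd Legendre (4 * a) (int p) - Legendre a (int p)"
    by (simp only: cong_iff_dvd_diff)
  \<comment> \<open>Both symbols lie in {-1, 0, 1}, so congruent symbols are equal as soon as p >
    2.\<close>
  moreover have "\<bar>Legendre (4 * a) (int p) - Legendre a (int p)\<bar> < int p"
    using assms(2) by (simp add: Legendre_def)
  ultimately have "Legendre (4 * a) (int p) - Legendre a (int p) = 0"
    by (metis dvd_imp_le_int not_le abs_of_nat)
  thus ?thesis by simp
qed

text \<open>The case n = 1 of the count of square roots, for the field of residues modulo p.\<close>

lemma card_square_roots_mod:
  assumes p: "Factorial_Ring.prime p" "p > 2"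
  shows "int (card {w \<in> {0..<int p}. [w * w = D] (mod int p)}) = 1 + Legendre D (int p)"
proof -
  interpret Z: residues_prime p "residue_ring (int p)"
    using p by (simp add: residues_prime_def)
  let ?Z = "residue_ring (int p)"
  have carr: "carrier ?Z = {0..<int p}" by (auto simp: Z.res_carrier_eq)
  interpret G: galois_field ?Z p 1
    by unfold_locales (use p in \<open>auto simp: carr\<close>)
  have nat: "[n] \<cdot>\<^bsub>?Z\<^esub> \<one>\<^bsub>?Z\<^esub> = int n mod int p" for n :: nat
    by (induction n) (simp_all add: Z.res_add_eq Z.res_one_eq Z.res_zero_eq mod_simps add.commute)
  have "[D] \<cdot>\<^bsub>?Z\<^esub> \<one>\<^bsub>?Z\<^esub> = [(D mod int p)] \<cdot>\<^bsub>?Z\<^esub> \<one>\<^bsub>?Z\<^esub>"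
    unfolding G.int_eq_iff by (simp add: cong_def)
  also have "\<dots> = D mod int p"
    using p by (simp add: add_pow_int_ge nat)
  finally have "{w \<in> carrier ?Z. w \<otimes>\<^bsub>?Z\<^esub> w = [D] \<cdot>\<^bsub>?Z\<^esub> \<one>\<^bsub>?Z\<^esub>} =
      {w \<in> {0..<int p}. [w * w = D] (mod int p)}"
    by (simp add: carr Z.res_mult_eq cong_def)
  thus ?thesis using G.card_square_roots_int[of D] p by simp
qed

section \<open>Roots modulo prime powers and the sum over ideals\<close>

context quadratic_order
begin

text \<open>The norm of \<open>b + w\<close>.\<close>

definition "poly_value b = b * b + t * b - c"

definition "discriminant = t * t + 4 * c"

lemma root_set_altdef: "root_set m = {b \<in> {0..<int m}. int m dvd poly_value b}"
  by (simp add: root_set_def poly_value_def)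

lemma finite_root_set [simp]: "finite (root_set m)"
  by (rule finite_subset[of _ "{0..<int m}"]) (auto simp: root_set_altdef)

lemma card_root_set_le: "card (root_set m) \<le> m"
proof -
  have "root_set m \<subseteq> {0..<int m}" by (auto simp: root_set_altdef)
  from card_mono[OF _ this] show ?thesis by simp
qed

lemma poly_value_diff: "poly_value b - poly_value b' = (b - b') * (b + b' + t)"
  by (simp add: poly_value_def algebra_simps)

lemma poly_value_square: "(2 * b + t) * (2 * b + t) = 4 * poly_value b + discriminant"
  by (simp add: poly_value_def discriminant_def algebra_simps)

lemma poly_value_dvd_cong:
  assumes "[b = b'] (mod m)"
  shows "m dvd poly_value b \<longleftrightarrow> m dvd poly_value b'"
proof -
  have "m dvd b - b'" using assms by (simp add: cong_iff_dvd_diff)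
  hence "m dvd poly_value b - poly_value b'" by (simp add: poly_value_diff)
  thus ?thesis by (metis dvd_diff_right_iff dvd_diff_left_iff diff_diff_eq2 dvd_add_right_iff diff_add_cancel)
qed

lemma mod_in_root_set:
  assumes "m > 0" "int m dvd poly_value b"
  shows "b mod int m \<in> root_set m"
  using assms poly_value_dvd_cong[of "b mod int m" b "int m"] by (simp add: root_set_altdef cong_def)

lemma card_root_set_1: "card (root_set 1) = 1"
proof -
  have "root_set 1 = {0}" by (auto simp: root_set_altdef)
  thus ?thesis by simp
qed

lemma card_root_set_mult:
  assumes "m > 0" "n > 0" "coprime m n"
  shows "card (root_set (m * n)) = card (root_set m) * card (root_set n)"
proof -
  have cop: "coprime (int m) (int n)" using assms(3) by simp
  have "bij_betw (\<lambda>b. (b mod int m, b mod int n)) (root_set (m * n)) (root_set m \<times> root_set n)"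
    unfolding bij_betw_def
  proof
    show "inj_on (\<lambda>b. (b mod int m, b mod int n)) (root_set (m * n))"
    proof (rule inj_onI)
      fix b b' assume b: "b \<in> root_set (m * n)" "b' \<in> root_set (m * n)"
        and eq: "(b mod int m, b mod int n) = (b' mod int m, b' mod int n)"
      have "[b = b'] (mod int m * int n)"
        using eq cop by (intro coprime_cong_mult) (simp_all add: cong_def)
      thus "b = b'" using b by (simp add: root_set_altdef cong_def)
    qed
    show "(\<lambda>b. (b mod int m, b mod int n)) ` root_set (m * n) = root_set m \<times> root_set n"
    proof (intro equalityI subsetI)
      fix z assume "z \<in> (\<lambda>b. (b mod int m, b mod int n)) ` root_set (m * n)"
      then obtain b where b: "z = (b mod int m, b mod int n)" "int m * int n dvd poly_value b"
        by (auto simp: root_set_altdef)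
      thus "z \<in> root_set m \<times> root_set n"
        using assms by (auto intro!: mod_in_root_set elim: dvd_mult_left dvd_mult_right)
    next
      fix z assume "z \<in> root_set m \<times> root_set n"
      then obtain u v where z: "z = (u, v)" "u \<in> root_set m" "v \<in> root_set n" by auto
      obtain x where x: "[x = u] (mod int m)" "[x = v] (mod int n)"
        using binary_chinese_remainder_int[OF cop] by blast
      have "int m dvd poly_value x" "int n dvd poly_value x"
        using poly_value_dvd_cong[OF x(1)] poly_value_dvd_cong[OF x(2)] z by (simp_all add: root_set_altdef)
      hence "int m * int n dvd poly_value x" using cop by (rule semiring_gcd_class.divides_mult)
      hence "int (m * n) dvd poly_value x" by simp
      hence mem: "x mod int (m * n) \<in> root_set (m * n)" using assms by (intro mod_in_root_set) simp_all
      have "x mod int (m * n) mod int m = u" "x mod int (m * n) mod int n = v"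
        using x z by (simp_all add: mod_mod_cancel cong_def root_set_altdef)
      thus "z \<in> (\<lambda>b. (b mod int m, b mod int n)) ` root_set (m * n)"
        using z(1) mem by (intro image_eqI[of _ _ "x mod int (m * n)"]) simp_all
    qed
  qed
  from bij_betw_same_card[OF this] show ?thesis by (simp add: card_cartesian_product)
qed

text \<open>Hensel lifting: at a root the derivative \<open>2 b + t\<close> squares to the discriminant modulo \<open>p\<close>.\<close>

lemma card_root_set_prime_power_Suc:
  assumes p: "Factorial_Ring.prime p" and nd: "\<not> int p dvd discriminant" and k: "k > 0"
  shows "card (root_set (p ^ Suc k)) = card (root_set (p ^ k))"
proof -
  have pos: "int p > 0" "p ^ k > 0" "p ^ Suc k > 0" using prime_gt_0_nat[OF p] by simp_all
  have prime: "Factorial_Ring.prime (int p)" using p by simp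
  have deriv: "\<not> int p dvd 2 * b + t" if "int p dvd poly_value b" for b
  proof
    assume "int p dvd 2 * b + t"
    hence "int p dvd 4 * poly_value b + discriminant" by (simp flip: poly_value_square)
    thus False using that nd by (simp add: dvd_add_right_iff)
  qed
  have pk: "int p dvd int (p ^ k)" using k by (simp add: dvd_power)
  have "bij_betw (\<lambda>b. b mod int (p ^ k)) (root_set (p ^ Suc k)) (root_set (p ^ k))"
    unfolding bij_betw_def
  proof
    show "inj_on (\<lambda>b. b mod int (p ^ k)) (root_set (p ^ Suc k))"
    proof (rule inj_onI)
      fix b b' assume b: "b \<in> root_set (p ^ Suc k)" "b' \<in> root_set (p ^ Suc k)"
        and eq: "b mod int (p ^ k) = b' mod int (p ^ k)"
      have "int (p ^ k) dvd b' - b" using eq by (metis mod_eq_dvd_iff)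
      hence "int p dvd b' - b" using pk dvd_trans by blast
      moreover have "int p dvd poly_value b"
        using b by (auto simp: root_set_altdef elim: dvd_mult_left)
      \<comment> \<open>Modulo p this cofactor of b - b' is the derivative, hence a unit, so the
        whole power of p divides b - b'.\<close>
      moreover have "b + b' + t = (2 * b + t) + (b' - b)" by simp
      ultimately have "\<not> int p dvd b + b' + t" using deriv by (metis dvd_add_left_iff)
      hence "coprime (int p ^ Suc k) (b + b' + t)"
        using prime by (meson coprime_power_left_iff prime_imp_coprime)
      moreover have "int p ^ Suc k dvd (b - b') * (b + b' + t)"
        unfolding poly_value_diff[symmetric] using b by (auto simp: root_set_altdef)
      ultimately have "int p ^ Suc k dvd b - b'" by (simp only: coprime_dvd_mult_left_iff)
      hence "[b = b'] (mod int (p ^ Suc k))" by (simp add: cong_iff_dvd_diff)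
      moreover have "b \<in> {0..<int (p ^ Suc k)}" "b' \<in> {0..<int (p ^ Suc k)}"
        using b unfolding root_set_altdef by blast+
      ultimately show "b = b'" unfolding cong_def by (simp del: power_Suc)
    qed
    show "(\<lambda>b. b mod int (p ^ k)) ` root_set (p ^ Suc k) = root_set (p ^ k)"
    proof (intro equalityI subsetI)
      fix z assume "z \<in> (\<lambda>b. b mod int (p ^ k)) ` root_set (p ^ Suc k)"
      then obtain b where b: "z = b mod int (p ^ k)" "int (p ^ Suc k) dvd poly_value b"
        unfolding root_set_altdef by blast
      have "int (p ^ k) dvd poly_value b" using b(2) by (auto elim: dvd_mult_right)
      thus "z \<in> root_set (p ^ k)" unfolding b(1) by (intro mod_in_root_set pos)
    next
      fix b assume b: "b \<in> root_set (p ^ k)"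
      then obtain l where l: "poly_value b = int (p ^ k) * l"
        unfolding root_set_altdef by (auto elim: dvdE)
      have "int p dvd poly_value b" using pk l by simp
      hence "coprime (int p) (2 * b + t)" using deriv prime prime_imp_coprime by blast
      hence "coprime (2 * b + t) (int p)" by (simp add: coprime_commute)
      then obtain i where i: "[(2 * b + t) * i = 1] (mod int p)"
        using cong_solve_coprime_int by blast
      define j where "j = - (i * l)"
      have "[l + (2 * b + t) * j = l - ((2 * b + t) * i) * l] (mod int p)"
        by (simp add: j_def algebra_simps)
      also have "[l - ((2 * b + t) * i) * l = l - 1 * l] (mod int p)"
        by (intro cong_diff cong_mult i cong_refl)
      finally have "int p dvd l + (2 * b + t) * j" by (simp add: cong_0_iff)
      then obtain e where e: "l + (2 * b + t) * j = int p * e" by (elim dvdE)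
      \<comment> \<open>As k > 0, the quadratic term p^k p^k j^2 is a multiple of p^(k + 1).\<close>
      obtain k' where k': "k = Suc k'" using k by (cases k) auto
      define b' where "b' = b + int (p ^ k) * j"
      have "poly_value b' = int (p ^ k) * (l + (2 * b + t) * j) + int (p ^ k) * int (p ^ k) * j * j"
        using l by (simp add: b'_def poly_value_def algebra_simps)
      also have "\<dots> = int (p ^ Suc k) * (e + int (p ^ k') * j * j)"
        unfolding e k' by (simp add: algebra_simps)
      finally have "int (p ^ Suc k) dvd poly_value b'" by simp
      hence "b' mod int (p ^ Suc k) \<in> root_set (p ^ Suc k)" by (intro mod_in_root_set pos)
      moreover have "b' mod int (p ^ Suc k) mod int (p ^ k) = b"
      proof -
        have "b' mod int (p ^ Suc k) mod int (p ^ k) = b' mod int (p ^ k)"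
          by (intro mod_mod_cancel) simp
        also have "\<dots> = b mod int (p ^ k)" by (simp add: b'_def)
        also have "\<dots> = b" using b unfolding root_set_altdef by (intro mod_pos_pos_trivial) auto
        finally show ?thesis .
      qed
      ultimately show "b \<in> (\<lambda>b. b mod int (p ^ k)) ` root_set (p ^ Suc k)" by (metis image_eqI)
    qed
  qed
  from bij_betw_same_card[OF this] show ?thesis .
qed

lemma card_root_set_unramified:
  assumes "Factorial_Ring.prime p" "\<not> int p dvd discriminant" "k > 0"
  shows "card (root_set (p ^ k)) = card (root_set p)"
  using assms(3)
proof (induction k rule: nat_induct_non_zero)
  case (Suc k)
  thus ?case using card_root_set_prime_power_Suc[OF assms(1,2)] by simp
qed simp

text \<open>Completing the square: b -> 2 b + t matches roots with square roots of the discriminant,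
  with h as the inverse of 2 modulo p.\<close>

lemma card_root_set_odd_prime:
  assumes p: "Factorial_Ring.prime p" "p > 2"
  shows "int (card (root_set p)) = 1 + Legendre discriminant (int p)"
proof -
  have "coprime 2 (int p)"
    using p prime_odd_nat[of p] by simp
  then obtain h where h: "[2 * h = 1] (mod int p)" using cong_solve_coprime_int by blast
  have cop4: "coprime (int p) 4"
    using \<open>coprime 2 (int p)\<close> coprime_power_left_iff[of 2 2 "int p"] by (simp add: coprime_commute)
  have "bij_betw (\<lambda>b. (2 * b + t) mod int p) (root_set p)
      {w \<in> {0..<int p}. [w * w = discriminant] (mod int p)}"
  proof (rule bij_betwI[where g = "\<lambda>w. (h * (w - t)) mod int p"])
    have iff: "int p dvd poly_value b \<longleftrightarrow> [(2 * b + t) * (2 * b + t) = discriminant] (mod int p)" for b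
      unfolding poly_value_square cong_iff_dvd_diff using cop4
      by (simp add: coprime_dvd_mult_right_iff)
    have inv: "[2 * (h * (w - t)) + t = w] (mod int p)" for w
    proof -
      have "[(2 * h) * (w - t) + t = 1 * (w - t) + t] (mod int p)"
        by (intro cong_add cong_mult h cong_refl)
      thus ?thesis by (simp add: mult.assoc)
    qed
    have inv': "[h * ((2 * b + t) - t) = b] (mod int p)" for b
    proof -
      have "[(2 * h) * b = 1 * b] (mod int p)" by (intro cong_mult h cong_refl)
      thus ?thesis by (simp add: mult_ac)
    qed
    show "(\<lambda>b. (2 * b + t) mod int p) \<in> root_set p \<rightarrow> {w \<in> {0..<int p}. [w * w = discriminant] (mod int p)}"
      using p iff by (auto simp: root_set_altdef cong_def mod_simps)
    show "(\<lambda>w. (h * (w - t)) mod int p) \<in> {w \<in> {0..<int p}. [w * w = discriminant] (mod int p)} \<rightarrow> root_set p"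
    proof safe
      fix w assume w: "[w * w = discriminant] (mod int p)"
      have "[(2 * (h * (w - t)) + t) * (2 * (h * (w - t)) + t) = w * w] (mod int p)"
        by (intro cong_mult inv)
      hence "int p dvd poly_value (h * (w - t))" using w iff cong_trans by blast
      thus "(h * (w - t)) mod int p \<in> root_set p" using p by (intro mod_in_root_set) auto
    qed
    show "(h * ((2 * b + t) mod int p - t)) mod int p = b" if "b \<in> root_set p" for b
    proof -
      have "[h * ((2 * b + t) mod int p - t) = h * ((2 * b + t) - t)] (mod int p)"
        by (intro cong_mult cong_diff cong_refl) (simp add: cong_def)
      hence "[h * ((2 * b + t) mod int p - t) = b] (mod int p)" using inv' cong_trans by blast
      thus ?thesis using that by (simp add: cong_def root_set_altdef)
    qed
    show "(2 * ((h * (w - t)) mod int p) + t) mod int p = w"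
      if "w \<in> {w \<in> {0..<int p}. [w * w = discriminant] (mod int p)}" for w
    proof -
      have "[2 * ((h * (w - t)) mod int p) + t = 2 * (h * (w - t)) + t] (mod int p)"
        by (intro cong_add cong_mult cong_refl) (simp add: cong_def)
      hence "[2 * ((h * (w - t)) mod int p) + t = w] (mod int p)" using inv cong_trans by blast
      thus ?thesis using that by (simp add: cong_def)
    qed
  qed
  from bij_betw_same_card[OF this] show ?thesis using card_square_roots_mod[OF p] by simp
qed

text \<open>At a root modulo p^2, (2 b + t)^2 = 4 \<open>poly_value b\<close> +
  \<open>discriminant\<close> is divisible by p, hence by p^2; then so is the discriminant.\<close>

lemma root_set_ramified_empty:
  assumes "Factorial_Ring.prime p" "int p dvd discriminant" "\<not> int p ^ 2 dvd discriminant" "k \<ge> 2"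
  shows "root_set (p ^ k) = {}"
proof -
  have False if "b \<in> root_set (p ^ k)" for b
  proof -
    have "int p ^ 2 dvd int p ^ k" using assms(4) by (rule le_imp_power_dvd)
    hence p2: "int p ^ 2 dvd poly_value b" using that dvd_trans by (fastforce simp: root_set_altdef)
    hence "int p dvd poly_value b" by (auto simp: power2_eq_square elim: dvd_mult_left)
    hence "int p dvd (2 * b + t) * (2 * b + t)"
      unfolding poly_value_square using assms(2) by simp
    hence "int p dvd 2 * b + t" using assms(1) by (simp add: prime_dvd_mult_iff)
    hence "int p ^ 2 dvd (2 * b + t) * (2 * b + t)" by (simp add: power2_eq_square mult_dvd_mono)
    hence "int p ^ 2 dvd discriminant"
      unfolding poly_value_square using p2 by (simp add: dvd_add_right_iff)
    thus False using assms(3) by simp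
  qed
  thus ?thesis by blast
qed

text \<open>The bound of m for the number of roots costs one unit of convergence, so Re s > 1
  becomes Re s > 2.\<close>

lemma summable_multiplicative_card_root_set:
  assumes "Re s > 2"
  shows "summable_multiplicative (\<lambda>m. of_nat (card (root_set m)) * of_nat m powr (- s))"
proof
  have bound: "norm (of_nat (card (root_set m)) * of_nat m powr (- s) :: complex) \<le>
      norm (of_nat m powr (- (s - 1)) :: complex)" if "m \<in> {1..}" for m
  proof -
    have "norm (of_nat (card (root_set m)) * of_nat m powr (- s) :: complex)
        \<le> real m * norm (of_nat m powr (- s) :: complex)"
      using card_root_set_le[of m] by (simp add: norm_mult mult_right_mono)
    also have "\<dots> = norm (of_nat m powr (- (s - 1)) :: complex)"
      using that by (simp add: powr_diff powr_minus divide_inverse norm_mult)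
    finally show ?thesis .
  qed
  have "(\<lambda>m::nat. norm (of_nat m powr (- (s - 1)) :: complex)) summable_on {1..}"
    by (rule abs_summable_on_nat_powr) (use assms in simp)
  thus "(\<lambda>m. norm (of_nat (card (root_set m)) * of_nat m powr (- s) :: complex)) summable_on {1..}"
    by (rule summable_on_comparison_test) (use bound in auto)
qed (simp_all only: card_root_set_1 card_root_set_mult of_nat_mult, simp_all add: powr_times_real)

text \<open>
  Summing over the normal forms \<open>(a, m, b)\<close> gives \<open>\<zeta>\<^sub>K(s) = \<zeta>(2 s) \<Sum>\<^sub>m \<rho>(m) m\<^bsup>-s\<^esup>\<close>, where \<open>\<rho>(m)\<close> is the number of
  roots of \<open>b\<^sup>2 + t b - c\<close> modulo \<open>m\<close>; unique factorization of ideals is not needed.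
\<close>

definition dedekind_euler :: "complex \<Rightarrow> nat \<Rightarrow> complex" where
  "dedekind_euler s p = (if Factorial_Ring.prime p
    then inverse (1 - of_nat p powr (- (2 * s))) *
      (\<Sum>\<^sub>\<infinity>k. of_nat (card (root_set (p ^ k))) * of_nat (p ^ k) powr (- s)) else 1)"

text \<open>The index of a lattice is a^2 m, so its term is a^(-2 s) m^(-s) regardless of b.
  Absolute summability over all triples separates the sum over a from the sum over (m, b).\<close>

lemma infsum_ideals:
  assumes s: "Re s > 2"
  shows "(\<Sum>\<^sub>\<infinity>I\<in>{I. ideal I order_ring \<and> I \<noteq> {0}}. of_nat (card (carrier (order_ring Quot I))) powr (- s)) =
    riemann_zeta (2 * s) * (\<Sum>\<^sub>\<infinity>m\<in>{1..}. of_nat (card (root_set m)) * of_nat m powr (- s))"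
proof -
  let ?U = "SIGMA m:{1::nat..}. root_set m"
  define A where "A a = (of_nat a powr (- (2 * s)) :: complex)" for a :: nat
  define B where "B = (\<lambda>(m, b :: int). of_nat m powr (- s) :: complex)"
  interpret f: summable_multiplicative "\<lambda>m. of_nat (card (root_set m)) * of_nat m powr (- s)"
    by (rule summable_multiplicative_card_root_set[OF s])
  have sumA: "(\<lambda>a. norm (A a)) summable_on {1..}"
    unfolding A_def by (rule abs_summable_on_nat_powr) (use s in simp)
  have fib: "(\<Sum>\<^sub>\<infinity>b\<in>root_set m. norm (B (m, b))) = norm (of_nat (card (root_set m)) * of_nat m powr (- s) :: complex)" for m
    by (simp add: B_def norm_mult)
  have sumB: "(\<lambda>u. norm (B u)) summable_on ?U"
    using f.abs_summable by (subst Infinite_Sum.abs_summable_on_Sigma_iff) (simp_all add: fib)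
  have fibA: "(\<lambda>u. norm (A a * B u)) summable_on ?U" for a
    using sumB by (simp add: norm_mult summable_on_cmult_right)
  have total: "(\<lambda>a. norm (\<Sum>\<^sub>\<infinity>u\<in>?U. norm (A a * B u))) summable_on {1..}"
    using sumA by (simp add: norm_mult infsum_cmult_right' summable_on_cmult_left abs_mult)
  have "(\<lambda>z. norm ((\<lambda>(a, u). A a * B u) z)) summable_on ({1..} \<times> ?U)"
    by (subst Infinite_Sum.abs_summable_on_Sigma_iff) (use fibA total in simp)
  hence sumAB: "(\<lambda>(a, u). A a * B u) summable_on ({1..} \<times> ?U)"
    by (rule abs_summable_summable)
  have "(\<Sum>\<^sub>\<infinity>I\<in>{I. ideal I order_ring \<and> I \<noteq> {0}}. of_nat (card (carrier (order_ring Quot I))) powr (- s)) =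
      (\<Sum>\<^sub>\<infinity>(a, m, b)\<in>ideal_index. of_nat (card (carrier (order_ring Quot lattice (int a) (int m) b))) powr (- s) :: complex)"
    using infsum_reindex_bij_betw[OF bij_betw_ideals,
        of "\<lambda>I. of_nat (card (carrier (order_ring Quot I))) powr (- s) :: complex"]
    by (simp add: case_prod_unfold)
  also have "\<dots> = (\<Sum>\<^sub>\<infinity>(a, u)\<in>{1..} \<times> ?U. A a * B u)"
  proof -
    have "of_nat (card (carrier (order_ring Quot lattice (int a) (int m) b))) powr (- s) = A a * B (m, b)"
      if "a > 0" "m > 0" "b \<in> root_set m" for a m b
    proof -
      have "card (carrier (order_ring Quot lattice (int a) (int m) b)) = nat (int (a * a * m))"
        using card_quotient_lattice[of "int a" "int m" b] that by (simp add: root_set_def)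
      hence "of_nat (card (carrier (order_ring Quot lattice (int a) (int m) b))) powr (- s) =
          (of_nat (a * (a * m)) powr (- s) :: complex)" by (simp add: mult.assoc)
      also have "\<dots> = of_nat a powr (- s) * of_nat a powr (- s) * of_nat m powr (- s)"
        by (simp add: powr_times_real)
      also have "of_nat a powr (- s) * of_nat a powr (- s) = A a"
        unfolding A_def powr_add[symmetric] by simp
      finally show ?thesis by (simp add: B_def)
    qed
    thus ?thesis unfolding ideal_index_def
      by (intro infsum_cong) (auto simp: Suc_le_eq)
  qed
  also have "\<dots> = (\<Sum>\<^sub>\<infinity>a\<in>{1..}. \<Sum>\<^sub>\<infinity>u\<in>?U. A a * B u)"
    using infsum_Sigma_banach[OF sumAB] by simp
  also have "\<dots> = (\<Sum>\<^sub>\<infinity>a\<in>{1..}. A a) * (\<Sum>\<^sub>\<infinity>u\<in>?U. B u)"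
    by (simp add: infsum_cmult_right' infsum_cmult_left')
  also have "(\<Sum>\<^sub>\<infinity>u\<in>?U. B u) = (\<Sum>\<^sub>\<infinity>m\<in>{1..}. \<Sum>\<^sub>\<infinity>b\<in>root_set m. B (m, b))"
    by (rule infsum_Sigma_banach[symmetric], rule abs_summable_summable[OF sumB])
  also have "\<dots> = (\<Sum>\<^sub>\<infinity>m\<in>{1..}. of_nat (card (root_set m)) * of_nat m powr (- s))"
    by (simp add: B_def)
  finally show ?thesis by (simp add: A_def riemann_zeta_def)
qed

lemma has_prod_dedekind_euler:
  assumes s: "Re s > 2"
  shows "dedekind_euler s has_prod (\<Sum>\<^sub>\<infinity>I\<in>{I. ideal I order_ring \<and> I \<noteq> {0}}.
    of_nat (card (carrier (order_ring Quot I))) powr (- s))"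
proof -
  interpret f: summable_multiplicative "\<lambda>m. of_nat (card (root_set m)) * of_nat m powr (- s)"
    by (rule summable_multiplicative_card_root_set[OF s])
  have "Re (2 * s) > 1" using s by simp
  from has_prod_mult[OF riemann_zeta_euler_product[OF this] f.has_prod_euler_factor]
  show ?thesis unfolding infsum_ideals[OF s]
    by (rule has_prod_subst[rotated])
      (auto simp: dedekind_euler_def euler_factor_def fun_eq_iff)
qed

text \<open>The term for k = 0 has to be split off: the root count modulo 1 is 1, whereas the counts
  modulo p^k for k > 0 follow their own constant.\<close>

lemma infsum_prime_powers:
  fixes x :: complex
  assumes x: "norm x < 1" and "\<And>k. k > 0 \<Longrightarrow> g k = a * x ^ k" and "g 0 = 1"
  shows "(\<Sum>\<^sub>\<infinity>k. g k) = 1 + a * x * inverse (1 - x)"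
proof (rule infsumI)
  have "((\<lambda>k. a * x * x ^ k) has_sum a * x * inverse (1 - x)) UNIV"
    by (intro has_sum_cmult_right has_sum_geometric_complex x)
  hence "((g \<circ> Suc) has_sum a * x * inverse (1 - x)) UNIV"
    using assms(2) by (simp add: o_def mult_ac)
  hence "(g has_sum a * x * inverse (1 - x)) (range Suc)"
    by (simp add: has_sum_reindex)
  hence "(g has_sum (g 0 + a * x * inverse (1 - x))) (insert 0 (range Suc))"
    by (intro has_sum_insert) auto
  moreover have "insert 0 (range Suc) = (UNIV :: nat set)"
    using not0_implies_Suc by auto
  ultimately show "(g has_sum (1 + a * x * inverse (1 - x))) UNIV" using assms(3) by simp
qed

text \<open>With x = p^(-s) the sum over k is (1 + x) / (1 - x) for e = 1 and 1 for e = -1; the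
  factor 1 / (1 - x^2) of zeta(2 s) turns these into the split and the inert Euler factor.\<close>

lemma dedekind_euler_unramified:
  assumes s: "Re s > 2" and p: "Factorial_Ring.prime p" "\<not> int p dvd discriminant"
    and card: "int (card (root_set p)) = 1 + e" and e: "e = 1 \<or> e = - 1"
  shows "dedekind_euler s p = inverse ((1 - of_nat p powr (- s)) * (1 - of_int e * of_nat p powr (- s)))"
proof -
  define x where "x = (of_nat p powr (- s) :: complex)"
  have x: "norm x < 1" unfolding x_def using s prime_gt_1_nat[OF p(1)] by (intro norm_nat_powr_less_1) auto
  have pk: "of_nat (p ^ k) powr (- s) = x ^ k" for k
    unfolding x_def using prime_gt_0_nat[OF p(1)] by (rule of_nat_power_powr)
  have x2: "of_nat p powr (- (2 * s)) = x * x"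
    unfolding x_def powr_add[symmetric] by simp
  have card': "of_nat (card (root_set p)) = (1 + of_int e :: complex)"
    using card by (metis of_int_1 of_int_add of_int_of_nat_eq)
  have sum: "(\<Sum>\<^sub>\<infinity>k. of_nat (card (root_set (p ^ k))) * of_nat (p ^ k) powr (- s)) =
      1 + (1 + of_int e) * x * inverse (1 - x)"
  proof (rule infsum_prime_powers[OF x])
    show "of_nat (card (root_set (p ^ k))) * of_nat (p ^ k) powr (- s) = (1 + of_int e) * x ^ k" if "k > 0" for k
      unfolding pk card_root_set_unramified[OF p that] card' ..
  qed (use card_root_set_1 in simp)
  have ne: "1 - x \<noteq> 0" "1 + x \<noteq> 0"
    using x by (auto simp: add_eq_0_iff)
  have "1 - x * x = (1 - x) * (1 + x)" by (simp add: algebra_simps)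
  hence inv: "inverse (1 - x * x) = inverse (1 - x) * inverse (1 + x)" by simp
  from e show ?thesis
  proof
    assume e: "e = 1"
    have "1 + (1 + of_int 1) * x * inverse (1 - x) = (1 + x) * inverse (1 - x)"
      using ne by (simp add: field_simps)
    thus ?thesis unfolding dedekind_euler_def if_P[OF p(1)] sum x2 x_def[symmetric] inv e
      using ne by simp
  next
    assume e: "e = - 1"
    show ?thesis unfolding dedekind_euler_def if_P[OF p(1)] sum x2 x_def[symmetric] inv e
      by simp
  qed
qed

text \<open>The sum stops after 1 + x, which cancels against 1 / (1 - x^2).\<close>

lemma dedekind_euler_ramified:
  assumes s: "Re s > 2" and p: "Factorial_Ring.prime p"
    and card: "card (root_set p) = 1" "\<And>k. k \<ge> 2 \<Longrightarrow> root_set (p ^ k) = {}"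
  shows "dedekind_euler s p = inverse (1 - of_nat p powr (- s))"
proof -
  define x where "x = (of_nat p powr (- s) :: complex)"
  have x: "norm x < 1" unfolding x_def using s prime_gt_1_nat[OF p] by (intro norm_nat_powr_less_1) auto
  have x2: "of_nat p powr (- (2 * s)) = x * x"
    unfolding x_def powr_add[symmetric] by simp
  have "(\<Sum>\<^sub>\<infinity>k. of_nat (card (root_set (p ^ k))) * of_nat (p ^ k) powr (- s)) =
      (\<Sum>\<^sub>\<infinity>k\<in>{0, 1}. of_nat (card (root_set (p ^ k))) * of_nat (p ^ k) powr (- s) :: complex)"
  proof (rule infsum_cong_neutral)
    fix k assume "k \<in> UNIV - {0, 1 :: nat}"
    hence "k \<ge> 2" by auto
    thus "of_nat (card (root_set (p ^ k))) * of_nat (p ^ k) powr (- s) = (0 :: complex)"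
      by (simp add: card(2))
  qed auto
  also have "\<dots> = 1 + x" using card(1) card_root_set_1 by (simp add: x_def)
  finally have sum: "(\<Sum>\<^sub>\<infinity>k. of_nat (card (root_set (p ^ k))) * of_nat (p ^ k) powr (- s)) = 1 + x" .
  have ne: "1 - x \<noteq> 0" "1 + x \<noteq> 0"
    using x by (auto simp: add_eq_0_iff)
  have eq: "1 - x * x = (1 - x) * (1 + x)" by (simp add: algebra_simps)
  show ?thesis unfolding dedekind_euler_def if_P[OF p] sum x2 x_def[symmetric] eq
    using ne by (simp add: mult.assoc)
qed

lemma dedekind_euler_odd_prime:
  assumes s: "Re s > 2" and p: "Factorial_Ring.prime p" "p > 2" and sq: "\<not> int p ^ 2 dvd discriminant"
  shows "dedekind_euler s p = inverse ((1 - of_nat p powr (- s)) *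
    (1 - of_int (Legendre discriminant (int p)) * of_nat p powr (- s)))"
proof (cases "int p dvd discriminant")
  case True
  hence L: "Legendre discriminant (int p) = 0" by (simp add: Legendre_def cong_0_iff)
  hence "card (root_set p) = 1" using card_root_set_odd_prime[OF p] by simp
  thus ?thesis using dedekind_euler_ramified[OF s p(1)] root_set_ramified_empty[OF p(1) True sq] L by simp
next
  case False
  thus ?thesis
    by (intro dedekind_euler_unramified s p card_root_set_odd_prime) (auto simp: Legendre_def cong_0_iff)
qed

end

text \<open>The Kronecker symbol of the discriminant of \<open>\<rat>(\<surd>d)\<close>, for \<open>d = 2\<close> and \<open>d = 5\<close> only.\<close>

definition splitting_character :: "int \<Rightarrow> nat \<Rightarrow> int" where
  "splitting_character d p = (if p = 2 then (if d = 5 then - 1 else 0) else Legendre d (int p))"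

lemma not_square_dvd_disc:
  assumes "Factorial_Ring.prime p" "p > 2"
  shows "\<not> int p ^ 2 dvd 8" "\<not> int p ^ 2 dvd 5"
proof -
  have "int p * int p \<ge> 3 * 3" using assms by (intro mult_mono) auto
  thus "\<not> int p ^ 2 dvd 8" "\<not> int p ^ 2 dvd 5" by (auto simp: power2_eq_square dest: zdvd_imp_le)
qed

text \<open>Odd primes follow from the discriminants 8 and 5; the prime 2 is settled directly,
  ramified for d = 2 and inert for d = 5.\<close>

theorem dedekind_zeta_euler_product:
  assumes s: "Re s > 2" and d: "d = 2 \<or> d = 5"
  shows "(\<lambda>p. if Factorial_Ring.prime p then inverse ((1 - of_nat p powr (- s)) *
      (1 - of_int (splitting_character (int d) p) * of_nat p powr (- s))) else 1)
    has_prod dedekind_zeta (quadratic_field d) s"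
  using d
proof
  assume d: "d = 2"
  have disc: "sqrt_2.discriminant = 8" by (simp add: sqrt_2.discriminant_def)
  have two: "sqrt_2.dedekind_euler s 2 = inverse (1 - of_nat 2 powr (- s))"
  proof (rule sqrt_2.dedekind_euler_ramified[OF s])
    have "{0..<int 2} = {0, 1}" by auto
    hence "sqrt_2.root_set 2 = {0}" by (auto simp: sqrt_2.root_set_def)
    thus "card (sqrt_2.root_set 2) = 1" by simp
    show "sqrt_2.root_set (2 ^ k) = {}" if "k \<ge> 2" for k
    proof -
      have False if b: "b \<in> sqrt_2.root_set (2 ^ k)" for b
      proof -
        \<comment> \<open>b^2 - 2 has no root modulo 4: b would be even, leaving b^2 - 2 congruent
          to 2.\<close>
        have "(2::int) ^ 2 dvd 2 ^ k" using \<open>k \<ge> 2\<close> by (rule le_imp_power_dvd)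
        hence 4: "4 dvd b * b - 2" using b dvd_trans by (fastforce simp: sqrt_2.root_set_def)
        hence "even (b * b - 2)" by (rule dvd_trans[rotated]) simp
        hence "even b" by simp
        then obtain e where "b = 2 * e" by (elim evenE)
        thus False using 4 by simp presburger
      qed
      thus ?thesis by blast
    qed
  qed simp
  have zeta: "dedekind_zeta (quadratic_field 2) s = (\<Sum>\<^sub>\<infinity>I\<in>{I. ideal I sqrt_2.order_ring \<and> I \<noteq> {0}}.
      of_nat (card (carrier (sqrt_2.order_ring Quot I))) powr (- s))"
    by (simp add: dedekind_zeta_def ring_of_integers_sqrt_2)
  have "sqrt_2.dedekind_euler s p = (if Factorial_Ring.prime p then inverse ((1 - of_nat p powr (- s)) *
      (1 - of_int (splitting_character 2 p) * of_nat p powr (- s))) else 1)" for p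
  proof (cases "Factorial_Ring.prime p \<and> p \<noteq> 2")
    case True
    hence p: "Factorial_Ring.prime p" "p > 2" using prime_ge_2_nat[of p] by auto
    show ?thesis
      using sqrt_2.dedekind_euler_odd_prime[OF s p] not_square_dvd_disc[OF p] p
        Legendre_4_mult[OF p, of 2] by (simp add: disc splitting_character_def)
  next
    case False
    thus ?thesis
    proof (cases "p = 2")
      case True
      thus ?thesis using two by (simp add: splitting_character_def)
    qed (simp add: sqrt_2.dedekind_euler_def)
  qed
  hence "sqrt_2.dedekind_euler s = (\<lambda>p. if Factorial_Ring.prime p then inverse ((1 - of_nat p powr (- s)) *
      (1 - of_int (splitting_character (int d) p) * of_nat p powr (- s))) else 1)"
    unfolding d by (intro ext) simp
  thus ?thesis using sqrt_2.has_prod_dedekind_euler[OF s] unfolding d zeta by simp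
next
  assume d: "d = 5"
  have disc: "golden_ratio.discriminant = 5" by (simp add: golden_ratio.discriminant_def)
  have two: "golden_ratio.dedekind_euler s 2 = inverse ((1 - of_nat 2 powr (- s)) * (1 - of_int (- 1) * of_nat 2 powr (- s)))"
  proof (rule golden_ratio.dedekind_euler_unramified[OF s])
    have "{0..<int 2} = {0, 1}" by auto
    \<comment> \<open>b^2 + b - 1 is always odd.\<close>
    hence "golden_ratio.root_set 2 = {}" by (auto simp: golden_ratio.root_set_def)
    thus "int (card (golden_ratio.root_set 2)) = 1 + - 1" by simp
  qed (simp_all add: disc)
  have zeta: "dedekind_zeta (quadratic_field 5) s = (\<Sum>\<^sub>\<infinity>I\<in>{I. ideal I golden_ratio.order_ring \<and> I \<noteq> {0}}.
      of_nat (card (carrier (golden_ratio.order_ring Quot I))) powr (- s))"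
    by (simp add: dedekind_zeta_def ring_of_integers_sqrt_5)
  have "golden_ratio.dedekind_euler s p = (if Factorial_Ring.prime p then inverse ((1 - of_nat p powr (- s)) *
      (1 - of_int (splitting_character 5 p) * of_nat p powr (- s))) else 1)" for p
  proof (cases "Factorial_Ring.prime p \<and> p \<noteq> 2")
    case True
    hence p: "Factorial_Ring.prime p" "p > 2" using prime_ge_2_nat[of p] by auto
    show ?thesis
      using golden_ratio.dedekind_euler_odd_prime[OF s p] not_square_dvd_disc[OF p] p
      by (simp add: disc splitting_character_def)
  next
    case False
    thus ?thesis
    proof (cases "p = 2")
      case True
      thus ?thesis using two by (simp add: splitting_character_def)
    qed (simp add: golden_ratio.dedekind_euler_def)
  qed
  hence "golden_ratio.dedekind_euler s = (\<lambda>p. if Factorial_Ring.prime p then inverse ((1 - of_nat p powr (- s)) *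
      (1 - of_int (splitting_character (int d) p) * of_nat p powr (- s))) else 1)"
    unfolding d by (intro ext) simp
  thus ?thesis using golden_ratio.has_prod_dedekind_euler[OF s] unfolding d zeta by simp
qed

section \<open>Local factors of the Hasse--Weil zeta functions\<close>

text \<open>Existence makes the defining property of the chosen field available.\<close>

lemma galois_field_finite_field:
  assumes "Factorial_Ring.prime p" "n > 0"
  shows "galois_field (finite_field (p ^ n)) p n"
proof -
  have *: "field (finite_field (p ^ n)) \<and> finite (carrier (finite_field (p ^ n))) \<and>
      card (carrier (finite_field (p ^ n))) = p ^ n"
    unfolding finite_field_def by (rule someI_ex) (rule exists_finite_field[OF assms])
  interpret field "finite_field (p ^ n)" using * by blast
  show ?thesis by unfold_locales (use assms * in auto)
qed

lemma card_points_finite_field: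
  assumes p: "Factorial_Ring.prime p" and n: "n > 0"
  shows "int (card (points f0 (finite_field (p ^ n)))) = (if p = 2 then (int p ^ n) ^ 2 + 1
      else (int p ^ n) ^ 2 + 3 * int p ^ n + 2 + Legendre 2 p ^ n * int p ^ n)"
    and "int (card (points f1 (finite_field (p ^ n)))) = (if p = 2
      then (int p ^ n) ^ 2 - int p ^ n + 2 + (- 1) ^ n * int p ^ n
      else (int p ^ n) ^ 2 + 3 + 2 * int p ^ n + 2 * Legendre 5 p ^ n * int p ^ n)"
    and "int (card (points f2 (finite_field (p ^ n)))) =
      (if p = 2 then (int p ^ n) ^ 2 + 1 else (int p ^ n) ^ 2 + 2)"
proof -
  interpret G: galois_field "finite_field (p ^ n)" p n
    by (rule galois_field_finite_field[OF assms])
  have q: "int G.q = int p ^ n" by (simp add: G.q_def)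
  show "int (card (points f0 (finite_field (p ^ n)))) = (if p = 2 then (int p ^ n) ^ 2 + 1
      else (int p ^ n) ^ 2 + 3 * int p ^ n + 2 + Legendre 2 p ^ n * int p ^ n)"
    using G.card_points_f0 unfolding q .
  show "int (card (points f1 (finite_field (p ^ n)))) = (if p = 2
      then (int p ^ n) ^ 2 - int p ^ n + 2 + (- 1) ^ n * int p ^ n
      else (int p ^ n) ^ 2 + 3 + 2 * int p ^ n + 2 * Legendre 5 p ^ n * int p ^ n)"
    using G.card_points_f1 unfolding q .
  show "int (card (points f2 (finite_field (p ^ n)))) =
      (if p = 2 then (int p ^ n) ^ 2 + 1 else (int p ^ n) ^ 2 + 2)"
    using G.card_points_f2 unfolding q .
qed

text \<open>The bound p^2 on the bases of the powers in the count makes each a p^(-s) smaller than 1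
  in norm, so every logarithmic series converges.\<close>

lemma hasse_weil_factor_eq:
  assumes s: "Re s > 3" and p: "Factorial_Ring.prime p"
    and card: "\<And>n. of_nat (card (points f (finite_field (p ^ Suc n)))) =
      (\<Sum>(k, a)\<leftarrow>L. of_int k * a ^ Suc n :: complex)"
    and norm: "\<forall>(k, a)\<in>set L. norm a \<le> real p ^ 2"
  shows "summable (hasse_weil_term f s p)"
    and "hasse_weil_factor f s p = (\<Prod>(k, a)\<leftarrow>L. (1 - a * of_nat p powr (- s)) powi (- k))"
proof -
  have p1: "real p > 1" using prime_gt_1_nat[OF p] by simp
  have small: "norm (a * of_nat p powr (- s)) < 1" if "(k, a) \<in> set L" for k a
  proof -
    have "norm (a * of_nat p powr (- s)) \<le> real p ^ 2 * real p powr (- Re s)"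
      using bspec[OF norm that] p1 by (simp add: norm_mult norm_powr_real_powr mult_right_mono)
    also have "\<dots> = real p powr (2 - Re s)"
      using p1 by (simp add: powr_diff powr_minus divide_inverse powr_numeral)
    also have "\<dots> < 1" using p1 s by (simp add: powr_less_one)
    finally show ?thesis .
  qed
  obtain S where S: "(\<lambda>n. of_nat (card (points f (finite_field (p ^ Suc n)))) / of_nat (Suc n) *
      (of_nat p powr (- s)) ^ Suc n) sums S"
    "exp S = (\<Prod>(k, a)\<leftarrow>L. (1 - a * of_nat p powr (- s)) powi (- k))"
  proof (rule exp_power_sum_series[OF card, where x = "of_nat p powr (- s)"])
    show "norm (a * of_nat p powr (- s)) < 1" if "(k, a) \<in> set L" for k a
      using that by (rule small)
  qed (rule that)
  have sums: "hasse_weil_term f s p sums S" using S(1) unfolding hasse_weil_term_def .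
  thus "summable (hasse_weil_term f s p)" by (rule sums_summable)
  show "hasse_weil_factor f s p = (\<Prod>(k, a)\<leftarrow>L. (1 - a * of_nat p powr (- s)) powi (- k))"
    using p by (simp add: hasse_weil_factor_def S(2) sums_unique[OF sums, symmetric])
qed

context
  fixes s :: complex and p :: nat
  assumes s: "Re s > 3" and p: "Factorial_Ring.prime p"
begin

lemma norm_Legendre_le: "norm (of_int (Legendre a (int p)) :: complex) \<le> 1"
  by (simp add: Legendre_def)

lemma prime_le_square: "real p \<le> real p ^ 2" "1 \<le> real p ^ 2"
  using prime_gt_1_nat[OF p] self_le_power[of "real p" 2] one_le_power[of "real p" 2] by simp_all

text \<open>Rewrites the entries 4 and -2 of the lists below into the shape q^2 and (-1)^n q of the
  counts for q = 2^n.\<close>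

lemma power_of_4_and_minus_2:
  "(4 :: complex) ^ n = 2 ^ n * 2 ^ n" "(- 2 :: complex) ^ n = (- 1) ^ n * 2 ^ n"
  by (simp_all flip: power_mult_distrib)

lemma card_points_complex:
  "of_nat (card (points f (finite_field (p ^ Suc n)))) =
    (of_int (int (card (points f (finite_field (p ^ Suc n))))) :: complex)"
  by simp

lemma local_factor_f0:
  shows "summable (hasse_weil_term f0 s p)"
    and "hasse_weil_factor f0 s p = (if p = 2
      then inverse (1 - 4 * of_nat p powr (- s)) * inverse (1 - of_nat p powr (- s))
      else inverse (1 - of_nat p ^ 2 * of_nat p powr (- s)) * inverse (1 - of_nat p * of_nat p powr (- s)) ^ 3 *
        inverse (1 - of_nat p powr (- s)) ^ 2 *
        inverse (1 - of_int (Legendre 2 p) * of_nat p * of_nat p powr (- s)))"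
proof -
  \<comment> \<open>A pair (k, a) stands for the term k a^n of the count over p^n elements; at p = 2
    the count q^2 + 1 is 4^n + 1.\<close>
  define L where "L = (if p = 2 then [(1, 4), (1, 1)] else
    [(1, of_nat p ^ 2), (3, of_nat p), (2, 1), (1, of_int (Legendre 2 p) * of_nat p)] :: (int \<times> complex) list)"
  have card: "of_nat (card (points f0 (finite_field (p ^ Suc n)))) =
      (\<Sum>(k, a)\<leftarrow>L. of_int k * a ^ Suc n)" for n
    unfolding card_points_complex card_points_finite_field(1)[OF p zero_less_Suc]
    by (simp add: L_def power_mult_distrib power2_eq_square mult_ac power_of_4_and_minus_2)
  have norm: "\<forall>(k, a)\<in>set L. norm a \<le> real p ^ 2"
    using prime_le_square mult_mono[OF norm_Legendre_le[of 2] prime_le_square(1)]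
    by (auto simp: L_def norm_mult norm_power split: if_splits)
  note * = hasse_weil_factor_eq[OF s p card norm]
  show "summable (hasse_weil_term f0 s p)" by (rule *(1))
  show "hasse_weil_factor f0 s p = (if p = 2
      then inverse (1 - 4 * of_nat p powr (- s)) * inverse (1 - of_nat p powr (- s))
      else inverse (1 - of_nat p ^ 2 * of_nat p powr (- s)) * inverse (1 - of_nat p * of_nat p powr (- s)) ^ 3 *
        inverse (1 - of_nat p powr (- s)) ^ 2 *
        inverse (1 - of_int (Legendre 2 p) * of_nat p * of_nat p powr (- s)))"
    unfolding *(2) by (simp add: L_def power_int_def mult.assoc)
qed

lemma local_factor_f1:
  shows "summable (hasse_weil_term f1 s p)"
    and "hasse_weil_factor f1 s p = (if p = 2
      then inverse (1 - 4 * of_nat p powr (- s)) * (1 - 2 * of_nat p powr (- s)) *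
        inverse (1 - of_nat p powr (- s)) ^ 2 * inverse (1 + 2 * of_nat p powr (- s))
      else inverse (1 - of_nat p ^ 2 * of_nat p powr (- s)) * inverse (1 - of_nat p powr (- s)) ^ 3 *
        inverse (1 - of_nat p * of_nat p powr (- s)) ^ 2 *
        inverse (1 - of_int (Legendre 5 p) * of_nat p * of_nat p powr (- s)) ^ 2)"
proof -
  \<comment> \<open>At p = 2 the count is 4^n - 2^n + 2 + (-2)^n; the coefficient -1 puts its factor
    into the numerator.\<close>
  define L where "L = (if p = 2 then [(1, 4), (- 1, 2), (2, 1), (1, - 2)] else
    [(1, of_nat p ^ 2), (3, 1), (2, of_nat p), (2, of_int (Legendre 5 p) * of_nat p)] :: (int \<times> complex) list)"
  have card: "of_nat (card (points f1 (finite_field (p ^ Suc n)))) =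
      (\<Sum>(k, a)\<leftarrow>L. of_int k * a ^ Suc n)" for n
    unfolding card_points_complex card_points_finite_field(2)[OF p zero_less_Suc]
    by (simp add: L_def power_mult_distrib power2_eq_square mult_ac power_of_4_and_minus_2)
  have norm: "\<forall>(k, a)\<in>set L. norm a \<le> real p ^ 2"
    using prime_le_square mult_mono[OF norm_Legendre_le[of 5] prime_le_square(1)]
    by (auto simp: L_def norm_mult norm_power split: if_splits)
  note * = hasse_weil_factor_eq[OF s p card norm]
  show "summable (hasse_weil_term f1 s p)" by (rule *(1))
  show "hasse_weil_factor f1 s p = (if p = 2
      then inverse (1 - 4 * of_nat p powr (- s)) * (1 - 2 * of_nat p powr (- s)) *
        inverse (1 - of_nat p powr (- s)) ^ 2 * inverse (1 + 2 * of_nat p powr (- s))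
      else inverse (1 - of_nat p ^ 2 * of_nat p powr (- s)) * inverse (1 - of_nat p powr (- s)) ^ 3 *
        inverse (1 - of_nat p * of_nat p powr (- s)) ^ 2 *
        inverse (1 - of_int (Legendre 5 p) * of_nat p * of_nat p powr (- s)) ^ 2)"
    unfolding *(2) by (simp add: L_def power_int_def mult.assoc)
qed

lemma local_factor_f2:
  shows "summable (hasse_weil_term f2 s p)"
    and "hasse_weil_factor f2 s p = (if p = 2
      then inverse (1 - 4 * of_nat p powr (- s)) * inverse (1 - of_nat p powr (- s))
      else inverse (1 - of_nat p ^ 2 * of_nat p powr (- s)) * inverse (1 - of_nat p powr (- s)) ^ 2)"
proof -
  define L where "L = (if p = 2 then [(1, 4), (1, 1)] else [(1, of_nat p ^ 2), (2, 1)] :: (int \<times> complex) list)"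
  have card: "of_nat (card (points f2 (finite_field (p ^ Suc n)))) =
      (\<Sum>(k, a)\<leftarrow>L. of_int k * a ^ Suc n)" for n
    unfolding card_points_complex card_points_finite_field(3)[OF p zero_less_Suc]
    by (simp add: L_def power_mult_distrib power2_eq_square mult_ac power_of_4_and_minus_2)
  have norm: "\<forall>(k, a)\<in>set L. norm a \<le> real p ^ 2"
    using prime_le_square by (auto simp: L_def norm_power split: if_splits)
  note * = hasse_weil_factor_eq[OF s p card norm]
  show "summable (hasse_weil_term f2 s p)" by (rule *(1))
  show "hasse_weil_factor f2 s p = (if p = 2
      then inverse (1 - 4 * of_nat p powr (- s)) * inverse (1 - of_nat p powr (- s))
      else inverse (1 - of_nat p ^ 2 * of_nat p powr (- s)) * inverse (1 - of_nat p powr (- s)) ^ 2)"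
    unfolding *(2) by (simp add: L_def power_int_def)
qed

end

text \<open>The comparison at the prime 2 for \<open>f0\<close>, \<open>f1\<close>,
  \<open>f2\<close> in turn, with a = 1 - x, b = 1 - 2 x, d = 1 + 2 x, c = 1 - 4 x and x = 2^(-s).
  The last bracket on each right-hand side is the correction in the theorem.\<close>

lemma inverse_cancel_identities:
  fixes a b c d :: complex
  assumes "a \<noteq> 0" "b \<noteq> 0" "d \<noteq> 0"
  shows "inverse c * inverse a =
      inverse b * inverse a ^ 2 * inverse b ^ 2 * inverse c * (b ^ 3 * a)"
    and "inverse c * b * inverse a ^ 2 * inverse d =
      inverse (b * d) ^ 2 * inverse a ^ 3 * inverse c * (b ^ 3 * d * a)"
    and "inverse c * inverse a = inverse a ^ 2 * inverse c * a"
  using assms by (cases "c = 0"; simp add: power2_eq_square power3_eq_cube field_simps)+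

lemma hasse_weil_converges_and_zeta_eqI:
  assumes "\<And>p. Factorial_Ring.prime p \<Longrightarrow> summable (hasse_weil_term f s p)"
    and "G has_prod z" "\<And>p. Factorial_Ring.prime p \<Longrightarrow> hasse_weil_factor f s p = G p"
    and "\<And>p. \<not> Factorial_Ring.prime p \<Longrightarrow> G p = 1"
  shows "hasse_weil_converges f s \<and> hasse_weil_zeta f s = z"
proof -
  have "hasse_weil_factor f s p = G p" for p
    using assms(3,4) by (cases "Factorial_Ring.prime p") (auto simp: hasse_weil_factor_def)
  hence "hasse_weil_factor f s = G" by (rule ext)
  hence "hasse_weil_factor f s has_prod z" using assms(2) by simp
  thus ?thesis using assms(1)
    by (auto simp: hasse_weil_converges_def hasse_weil_zeta_def has_prod_iff)
qed

text \<open>Every right-hand side is itself an Euler product, so it suffices to compare local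
  factors: the odd primes agree term by term, and the powers of 2 form a product supported at the
  prime 2.\<close>

theorem mainTheorem1:
  fixes s :: complex
  assumes "Re s > 3"
  shows "(\<forall>f \<in> {f0, f1, f2}. hasse_weil_converges f s) \<and>
    hasse_weil_zeta f0 s =
      dedekind_zeta (quadratic_field 2) (s - 1) * riemann_zeta s ^ 2 * riemann_zeta (s - 1) ^ 2 *
      riemann_zeta (s - 2) * (1 - 2 powr (1 - s)) ^ 3 * (1 - 2 powr (- s)) \<and>
    hasse_weil_zeta f1 s =
      dedekind_zeta (quadratic_field 5) (s - 1) ^ 2 * riemann_zeta s ^ 3 * riemann_zeta (s - 2) *
      (1 - 2 powr (1 - s)) ^ 3 * (1 + 2 powr (1 - s)) * (1 - 2 powr (- s)) \<and>
    hasse_weil_zeta f2 s =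
      riemann_zeta s ^ 2 * riemann_zeta (s - 2) * (1 - 2 powr (- s))"
proof -
  note s = assms
  define E where "E u p = (if Factorial_Ring.prime p then inverse (1 - of_nat p powr (- u)) else 1)"
    for u :: complex and p :: nat
  define K where "K d p = (if Factorial_Ring.prime p then inverse ((1 - of_nat p powr (- (s - 1))) *
      (1 - of_int (splitting_character (int d) p) * of_nat p powr (- (s - 1)))) else 1)" for d p
  \<comment> \<open>Presents a constant as an Euler product whose only nontrivial factor sits at
    2.\<close>
  define C where "C c p = (if p = 2 then c else 1)" for c :: complex and p :: nat
  have E: "E u has_prod riemann_zeta u" if "Re u > 1" for u
    unfolding E_def using riemann_zeta_euler_product[OF that] .
  have E0: "E s has_prod riemann_zeta s" and E1: "E (s - 1) has_prod riemann_zeta (s - 1)"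
    and E2: "E (s - 2) has_prod riemann_zeta (s - 2)"
    using s by (auto intro: E)
  have K: "K d has_prod dedekind_zeta (quadratic_field d) (s - 1)" if "d = 2 \<or> d = 5" for d
    unfolding K_def using s that by (intro dedekind_zeta_euler_product) simp_all
  have C: "C c has_prod c" for c
    unfolding C_def using has_prod_single[of 2 "\<lambda>_. c"] by simp
  have prime2: "C c p = 1" if "\<not> Factorial_Ring.prime p" for c p
    using that by (auto simp: C_def)
  have x1: "of_nat p powr (- (s - 1)) = of_nat p * of_nat p powr (- s)"
    and x2: "of_nat p powr (- (s - 2)) = of_nat p ^ 2 * of_nat p powr (- s)"
    if p: "Factorial_Ring.prime p" for p
  proof -
    have p0: "(of_nat p :: complex) \<noteq> 0" using prime_gt_0_nat[OF p] by simp
    have "of_nat p powr (- (s - 1)) = of_nat p powr (1 + - s)" by simp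
    also have "\<dots> = of_nat p powr 1 * of_nat p powr (- s)" by (rule powr_add)
    finally show "of_nat p powr (- (s - 1)) = of_nat p * of_nat p powr (- s)" using p0 by simp
    have "of_nat p powr (- (s - 2)) = of_nat p powr (1 + (1 + - s))" by simp
    also have "\<dots> = of_nat p powr 1 * (of_nat p powr 1 * of_nat p powr (- s))" by (simp only: powr_add)
    finally show "of_nat p powr (- (s - 2)) = of_nat p ^ 2 * of_nat p powr (- s)"
      using p0 by (simp add: power2_eq_square)
  qed
  define x where "x = (2 powr (- s) :: complex)"
  have x1': "2 powr (1 - s) = 2 * x" using x1[of 2] by (simp add: x_def)
  have y1: "2 powr (- (s - 1)) = 2 * x" and y2: "2 powr (- (s - 2)) = 4 * x"
    using x1[of 2] x2[of 2] by (simp_all add: x_def del: minus_diff_eq)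
  \<comment> \<open>Ensures that 1 - x, 1 - 2 x and 1 + 2 x can be cancelled.\<close>
  have normx: "norm x < 1 / 2"
  proof -
    have "norm x = 2 powr (- Re s)" by (simp add: x_def norm_powr_real_powr)
    also have "\<dots> < 2 powr (- 1)" using s by (intro powr_less_mono) auto
    finally show ?thesis by (simp add: powr_minus)
  qed
  have ne: "1 - x \<noteq> 0" "1 - 2 * x \<noteq> 0" "1 + 2 * x \<noteq> 0"
  proof -
    have "norm x \<noteq> 1" "norm (2 * x) \<noteq> 1" using normx by (auto simp: norm_mult)
    thus "1 - x \<noteq> 0" "1 - 2 * x \<noteq> 0" "1 + 2 * x \<noteq> 0"
      by (metis norm_one right_minus_eq, metis norm_one right_minus_eq, metis add_eq_0_iff norm_minus_cancel norm_one)
  qed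
  have "hasse_weil_converges f0 s \<and> hasse_weil_zeta f0 s =
      dedekind_zeta (quadratic_field 2) (s - 1) * riemann_zeta s ^ 2 * riemann_zeta (s - 1) ^ 2 *
      riemann_zeta (s - 2) * ((1 - 2 * x) ^ 3 * (1 - x))"
  proof (rule hasse_weil_converges_and_zeta_eqI)
    show "(\<lambda>p. K 2 p * E s p ^ 2 * E (s - 1) p ^ 2 * E (s - 2) p * C ((1 - 2 * x) ^ 3 * (1 - x)) p) has_prod
        (dedekind_zeta (quadratic_field 2) (s - 1) * riemann_zeta s ^ 2 * riemann_zeta (s - 1) ^ 2 *
        riemann_zeta (s - 2) * ((1 - 2 * x) ^ 3 * (1 - x)))"
      by (intro has_prod_mult has_prod_power K E0 E1 E2 C) simp
    show "hasse_weil_factor f0 s p =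
        K 2 p * E s p ^ 2 * E (s - 1) p ^ 2 * E (s - 2) p * C ((1 - 2 * x) ^ 3 * (1 - x)) p"
      if p: "Factorial_Ring.prime p" for p
    proof (cases "p = 2")
      case True
      have "inverse (1 - 4 * x) * inverse (1 - x) = inverse (1 - 2 * x) * inverse (1 - x) ^ 2 *
          inverse (1 - 2 * x) ^ 2 * inverse (1 - 4 * x) * ((1 - 2 * x) ^ 3 * (1 - x))"
        by (rule inverse_cancel_identities[OF ne])
      thus ?thesis using p unfolding local_factor_f0(2)[OF s p] if_P[OF True]
        by (simp add: y1 y2 K_def E_def C_def True splitting_character_def
            del: minus_diff_eq flip: x_def)
    next
      case False
      thus ?thesis using p
        by (simp add: local_factor_f0(2)[OF s p] x1 x2 K_def E_def C_def splitting_character_def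
            power2_eq_square power3_eq_cube mult_ac del: minus_diff_eq)
    qed
  qed (use local_factor_f0(1)[OF s] prime2 in \<open>simp_all add: K_def E_def\<close>)
  moreover have "hasse_weil_converges f1 s \<and> hasse_weil_zeta f1 s =
      dedekind_zeta (quadratic_field 5) (s - 1) ^ 2 * riemann_zeta s ^ 3 * riemann_zeta (s - 2) *
      ((1 - 2 * x) ^ 3 * (1 + 2 * x) * (1 - x))"
  proof (rule hasse_weil_converges_and_zeta_eqI)
    show "(\<lambda>p. K 5 p ^ 2 * E s p ^ 3 * E (s - 2) p * C ((1 - 2 * x) ^ 3 * (1 + 2 * x) * (1 - x)) p) has_prod
        (dedekind_zeta (quadratic_field 5) (s - 1) ^ 2 * riemann_zeta s ^ 3 *
        riemann_zeta (s - 2) * ((1 - 2 * x) ^ 3 * (1 + 2 * x) * (1 - x)))"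
      by (intro has_prod_mult has_prod_power K E0 E1 E2 C) simp
    show "hasse_weil_factor f1 s p =
        K 5 p ^ 2 * E s p ^ 3 * E (s - 2) p * C ((1 - 2 * x) ^ 3 * (1 + 2 * x) * (1 - x)) p"
      if p: "Factorial_Ring.prime p" for p
    proof (cases "p = 2")
      case True
      have "inverse (1 - 4 * x) * (1 - 2 * x) * inverse (1 - x) ^ 2 * inverse (1 + 2 * x) =
          inverse ((1 - 2 * x) * (1 + 2 * x)) ^ 2 * inverse (1 - x) ^ 3 * inverse (1 - 4 * x) *
          ((1 - 2 * x) ^ 3 * (1 + 2 * x) * (1 - x))"
        by (rule inverse_cancel_identities[OF ne])
      thus ?thesis using p unfolding local_factor_f1(2)[OF s p] if_P[OF True]
        by (simp add: y1 y2 K_def E_def C_def True splitting_character_def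
            del: minus_diff_eq inverse_mult_distrib flip: x_def)
    next
      case False
      thus ?thesis using p
        by (simp add: local_factor_f1(2)[OF s p] x1 x2 K_def E_def C_def splitting_character_def
            power2_eq_square power3_eq_cube mult_ac del: minus_diff_eq)
    qed
  qed (use local_factor_f1(1)[OF s] prime2 in \<open>simp_all add: K_def E_def\<close>)
  moreover have "hasse_weil_converges f2 s \<and> hasse_weil_zeta f2 s =
      riemann_zeta s ^ 2 * riemann_zeta (s - 2) * (1 - x)"
  proof (rule hasse_weil_converges_and_zeta_eqI)
    show "(\<lambda>p. E s p ^ 2 * E (s - 2) p * C (1 - x) p) has_prod
        (riemann_zeta s ^ 2 * riemann_zeta (s - 2) * (1 - x))"
      by (intro has_prod_mult has_prod_power E0 E2 C)
    show "hasse_weil_factor f2 s p = E s p ^ 2 * E (s - 2) p * C (1 - x) p"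
      if p: "Factorial_Ring.prime p" for p
    proof (cases "p = 2")
      case True
      have "inverse (1 - 4 * x) * inverse (1 - x) = inverse (1 - x) ^ 2 * inverse (1 - 4 * x) * (1 - x)"
        by (rule inverse_cancel_identities[OF ne])
      thus ?thesis using p unfolding local_factor_f2(2)[OF s p] if_P[OF True]
        by (simp add: y2 E_def C_def True del: minus_diff_eq flip: x_def)
    next
      case False
      thus ?thesis using p
        by (simp add: local_factor_f2(2)[OF s p] x2 E_def C_def power2_eq_square mult_ac del: minus_diff_eq)
    qed
  qed (use local_factor_f2(1)[OF s] prime2 in \<open>simp_all add: E_def\<close>)
  ultimately show ?thesis unfolding x1' x_def[symmetric] by (simp add: mult.assoc)
qed

end
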